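(* Let $\lambda$ be a partition of $n$, and let $C_n$ act on $\mathrm{SYT}(\lambda)$ as described in the context (and diagonally on $\mathrm{SYT}(\lambda)\times\mathrm{SYT}(\lambda)$). (1) The action of $C_n$ on $\mathrm{SYT}(\lambda)$ is transitive. (2) If $\lambda$ is neither hook-shaped nor self-transpose, the action of $C_n$ on $\mathrm{SYT}(\lambda)$ is doubly transitive, i.e. $C_n$ acts transitively on the set of ordered pairs $(A,B)$ of distinct elements of $\mathrm{SYT}(\lambda)$. (3) If $\lambda$ is hook-shaped, then the only $C_n$-invariant of pairs is the number of shared first-row entries: two pairs $(A,B),(C,D)\in\mathrm{SYT}(\lambda)\times\mathrm{SYT}(\lambda)$ lie in the same $C_n$-orbit if and only if $|S_{A,B}|=|S_{C,D}|$, where $S_{A,B}$ is the set of numbers $k\in\{1,\dots,n\}$ lying in the first row of both $A$ and $B$. (4) If $\lambda$ is self-transpose, then the only $C_n$-invariant of pairs is whether the elements of the pair are different or not up to transposition: two pairs $(A,B),(C,D)\in\mathrm{SYT}(\lambda)\times\mathrm{SYT}(\lambda)$ lie in the same $C_n$-orbit if and only if ($A=B \Leftrightarrow C=D$) and ($A^T=B\Leftrightarrow C^T=D$).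
   Context: A partition $\lambda=(\lambda_1\ge\dots\ge\lambda_k>0)$ of $n$ is identified with its Young diagram, the set of boxes $(i,j)$ with $1\le i\le k$, $1\le j\le\lambda_i$ (row $i$, column $j$). A standard Young tableau of shape $\lambda$ is a bijection from the boxes to $\{1,\dots,n\}$ whose entries increase along each row (left to right) and down each column; $\mathrm{SYT}(\lambda)$ is the set of these. $\lambda^T$ is the transpose partition and $A^T\in\mathrm{SYT}(\lambda^T)$ the transpose tableau. $\lambda$ is hook-shaped if its diagram does not contain the box $(2,2)$; it is self-transpose if $\lambda=\lambda^T$. The cactus group $C_n$ is the group generated by $s_{[i,j]}$ for $1\le i<j\le n$ subject to $s_{[i,j]}^2=1$; $s_{[i,j]}s_{[k,l]}=s_{[k,l]}s_{[i,j]}$ if $[i,j]\cap[k,l]=\emptyset$; $s_{[i,j]}s_{[k,l]}s_{[i,j]}=s_{[i+j-l,i+j-k]}$ if $[k,l]\subseteq[i,j]$. It acts on $\mathrm{SYT}(\lambda)$ for each $\lambda\vdash n$ with $s_{[1,j]}$ acting by the Schützenberger involution (evacuation) of the subtableau formed by the entries $1,\dots,j$. The image of $C_n$ in the permutation group of $\mathrm{SYT}(\lambda)$ equals the group generated by the Bender–Knuth involutions $t_1,\dots,t_{n-1}$, where $t_i$ swaps the entries $i$ and $i+1$ if the result is still a standard Young tableau and does nothing otherwise.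
   Formalization: Part (4) is stated only for self-transpose λ that are not hook-shaped, since for self-transpose hooks such as (4,1,1,1) it contradicts (3): |S_{A,B}| takes four values, while (4) would allow only three orbits; such hooks are covered by (3). *)

theory Defs
  imports "HOL-Algebra.Group_Action"
begin

section \<open>Partitions and Young diagrams\<close>

definition partition_of :: "nat list \<Rightarrow> nat \<Rightarrow> bool" where
  "partition_of lam n \<longleftrightarrow>
     sorted_wrt (\<ge>) lam \<and> (\<forall>x\<in>set lam. 0 < x) \<and> sum_list lam = n"

text \<open>Boxes are pairs (row, column), both counted from 1, whereas list positions start at 0.\<close>

definition diagram :: "nat list \<Rightarrow> (nat \<times> nat) set" where
  "diagram lam = {(i, j). 1 \<le> i \<and> i \<le> length lam \<and> 1 \<le> j \<and> j \<le> lam ! (i - 1)}"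

definition transpose_partition :: "nat list \<Rightarrow> nat list" where
  "transpose_partition lam =
     map (\<lambda>j. card {i. (i, j) \<in> diagram lam}) [1..<Suc (card {j. (1, j) \<in> diagram lam})]"

definition self_transpose :: "nat list \<Rightarrow> bool" where
  "self_transpose lam \<longleftrightarrow> transpose_partition lam = lam"

definition hook_shaped :: "nat list \<Rightarrow> bool" where
  "hook_shaped lam \<longleftrightarrow> (2, 2) \<notin> diagram lam"


section \<open>Standard Young tableaux\<close>

text \<open>A filling is a total function on positions; the value 0 marks a position without an entry.
  In particular a tableau is 0 outside its diagram, so that tableaux are equal as functions
  iff they agree on the diagram.\<close>

type_synonym tableau = "nat \<times> nat \<Rightarrow> nat"

definition SYT :: "nat list \<Rightarrow> tableau set" where
  "SYT lam = {T.
     bij_betw T (diagram lam) {1..sum_list lam} \<and>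
     (\<forall>i j j'. (i, j) \<in> diagram lam \<longrightarrow> (i, j') \<in> diagram lam \<longrightarrow> j < j' \<longrightarrow> T (i, j) < T (i, j')) \<and>
     (\<forall>i i' j. (i, j) \<in> diagram lam \<longrightarrow> (i', j) \<in> diagram lam \<longrightarrow> i < i' \<longrightarrow> T (i, j) < T (i', j)) \<and>
     (\<forall>c. c \<notin> diagram lam \<longrightarrow> T c = 0)}"

definition transpose_tableau :: "tableau \<Rightarrow> tableau" where
  "transpose_tableau T = (\<lambda>(i, j). T (j, i))"

definition first_row :: "nat list \<Rightarrow> tableau \<Rightarrow> nat set" where
  "first_row lam T = {T (1, j) | j. (1, j) \<in> diagram lam}"

definition shared_first_row :: "nat list \<Rightarrow> tableau \<Rightarrow> tableau \<Rightarrow> nat set" where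
  "shared_first_row lam A B =
     {k \<in> {1..sum_list lam}. k \<in> first_row lam A \<and> k \<in> first_row lam B}"


section \<open>Evacuation\<close>

text \<open>One step of a jeu de taquin slide: the smaller of the entries to the right of and below the
  hole moves into the hole. Once both neighbours are empty, the step does nothing.\<close>

fun jdt_step :: "tableau \<times> nat \<times> nat \<Rightarrow> tableau \<times> nat \<times> nat" where
  "jdt_step (T, i, j) =
     (let a = T (i, j + 1); b = T (i + 1, j) in
      if a = 0 \<and> b = 0 then (T, i, j)
      else if b = 0 \<or> (a \<noteq> 0 \<and> a < b)
           then (T((i, j) := a, (i, j + 1) := 0), i, j + 1)
           else (T((i, j) := b, (i + 1, j) := 0), i + 1, j))"

text \<open>Delete the entry in the corner and slide the hole outwards; the result is the new filling
  together with the vacated box. For a filling with k entries the hole is stationary after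
  fewer than k steps.\<close>

definition jdt_slide :: "nat \<Rightarrow> tableau \<Rightarrow> tableau \<times> nat \<times> nat" where
  "jdt_slide k T = (jdt_step ^^ k) (T((1, 1) := 0), 1, 1)"

text \<open>Schuetzenberger's evacuation of a tableau with k entries: the box vacated by the first
  slide receives k, the one vacated by the second slide receives k - 1, and so on.\<close>

fun evacuation :: "nat \<Rightarrow> tableau \<Rightarrow> tableau" where
  "evacuation 0 T = (\<lambda>_. 0)"
| "evacuation (Suc k) T =
     (let (T', c) = jdt_slide (Suc k) T in (evacuation k T')(c := Suc k))"

definition partial_evacuation :: "nat \<Rightarrow> tableau \<Rightarrow> tableau" where
  "partial_evacuation m T =
     (\<lambda>c. if T c \<le> m then evacuation m (\<lambda>d. if T d \<le> m then T d else 0) c else T c)"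


section \<open>The cactus group\<close>

definition cactus_gens :: "nat \<Rightarrow> (nat \<times> nat) set" where
  "cactus_gens n = {(i, j). 1 \<le> i \<and> i < j \<and> j \<le> n}"

text \<open>The letter (i, j) stands for the generator of the interval from i to j. Since all generators
  are involutions, words in the generators without formal inverses suffice: the monoid with this
  presentation is already the group with this presentation.\<close>

inductive cactus_eq :: "nat \<Rightarrow> (nat \<times> nat) list \<Rightarrow> (nat \<times> nat) list \<Rightarrow> bool" for n where
  refl: "w \<in> lists (cactus_gens n) \<Longrightarrow> cactus_eq n w w"
| sym: "cactus_eq n u v \<Longrightarrow> cactus_eq n v u"
| trans: "cactus_eq n u v \<Longrightarrow> cactus_eq n v w \<Longrightarrow> cactus_eq n u w"
| app: "cactus_eq n u u' \<Longrightarrow> cactus_eq n v v' \<Longrightarrow> cactus_eq n (u @ v) (u' @ v')"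
| invol: "(i, j) \<in> cactus_gens n \<Longrightarrow> cactus_eq n [(i, j), (i, j)] []"
| disj: "(i, j) \<in> cactus_gens n \<Longrightarrow> (k, l) \<in> cactus_gens n \<Longrightarrow> {i..j} \<inter> {k..l} = {} \<Longrightarrow>
    cactus_eq n [(i, j), (k, l)] [(k, l), (i, j)]"
| nested: "(i, j) \<in> cactus_gens n \<Longrightarrow> (k, l) \<in> cactus_gens n \<Longrightarrow> {k..l} \<subseteq> {i..j} \<Longrightarrow>
    cactus_eq n [(i, j), (k, l), (i, j)] [(i + j - l, i + j - k)]"

definition cactus_class :: "nat \<Rightarrow> (nat \<times> nat) list \<Rightarrow> (nat \<times> nat) list set" where
  "cactus_class n w = {v. cactus_eq n w v}"

definition cactus_group :: "nat \<Rightarrow> (nat \<times> nat) list set monoid" where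
  "cactus_group n =
     \<lparr> carrier = cactus_class n ` lists (cactus_gens n),
       mult = (\<lambda>X Y. \<Union>u\<in>X. \<Union>v\<in>Y. cactus_class n (u @ v)),
       one = cactus_class n [] \<rparr>"

definition cactus_gen :: "nat \<Rightarrow> nat \<Rightarrow> nat \<Rightarrow> (nat \<times> nat) list set" where
  "cactus_gen n i j = cactus_class n [(i, j)]"

lemma cactus_eq_lists:
  "cactus_eq n u v \<Longrightarrow> u \<in> lists (cactus_gens n) \<and> v \<in> lists (cactus_gens n)"
  by (induction rule: cactus_eq.induct) (auto simp: cactus_gens_def)

lemma cactus_class_eq:
  assumes "u \<in> lists (cactus_gens n)"
  shows "cactus_class n u = cactus_class n v \<longleftrightarrow> cactus_eq n u v"
proof
  assume "cactus_class n u = cactus_class n v"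
  then have "cactus_eq n v u"
    using cactus_eq.refl[OF assms] unfolding cactus_class_def by blast
  then show "cactus_eq n u v" by (rule cactus_eq.sym)
next
  assume uv: "cactus_eq n u v"
  show "cactus_class n u = cactus_class n v"
    unfolding cactus_class_def
    using cactus_eq.trans[OF uv] cactus_eq.trans[OF cactus_eq.sym[OF uv]] by blast
qed

lemma cactus_mult:
  assumes "u \<in> lists (cactus_gens n)" "v \<in> lists (cactus_gens n)"
  shows "cactus_class n u \<otimes>\<^bsub>cactus_group n\<^esub> cactus_class n v = cactus_class n (u @ v)"
proof -
  have "cactus_class n (a @ b) = cactus_class n (u @ v)"
    if "a \<in> cactus_class n u" "b \<in> cactus_class n v" for a b
  proof -
    have "cactus_eq n (u @ v) (a @ b)"
      using that by (simp add: cactus_class_def cactus_eq.app)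
    then show ?thesis
      using cactus_class_eq[of "u @ v" n "a @ b"] assms by simp
  qed
  moreover have "u \<in> cactus_class n u" "v \<in> cactus_class n v"
    using assms by (simp_all add: cactus_class_def cactus_eq.refl)
  ultimately have "(\<Union>a\<in>cactus_class n u. \<Union>b\<in>cactus_class n v. cactus_class n (a @ b)) =
      cactus_class n (u @ v)"
    by blast
  then show ?thesis
    by (simp add: cactus_group_def)
qed

lemma cactus_rev:
  "w \<in> lists (cactus_gens n) \<Longrightarrow> cactus_eq n (rev w @ w) []"
proof (induction w)
  case Nil
  then show ?case by (simp add: cactus_eq.refl)
next
  case (Cons x w)
  obtain i j where x: "x = (i, j)" by (cases x)
  have w: "w \<in> lists (cactus_gens n)" "rev w \<in> lists (cactus_gens n)" "(i, j) \<in> cactus_gens n"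
    using Cons.prems x by auto
  have "cactus_eq n (rev w @ ([x, x] @ w)) (rev w @ ([] @ w))"
    unfolding x
    by (rule cactus_eq.app[OF cactus_eq.refl[OF w(2)]
          cactus_eq.app[OF cactus_eq.invol[OF w(3)] cactus_eq.refl[OF w(1)]]])
  then have "cactus_eq n (rev (x # w) @ x # w) (rev w @ w)"
    by simp
  then show ?case
    using Cons.IH[OF w(1)] by (rule cactus_eq.trans)
qed

lemma group_cactus_group: "group (cactus_group n)"
proof (rule groupI)
  show "\<one>\<^bsub>cactus_group n\<^esub> \<in> carrier (cactus_group n)"
    by (auto simp: cactus_group_def)
next
  fix x assume "x \<in> carrier (cactus_group n)"
  then obtain u where u: "u \<in> lists (cactus_gens n)" "x = cactus_class n u"
    by (auto simp: cactus_group_def)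
  have one: "\<one>\<^bsub>cactus_group n\<^esub> = cactus_class n []"
    by (simp add: cactus_group_def)
  show "\<one>\<^bsub>cactus_group n\<^esub> \<otimes>\<^bsub>cactus_group n\<^esub> x = x"
    using cactus_mult[of "[]" n u] u one by simp
  have r: "rev u \<in> lists (cactus_gens n)" using u by auto
  have "cactus_class n (rev u) \<otimes>\<^bsub>cactus_group n\<^esub> x = \<one>\<^bsub>cactus_group n\<^esub>"
    using cactus_mult[OF r u(1)] cactus_rev[OF u(1)] cactus_class_eq[of "rev u @ u" n "[]"]
      u r one by simp
  moreover have "cactus_class n (rev u) \<in> carrier (cactus_group n)"
    using r by (simp add: cactus_group_def)
  ultimately show "\<exists>y\<in>carrier (cactus_group n). y \<otimes>\<^bsub>cactus_group n\<^esub> x = \<one>\<^bsub>cactus_group n\<^esub>"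
    by blast
next
  fix x y assume "x \<in> carrier (cactus_group n)" "y \<in> carrier (cactus_group n)"
  then obtain u v where "u \<in> lists (cactus_gens n)" "x = cactus_class n u"
    "v \<in> lists (cactus_gens n)" "y = cactus_class n v"
    by (auto simp: cactus_group_def)
  then have "x \<otimes>\<^bsub>cactus_group n\<^esub> y = cactus_class n (u @ v)" "u @ v \<in> lists (cactus_gens n)"
    using cactus_mult by auto
  then show "x \<otimes>\<^bsub>cactus_group n\<^esub> y \<in> carrier (cactus_group n)"
    by (simp add: cactus_group_def)
next
  fix x y z
  assume "x \<in> carrier (cactus_group n)" "y \<in> carrier (cactus_group n)"
    "z \<in> carrier (cactus_group n)"
  then obtain u v w where "u \<in> lists (cactus_gens n)" "x = cactus_class n u"
    "v \<in> lists (cactus_gens n)" "y = cactus_class n v"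
    "w \<in> lists (cactus_gens n)" "z = cactus_class n w"
    by (auto simp: cactus_group_def)
  then show "x \<otimes>\<^bsub>cactus_group n\<^esub> y \<otimes>\<^bsub>cactus_group n\<^esub> z =
      x \<otimes>\<^bsub>cactus_group n\<^esub> (y \<otimes>\<^bsub>cactus_group n\<^esub> z)"
    using cactus_mult[of "u @ v" n w] cactus_mult[of u n "v @ w"] by (simp add: cactus_mult)
qed


section \<open>The action on tableaux and on pairs of tableaux\<close>

text \<open>An action is determined by these conditions: by the nested relation the generator of the
  interval from i to j is the conjugate of that of the interval from 1 to j - i + 1 by that
  of the interval from 1 to j.\<close>

definition cactus_SYT_action ::
    "nat \<Rightarrow> nat list \<Rightarrow> ((nat \<times> nat) list set \<Rightarrow> tableau \<Rightarrow> tableau) \<Rightarrow> bool" where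
  "cactus_SYT_action n lam \<phi> \<longleftrightarrow>
     group_action (cactus_group n) (SYT lam) \<phi> \<and>
     (\<forall>j T. 1 < j \<longrightarrow> j \<le> n \<longrightarrow> T \<in> SYT lam \<longrightarrow>
        \<phi> (cactus_gen n 1 j) T = partial_evacuation j T)"

definition diagonal_action :: "('g \<Rightarrow> 'a \<Rightarrow> 'a) \<Rightarrow> 'g \<Rightarrow> 'a \<times> 'a \<Rightarrow> 'a \<times> 'a" where
  "diagonal_action \<phi> g = (\<lambda>(A, B). (\<phi> g A, \<phi> g B))"

end

theory Submission
  imports Defs "HOL-Library.Multiset"
begin

text \<open>
  List the boxes of a standard tableau in decreasing order of their entries. The Bender-Knuth
  involutions become adjacent transpositions of this list, blocked when the two boxes share a row
  or a column, and the group they generate is the image of the cactus group: evacuation \<open>E\<^sub>j\<close> of the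
  entries up to \<open>j\<close> is \<open>E\<^sub>j\<^sub>-\<^sub>1\<close> after promotion \<open>p\<^sub>j\<close>, and \<open>p\<^sub>j = t\<^sub>j\<^sub>-\<^sub>1 p\<^sub>j\<^sub>-\<^sub>1\<close>.

  For hooks a tableau is a word in two letters (row or column), the involutions permute positions,
  and the orbit of a pair of words is determined by the multiset of pairs of letters.

  Otherwise one proves by induction on the size that all pairs \<open>(A, B)\<close> with \<open>A\<close> of shape \<open>S\<close>, \<open>B\<close> of
  shape \<open>R\<close>, not both hooks, and \<open>B \<noteq> A, A\<^sup>T\<close>, form one orbit. The pairs whose largest entries lie in
  fixed corners \<open>a\<close> of \<open>S\<close> and \<open>b\<close> of \<open>R\<close> form a block, connected by induction if \<open>S - a\<close> or \<open>R - b\<close>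
  is not a hook; exchanging the two largest entries links the blocks. Transposing one component commutes
  with everything, which halves the case distinctions.
\<close>


section \<open>Tableaux as lists of boxes\<close>

text \<open>With the largest entry first, a tableau is its top box followed by a tableau of the
  remaining shape, so a word for the smaller tableau lifts by adding one to every index
  (\<open>fold_sw_Cons\<close>), and the same lifted word serves both components of a pair. Two
  obstacles shape the induction. A block can be bad: if removing its two top boxes leaves
  \<open>(1, 1)\<close> in neither remainder, both remainders are hooks, for which genericity no
  longer determines the orbit in general, and the induction hypothesis is silent. And a link between
  blocks counts only if the tails are again generic, which can fail when the remainders agree up to
  transposition; the extreme case is the 2 by 2 square, whose only two tableaux are transposes of
  each other. Changing both top boxes at once is easy, because distinct corners are never aligned.
  Changing only one of them needs an exchange that is blocked in the other component, or a detour
  through further corners; this is where the case distinctions come from.\<close>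

type_synonym cell = "nat \<times> nat"

text \<open>For boxes carrying consecutive entries of a standard tableau, alignment amounts to
  adjacency, so it is exactly the case in which exchanging the two entries destroys
  standardness.\<close>

definition aligned :: "cell \<Rightarrow> cell \<Rightarrow> bool" where
  "aligned a b \<longleftrightarrow> fst a = fst b \<or> snd a = snd b"

definition shape :: "cell set \<Rightarrow> bool" where
  "shape S \<longleftrightarrow> finite S \<and> (\<forall>i j i' j'. (i, j) \<in> S \<longrightarrow> i' \<le> i \<longrightarrow> j' \<le> j \<longrightarrow> (i', j') \<in> S)"

definition corner :: "cell set \<Rightarrow> cell \<Rightarrow> bool" where
  "corner S c \<longleftrightarrow> c \<in> S \<and> (Suc (fst c), snd c) \<notin> S \<and> (fst c, Suc (snd c)) \<notin> S"

lemma aligned_sym: "aligned a b \<longleftrightarrow> aligned b a"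
  by (auto simp: aligned_def)

lemma aligned_refl [simp]: "aligned a a"
  by (simp add: aligned_def)

lemma aligned_swap [simp]: "aligned (prod.swap a) (prod.swap b) \<longleftrightarrow> aligned a b"
  by (auto simp: aligned_def)

lemma shape_finite: "shape S \<Longrightarrow> finite S"
  by (simp add: shape_def)

lemma shape_down: "shape S \<Longrightarrow> (i, j) \<in> S \<Longrightarrow> i' \<le> i \<Longrightarrow> j' \<le> j \<Longrightarrow> (i', j') \<in> S"
  unfolding shape_def by blast

lemma corner_in: "corner S c \<Longrightarrow> c \<in> S"
  by (simp add: corner_def)

lemma corner_max:
  assumes "shape S" "corner S (i, j)" "(i', j') \<in> S" "i \<le> i'" "j \<le> j'"
  shows "i' = i \<and> j' = j"
proof (rule ccontr)
  assume "\<not> ?thesis"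
  then have "Suc i \<le> i' \<and> j \<le> j' \<or> i \<le> i' \<and> Suc j \<le> j'" using assms(4,5) by auto
  then have "(Suc i, j) \<in> S \<or> (i, Suc j) \<in> S"
    using shape_down[OF assms(1,3)] by blast
  then show False using assms(2) by (simp add: corner_def)
qed

lemma shape_remove_corner:
  assumes "shape S" "corner S c" shows "shape (S - {c})"
proof -
  obtain i j where c: "c = (i, j)" by (cases c)
  show ?thesis unfolding shape_def
  proof (intro conjI allI impI)
    show "finite (S - {c})" using assms(1) by (simp add: shape_def)
    fix k l k' l' assume k: "(k, l) \<in> S - {c}" "k' \<le> k" "l' \<le> l"
    then have "(k', l') \<in> S" using shape_down[OF assms(1)] by blast
    moreover have "(k', l') \<noteq> c"
      using corner_max[OF assms(1) assms(2)[unfolded c], of k l] k c by auto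
    ultimately show "(k', l') \<in> S - {c}" by blast
  qed
qed

text \<open>A box of largest coordinate sum among those weakly below and to the right of
  \<open>(i, j)\<close> is a corner.\<close>

lemma corner_above:
  assumes "shape S" "(i, j) \<in> S"
  obtains k l where "corner S (k, l)" "i \<le> k" "j \<le> l"
proof -
  let ?T = "{(k, l) \<in> S. i \<le> k \<and> j \<le> l}"
  have f: "finite ((\<lambda>(k, l). k + l) ` ?T)"
    using shape_finite[OF assms(1)] by (auto intro: finite_subset)
  have ne: "(\<lambda>(k, l). k + l) ` ?T \<noteq> {}" using assms(2) by blast
  obtain p where p: "p \<in> ?T" "(\<lambda>(k, l). k + l) p = Max ((\<lambda>(k, l). k + l) ` ?T)"
    using Max_in[OF f ne] by (metis (no_types, lifting) imageE)
  obtain k l where kl: "p = (k, l)" by (cases p)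
  have mx: "k' + l' \<le> k + l" if "(k', l') \<in> ?T" for k' l'
    using Max_ge[OF f, of "k' + l'"] that p kl by force
  have "corner S (k, l)"
    unfolding corner_def using p kl mx[of "Suc k" l] mx[of k "Suc l"] by force
  then show thesis using that p kl by auto
qed

lemma shape_has_corner:
  assumes "shape S" "S \<noteq> {}" obtains c where "corner S c"
  using assms corner_above[OF assms(1)] by (metis ex_in_conv surj_pair)

lemma corners_not_aligned:
  assumes "shape S" "corner S a" "corner S b" "a \<noteq> b" shows "\<not> aligned a b"
proof
  assume al: "aligned a b"
  obtain i j k l where e: "a = (i, j)" "b = (k, l)" by (cases a, cases b)
  have "i \<le> k \<and> j \<le> l \<or> k \<le> i \<and> l \<le> j" using al e by (auto simp: aligned_def)
  then show False
    using corner_max[OF assms(1), of i j k l] corner_max[OF assms(1), of k l i j] assms(2-4) e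
      corner_in by blast
qed

lemma corner_remove:
  assumes "corner S b" "a \<noteq> b" shows "corner (S - {a}) b"
  using assms by (auto simp: corner_def)

lemma corner_unremove:
  assumes "shape S" "corner S a" "corner (S - {a}) b" "\<not> aligned a b" shows "corner S b"
  using assms by (auto simp: corner_def aligned_def)

lemma mem_swap [simp]: "(i, j) \<in> prod.swap ` S \<longleftrightarrow> (j, i) \<in> S"
  by force

lemma shape_swap: "shape S \<Longrightarrow> shape (prod.swap ` S)"
  unfolding shape_def by (simp only: mem_swap finite_imageI) blast

lemma corner_swap: "corner (prod.swap ` S) (prod.swap c) \<longleftrightarrow> corner S c"
  by (cases c) (auto simp: corner_def)

lemma swap_Diff: "prod.swap ` (S - {a}) = prod.swap ` S - {prod.swap a}"
  by (cases a) auto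

lemma card_swap: "card (prod.swap ` S) = card S"
  by (rule card_image) simp

lemma origin_in: "shape S \<Longrightarrow> S \<noteq> {} \<Longrightarrow> (0, 0) \<in> S"
  by (metis ex_in_conv le0 shape_down surj_pair)


text \<open>A standard tableau is represented by the list of its boxes (counted from 0) in decreasing
  order of their entries.\<close>

fun std :: "cell list \<Rightarrow> bool" where
  "std [] = True"
| "std (c # w) = (std w \<and> c \<notin> set w \<and> shape (insert c (set w)))"

definition Tab :: "cell set \<Rightarrow> cell list set" where
  "Tab S = {w. std w \<and> set w = S}"

lemma std_shape: "std w \<Longrightarrow> shape (set w)"
  by (cases w) (simp_all add: shape_def)

lemma std_distinct: "std w \<Longrightarrow> distinct w"
  by (induction w) auto

lemma Tab_shape: "w \<in> Tab S \<Longrightarrow> shape S"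
  using std_shape by (auto simp: Tab_def)

lemma Tab_length: "w \<in> Tab S \<Longrightarrow> length w = card S"
  using std_distinct distinct_card by (fastforce simp: Tab_def)

lemma std_corner: "std (c # w) \<Longrightarrow> corner (insert c (set w)) c"
  using std_shape[of w] shape_down[of "set w" _ _ "fst c" "snd c"]
  by (cases c) (fastforce simp: corner_def)

lemma Tab_Cons:
  assumes "shape S" shows "c # w \<in> Tab S \<longleftrightarrow> corner S c \<and> w \<in> Tab (S - {c})"
proof
  assume "c # w \<in> Tab S"
  then show "corner S c \<and> w \<in> Tab (S - {c})"
    using std_corner[of c w] by (auto simp: Tab_def)
next
  assume "corner S c \<and> w \<in> Tab (S - {c})"
  moreover from this have "insert c (S - {c}) = S" using corner_in by blast
  ultimately show "c # w \<in> Tab S" using assms by (auto simp: Tab_def)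
qed

lemma Tab_nonempty:
  assumes "shape S" shows "Tab S \<noteq> {}"
  using assms
proof (induction "card S" arbitrary: S)
  case 0
  then show ?case by (auto simp: shape_def Tab_def intro!: exI[of _ "[]"])
next
  case (Suc n)
  then have "S \<noteq> {}" by auto
  then obtain c where c: "corner S c" using shape_has_corner Suc.prems by blast
  have "card (S - {c}) = n" using Suc.hyps(2) corner_in[OF c] by simp
  then obtain w where "w \<in> Tab (S - {c})"
    using Suc.hyps(1) shape_remove_corner[OF Suc.prems c] by blast
  then have "c # w \<in> Tab S" using Tab_Cons[OF Suc.prems] c by blast
  then show ?case by blast
qed

text \<open>A missing box has a corner of \<open>S\<close> weakly below and to its right, which lies
  outside the down-closed \<open>V\<close> as well and can take the largest entry. This gives
  tableaux of a large shape with prescribed smallest entries.\<close>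

lemma Tab_extend:
  assumes "shape S" "w \<in> Tab V" "V \<subseteq> S"
  obtains e where "e @ w \<in> Tab S"
proof -
  have "\<exists>e. e @ w \<in> Tab S"
    using assms
  proof (induction "card (S - V)" arbitrary: S)
    case 0
    then have "S = V" using shape_finite by fastforce
    then show ?case using 0 by (metis append_Nil)
  next
    case (Suc n)
    then obtain i j where ij: "(i, j) \<in> S" "(i, j) \<notin> V"
      by (metis Diff_eq_empty_iff card.empty nat.distinct(1) subrelI)
    obtain k l where c: "corner S (k, l)" "i \<le> k" "j \<le> l"
      using corner_above[OF Suc.prems(1) ij(1)] .
    have nV: "(k, l) \<notin> V" using shape_down[OF Tab_shape[OF assms(2)]] ij c by blast
    have "S - {(k, l)} - V = (S - V) - {(k, l)}" by blast
    then have "card (S - {(k, l)} - V) = n"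
      using Suc.hyps(2) corner_in[OF c(1)] nV by simp
    then obtain e where "e @ w \<in> Tab (S - {(k, l)})"
      using Suc.hyps(1)[of "S - {(k, l)}"] shape_remove_corner[OF Suc.prems(1) c(1)] Suc.prems nV
      by blast
    then have "((k, l) # e) @ w \<in> Tab S" using Tab_Cons[OF Suc.prems(1)] c(1) by simp
    then show ?case by blast
  qed
  then show thesis using that by blast
qed

text \<open>On a list of length \<open>n\<close> this is the Bender-Knuth involution of the entries \<open>n - i - 1\<close> and \<open>n - i\<close>.\<close>

fun sw :: "nat \<Rightarrow> cell list \<Rightarrow> cell list" where
  "sw 0 (a # b # w) = (if aligned a b then a # b # w else b # a # w)"
| "sw (Suc i) (a # w) = a # sw i w"
| "sw 0 [a] = [a]"
| "sw i [] = []"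

lemma sw_sw [simp]: "sw i (sw i w) = w"
  by (induction i w rule: sw.induct) (auto simp: aligned_sym)

lemma length_sw [simp]: "length (sw i w) = length w"
  by (induction i w rule: sw.induct) auto

lemma set_sw [simp]: "set (sw i w) = set w"
  by (induction i w rule: sw.induct) auto

text \<open>If \<open>a\<close> and \<open>b\<close> are not aligned, \<open>a\<close> is not one of
  the two boxes that decide whether \<open>b\<close> is a corner, so the two can be removed in
  either order.\<close>

lemma std_sw: "std w \<Longrightarrow> std (sw i w)"
proof (induction i w rule: sw.induct)
  case (1 a b w)
  let ?S = "insert a (insert b (set w))"
  have S: "shape ?S" "corner ?S a" using 1 std_corner[of a "b # w"] by auto
  have eq: "?S - {a} = insert b (set w)" using 1 by auto
  have "std (b # a # w)" if "\<not> aligned a b"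
  proof -
    have "corner ?S b"
      using corner_unremove[OF S, unfolded eq] std_corner[of b w] 1 that by auto
    then have "shape (?S - {b})" using shape_remove_corner[OF S(1)] by blast
    moreover have "?S - {b} = insert a (set w)" using 1 by auto
    ultimately show ?thesis using 1 by (auto simp: insert_commute)
  qed
  then show ?case using 1 by auto
qed auto

lemma Tab_sw: "w \<in> Tab S \<Longrightarrow> sw i w \<in> Tab S"
  by (simp add: Tab_def std_sw)

lemma Tab_fold_sw: "w \<in> Tab S \<Longrightarrow> fold sw ws w \<in> Tab S"
  by (induction ws arbitrary: w) (simp_all add: Tab_sw)

lemma fold_sw_rev [simp]: "fold sw (rev ws) (fold sw ws w) = w"
  by (induction ws arbitrary: w) simp_all

lemma fold_sw_inj: "fold sw ws v = fold sw ws w \<Longrightarrow> v = w"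
  by (metis fold_sw_rev)

lemma fold_sw_Cons: "fold sw (map Suc ws) (a # w) = a # fold sw ws w"
  by (induction ws arbitrary: w) simp_all

section \<open>Transposition and simultaneous moves of pairs\<close>

abbreviation tr :: "cell list \<Rightarrow> cell list" where
  "tr \<equiv> map prod.swap"

lemma tr_tr [simp]: "tr (tr w) = w"
  by (induction w) auto

lemma sw_tr: "sw i (tr w) = tr (sw i w)"
  by (induction i w rule: sw.induct) (auto simp: aligned_def)

lemma fold_sw_tr: "fold sw ws (tr w) = tr (fold sw ws w)"
  by (induction ws arbitrary: w) (simp_all add: sw_tr)

lemma Tab_tr: "w \<in> Tab S \<Longrightarrow> tr w \<in> Tab (prod.swap ` S)"
proof -
  have "std w \<Longrightarrow> std (tr w)"
  proof (induction w)
    case (Cons c w)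
    then show ?case using shape_swap[of "insert c (set w)"] by (cases c) auto
  qed simp
  then show "w \<in> Tab S \<Longrightarrow> ?thesis" by (auto simp: Tab_def)
qed

definition conn :: "cell list \<Rightarrow> cell list \<Rightarrow> cell list \<Rightarrow> cell list \<Rightarrow> bool" where
  "conn A B C D \<longleftrightarrow> (\<exists>ws. fold sw ws A = C \<and> fold sw ws B = D)"

text \<open>Words act injectively and commute with \<open>tr\<close>, so equality and transposition
  of the two components survive every move; a generic pair is one with neither of these
  relations.\<close>

definition generic :: "cell list \<Rightarrow> cell list \<Rightarrow> bool" where
  "generic A B \<longleftrightarrow> A \<noteq> B \<and> tr A \<noteq> B"

lemma conn_refl [simp]: "conn A B A B"
  unfolding conn_def by (rule exI[of _ "[]"]) simp

lemma conn_sym: "conn A B C D \<Longrightarrow> conn C D A B"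
  unfolding conn_def using fold_sw_rev by blast

lemma conn_trans: "conn A B C D \<Longrightarrow> conn C D E F \<Longrightarrow> conn A B E F"
  unfolding conn_def by (metis comp_apply fold_append)

lemma conn_sw: "conn A B (sw i A) (sw i B)"
  unfolding conn_def by (rule exI[of _ "[i]"]) simp

lemma conn_Cons: "conn A B C D \<Longrightarrow> conn (a # A) (b # B) (a # C) (b # D)"
  unfolding conn_def using fold_sw_Cons by metis

lemma conn_flip: "conn A B C D \<Longrightarrow> conn B A D C"
  unfolding conn_def by blast

lemma conn_tr: "conn A B C D \<Longrightarrow> conn A (tr B) C (tr D)"
  unfolding conn_def by (metis fold_sw_tr)

lemma conn_tr': "conn A (tr B) C (tr D) \<Longrightarrow> conn A B C D"
  using conn_tr by fastforce

lemma generic_flip: "generic A B \<Longrightarrow> generic B A"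
  unfolding generic_def by auto

lemma generic_tr: "generic A B \<Longrightarrow> generic A (tr B)"
  unfolding generic_def by auto

lemma generic_conn: "conn A B C D \<Longrightarrow> generic A B \<Longrightarrow> generic C D"
  unfolding conn_def generic_def by (metis fold_sw_inj fold_sw_tr)

lemma conn_Tab: "conn A B C D \<Longrightarrow> A \<in> Tab S \<Longrightarrow> B \<in> Tab R \<Longrightarrow> C \<in> Tab S \<and> D \<in> Tab R"
  unfolding conn_def using Tab_fold_sw by blast

text \<open>If the largest entries lie in different corners \<open>a\<close> and \<open>c\<close>,
  each is still a corner after removal of the other. By induction both tableaux can be brought to
  have their two largest entries in \<open>a\<close> and \<open>c\<close>, with a common rest
  \<open>X\<close>, and one exchange joins them.\<close>

lemma Tab_connected:
  assumes "A \<in> Tab S" "C \<in> Tab S" shows "\<exists>ws. fold sw ws A = C"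
  using assms
proof (induction "card S" arbitrary: S A C)
  case 0
  then have "A = C" using Tab_length[of A S] Tab_length[of C S] by simp
  then show ?case by (intro exI[of _ "[]"]) simp
next
  case (Suc n)
  note S = Tab_shape[OF Suc.prems(1)]
  obtain a A' c C' where e: "A = a # A'" "C = c # C'"
    using Suc.hyps(2) Tab_length Suc.prems by (metis length_Suc_conv)
  have a: "corner S a" "A' \<in> Tab (S - {a})" and c: "corner S c" "C' \<in> Tab (S - {c})"
    using Suc.prems e Tab_Cons[OF S] by auto
  have cd: "card (S - {a}) = n" "card (S - {c}) = n"
    using Suc.hyps(2) corner_in a(1) c(1) by auto
  show ?case
  proof (cases "a = c")
    case True
    then obtain ws where "fold sw ws A' = C'" using Suc.hyps(1)[OF cd(1)[symmetric] a(2)] c by blast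
    then show ?thesis using fold_sw_Cons e True by blast
  next
    case False
    have ca: "corner (S - {a}) c" "corner (S - {c}) a" using corner_remove a c False by auto
    have sh: "shape (S - {a})" "shape (S - {c})" using shape_remove_corner[OF S] a c by auto
    obtain X where X: "X \<in> Tab (S - {a} - {c})"
      using Tab_nonempty[OF shape_remove_corner[OF sh(1) ca(1)]] by blast
    then have X': "X \<in> Tab (S - {c} - {a})" by (metis Diff_insert Diff_insert2)
    obtain ws where ws: "fold sw ws A' = c # X"
      using Suc.hyps(1)[OF cd(1)[symmetric] a(2)] Tab_Cons[OF sh(1)] ca X by blast
    obtain vs where vs: "fold sw vs (a # X) = C'"
      using Suc.hyps(1)[OF cd(2)[symmetric] _ c(2)] Tab_Cons[OF sh(2)] ca X' by blast
    have "fold sw (map Suc ws @ [0] @ map Suc vs) A = C"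
      using e ws vs corners_not_aligned[OF S a(1) c(1) False] by (simp add: fold_sw_Cons)
    then show ?thesis by blast
  qed
qed


section \<open>Linking blocks of pairs\<close>

abbreviation square2 :: "cell set" where
  "square2 \<equiv> {0, 1} \<times> {0, 1}"

lemma generic_Cons: "generic A B \<Longrightarrow> generic (a # A) (b # B)"
  by (auto simp: generic_def)

text \<open>The entry 2 lies to the right of or below the entry 1, and transposition exchanges these
  two boxes; hence a tableau with at least two boxes is never its own transpose.\<close>

lemma Tab_ends:
  assumes "w \<in> Tab S" "2 \<le> card S"
  obtains u where "w = u @ [(0, 1), (0, 0)]" | u where "w = u @ [(1, 0), (0, 0)]"
proof -
  have l: "2 \<le> length w" using assms Tab_length by simp
  then obtain u x y where w: "w = u @ [x, y]"
    by (metis One_nat_def Suc_1 append_Cons append_Nil append_assoc length_0_conv length_append_singleton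
        list.exhaust not_less_eq_eq rev_exhaust zero_le)
  have "std (u @ v) \<Longrightarrow> std v" for u v by (induction u) auto
  then have s: "std [x, y]" using assms(1) w unfolding Tab_def by blast
  then have y: "y = (0, 0)" using origin_in[of "{y}"] by simp
  obtain i j where x: "x = (i, j)" by (cases x)
  have sh: "shape {x, y}" using s by simp
  have dn: "i' \<le> i \<Longrightarrow> j' \<le> j \<Longrightarrow> (i', j') \<in> {x, y}" for i' j'
    by (rule shape_down[OF sh]) (use x in auto)
  have "x = (0, 1) \<or> x = (1, 0)"
    using dn[of i 0] dn[of 0 j] dn[of "i - 1" j] dn[of i "j - 1"] s x y by auto
  then show thesis using that w y by blast
qed

lemma Tab_tr_neq: "w \<in> Tab S \<Longrightarrow> 2 \<le> card S \<Longrightarrow> tr w \<noteq> w"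
  by (erule (1) Tab_ends) auto

text \<open>If the pair were transposed, the common tail would be its own transpose.\<close>

lemma generic_Cons_same:
  "w \<in> Tab S \<Longrightarrow> 2 \<le> card S \<Longrightarrow> a \<noteq> b \<Longrightarrow> generic (a # w) (b # w)"
  using Tab_tr_neq by (auto simp: generic_def)

lemma generic_Tab:
  assumes "A \<in> Tab S" "B \<in> Tab R" "R \<noteq> S" "R \<noteq> prod.swap ` S"
  shows "generic A B"
  using assms Tab_tr[OF assms(1)] by (auto simp: generic_def Tab_def)

text \<open>Apart from the square, such a shape contains \<open>(0, 2)\<close> or
  \<open>(2, 0)\<close>, hence up to transposition the hook with three boxes in its first row and
  one below. Two tableaux of this hook have the entry 2 in \<open>(0, 1)\<close> but differ in the
  entries 3 and 4; having the same entry 2 they are not transposes. A common extension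
  \<open>e\<close> keeps them generic.\<close>

lemma generic_pair_exists:
  assumes "shape U" "4 \<le> card U" "(0, 1) \<in> U" "(1, 0) \<in> U" "U \<noteq> square2"
  obtains X Y where "X \<in> Tab U" "Y \<in> Tab U" "generic X Y"
proof -
  have main: "\<exists>X Y. X \<in> Tab U \<and> Y \<in> Tab U \<and> generic X Y"
    if U: "shape U" "(0, 2) \<in> U" "(1, 0) \<in> U" for U
  proof -
    let ?v = "[(1, 0), (0, 2), (0, 1), (0, 0)] :: cell list"
    let ?w = "[(0, 2), (1, 0), (0, 1), (0, 0)] :: cell list"
    have shapes: "shape {(0, 0)}" "shape {(0, 1), (0, 0)}" "shape {(0, 2), (0, 1), (0, 0)}"
      "shape {(1, 0), (0, 1), (0, 0)}" "shape (set ?v)" "set ?w = set ?v"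
      by (auto simp: shape_def)
    then have v: "?v \<in> Tab (set ?v)" and w: "?w \<in> Tab (set ?v)"
      unfolding Tab_def by (simp_all del: One_nat_def)
    have sub: "set ?v \<subseteq> U" using U shape_down[OF U(1), of 0 2 0 1] shape_down[OF U(1), of 0 2 0 0] by auto
    obtain e where e: "e @ ?v \<in> Tab U" using Tab_extend[OF U(1) v sub] .
    have "set (e @ ?w) = set (e @ ?v)" by auto
    moreover have "std (e @ ?w)"
    proof -
      have "std (e @ ?w)" if "std (e @ ?v)" for e
        using that
      proof (induction e)
        case Nil
        then show ?case using w by (simp add: Tab_def)
      next
        case (Cons c e)
        have "set (e @ ?w) = set (e @ ?v)" by auto
        then show ?case using Cons by (simp del: set_append)
      qed
      then show ?thesis using e by (simp add: Tab_def)
    qed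
    ultimately have "e @ ?w \<in> Tab U" using e by (simp add: Tab_def)
    moreover have "generic (e @ ?v) (e @ ?w)" by (simp add: generic_def)
    ultimately show ?thesis using e by blast
  qed
  have "(0, 2) \<in> U \<or> (2, 0) \<in> U"
  proof (rule ccontr)
    assume n: "\<not> ?thesis"
    have "U \<subseteq> square2"
    proof
      fix p assume p: "p \<in> U"
      obtain i j where ij: "p = (i, j)" by (cases p)
      have "\<not> 2 \<le> i" "\<not> 2 \<le> j"
        using n p ij shape_down[OF assms(1), of i j 2 0] shape_down[OF assms(1), of i j 0 2] by auto
      then show "p \<in> square2" using ij by auto
    qed
    moreover have "card square2 = 4" by (simp add: card_cartesian_product)
    ultimately show False using assms(2,5) card_seteq[of square2 U] by simp
  qed
  then show thesis
  proof
    assume "(0, 2) \<in> U" then show thesis using main[OF assms(1)] assms(4) that by blast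
  next
    assume "(2, 0) \<in> U"
    then obtain X Y where "X \<in> Tab (prod.swap ` U)" "Y \<in> Tab (prod.swap ` U)" "generic X Y"
      using main[OF shape_swap[OF assms(1)]] assms(3) by auto
    moreover have "prod.swap ` prod.swap ` U = U" by (auto simp: image_image)
    ultimately have "tr X \<in> Tab U" "tr Y \<in> Tab U" "generic (tr X) (tr Y)"
      using Tab_tr[of X "prod.swap ` U"] Tab_tr[of Y "prod.swap ` U"] by (auto simp: generic_def)
    then show thesis using that by blast
  qed
qed

lemma square2_addable:
  assumes "shape (insert a square2)" "a \<notin> square2"
  shows "a = (0, 2) \<or> a = (2, 0)"
proof -
  obtain i j where a: "a = (i, j)" by (cases a)
  have dn: "i' \<le> i \<Longrightarrow> j' \<le> j \<Longrightarrow> (i', j') \<in> insert a square2" for i' j'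
    by (rule shape_down[OF assms(1)]) (use a in auto)
  have "i \<le> 1 \<or> j = 0 \<and> i = 2" "j \<le> 1 \<or> i = 0 \<and> j = 2"
    using dn[of "i - 1" j] dn[of i "j - 1"] dn[of i 0] dn[of 0 j] a by auto
  then show ?thesis using a assms(2) by auto
qed

text \<open>One witness is enough to join two whole blocks, provided that each is connected by the
  induction hypothesis. That hypothesis speaks of generic pairs only, which is why the tails have to
  be generic, not just the full lists.\<close>

definition linked :: "cell set \<Rightarrow> cell set \<Rightarrow> cell \<Rightarrow> cell \<Rightarrow> cell \<Rightarrow> cell \<Rightarrow> bool" where
  "linked S R a b a' b' \<longleftrightarrow> (\<exists>A B C D.
     A \<in> Tab (S - {a}) \<and> B \<in> Tab (R - {b}) \<and> generic A B \<and>
     C \<in> Tab (S - {a'}) \<and> D \<in> Tab (R - {b'}) \<and> generic C D \<and>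
     conn (a # A) (b # B) (a' # C) (b' # D))"

lemma linked_sym: "linked S R a b a' b' \<Longrightarrow> linked S R a' b' a b"
  unfolding linked_def using conn_sym by blast

lemma linked_flip: "linked S R a b a' b' \<Longrightarrow> linked R S b a b' a'"
  unfolding linked_def using conn_flip generic_flip by blast

lemma swap_swap_image [simp]: "prod.swap ` prod.swap ` S = S"
  by (auto simp: image_image)

lemma linked_tr:
  assumes "linked S (prod.swap ` R) a (prod.swap b) a' (prod.swap b')"
  shows "linked S R a b a' b'"
proof -
  obtain A B C D where h: "A \<in> Tab (S - {a})" "B \<in> Tab (prod.swap ` R - {prod.swap b})" "generic A B"
    "C \<in> Tab (S - {a'})" "D \<in> Tab (prod.swap ` R - {prod.swap b'})" "generic C D"
    "conn (a # A) (prod.swap b # B) (a' # C) (prod.swap b' # D)"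
    using assms unfolding linked_def by blast
  have "tr B \<in> Tab (R - {b})" "tr D \<in> Tab (R - {b'})"
    using Tab_tr[OF h(2)] Tab_tr[OF h(5)] by (simp_all add: swap_Diff)
  moreover have "conn (a # A) (b # tr B) (a' # C) (b' # tr D)"
    using conn_tr[OF h(7)] by simp
  ultimately show ?thesis unfolding linked_def using h generic_tr by blast
qed

lemma neighbours_11_not_corner:
  assumes "shape S" "(1, 1) \<in> S" "corner S a" shows "(0, 1) \<in> S - {a}" "(1, 0) \<in> S - {a}"
  using assms shape_down[OF assms(1,2), of 0 1] shape_down[OF assms(1,2), of 1 0]
  by (auto simp: corner_def)

text \<open>Put the two corners on top in both components: neither exchange is blocked, so the top
  boxes change together. What remains is to choose the rests \<open>X\<close> and \<open>Y\<close>
  such that the tails before and after are generic. This is free if the remaining shapes differ even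
  up to transposition, and follows from \<open>generic_pair_exists\<close> if they agree and are not
  the square. For the square, the boxes involved can only be \<open>(0, 2)\<close> and
  \<open>(2, 0)\<close>, and the choice is made by hand.\<close>

lemma linked_change_both:
  assumes S: "shape S" and R: "shape R" and n: "card S = card R" "6 \<le> card R"
    and a: "corner S a" "corner S a'" "a \<noteq> a'" and b: "corner R b" "corner R b'" "b \<noteq> b'"
    and g: "(1, 1) \<in> S \<union> R"
  shows "linked S R a b a' b'"
proof -
  let ?U = "S - {a} - {a'}"
  have S6: "6 \<le> card S" using n by simp
  have main: "linked S R a b a' b'"
    if R: "shape R" and n: "card S = card R" and b: "corner R b" "corner R b'" "b \<noteq> b'"
      and g: "(1, 1) \<in> S \<union> R" and V: "R - {b} - {b'} = ?U \<or>
      R - {b} - {b'} \<noteq> ?U \<and> R - {b} - {b'} \<noteq> prod.swap ` ?U" for R b b'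
  proof -
    let ?V = "R - {b} - {b'}"
    have na: "\<not> aligned a a'" "\<not> aligned b b'"
      using corners_not_aligned[OF S a] corners_not_aligned[OF R b] by auto
    have ca: "corner (S - {a}) a'" "corner (S - {a'}) a" "corner (R - {b}) b'" "corner (R - {b'}) b"
      using corner_remove a b by auto
    note sh = shape_remove_corner[OF S a(1)] shape_remove_corner[OF S a(2)]
      shape_remove_corner[OF R b(1)] shape_remove_corner[OF R b(2)]
    have shU: "shape ?U" "shape ?V"
      using shape_remove_corner[OF sh(1) ca(1)] shape_remove_corner[OF sh(3) ca(3)] .
    have cU: "card ?U = card S - 2" "card ?V = card S - 2"
      using n corner_in ca a b by (simp_all add: card_Diff_singleton)
    have fin: "linked S R a b a' b'" if X: "X \<in> Tab ?U" and Y: "Y \<in> Tab ?V"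
      and g: "generic (a' # X) (b' # Y)" "generic (a # X) (b # Y)" for X Y
    proof -
      have t: "a' # X \<in> Tab (S - {a})" "a # X \<in> Tab (S - {a'})"
        "b' # Y \<in> Tab (R - {b})" "b # Y \<in> Tab (R - {b'})"
        using X Y ca Tab_Cons sh by (metis Diff_insert Diff_insert2)+
      have "conn (a # a' # X) (b # b' # Y) (a' # a # X) (b' # b # Y)"
        using conn_sw[of "a # a' # X" "b # b' # Y" 0] na by simp
      then show ?thesis unfolding linked_def using t g by blast
    qed
    show ?thesis
    proof (cases "?V = ?U")
      case False
      obtain X Y where X: "X \<in> Tab ?U" "Y \<in> Tab ?V" using Tab_nonempty shU by blast
      then have "generic X Y" using generic_Tab V False by blast
      then show ?thesis using fin[OF X] generic_Cons by blast
    next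
      case VU: True
      have r: "(0, 1) \<in> ?U" "(1, 0) \<in> ?U"
        using g neighbours_11_not_corner[OF S _ a(1)] neighbours_11_not_corner[OF S _ a(2)]
          neighbours_11_not_corner[OF R _ b(1)] neighbours_11_not_corner[OF R _ b(2)] VU by blast+
      show ?thesis
      proof (cases "?U = square2")
        case False
        obtain X Y where "X \<in> Tab ?U" "Y \<in> Tab ?U" "generic X Y"
        proof (rule generic_pair_exists[OF shU(1) _ r False])
          show "4 \<le> card ?U" using cU S6 by linarith
        qed
        then show ?thesis using fin[of X Y] generic_Cons VU by simp
      next
        case True
        have "insert a' ?U = S - {a}" "insert a ?U = S - {a'}" "insert b' ?V = R - {b}" "insert b ?V = R - {b'}"
          using ca corner_in by blast+
        then have ad: "a = (0, 2) \<or> a = (2, 0)" "a' = (0, 2) \<or> a' = (2, 0)"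
          "b = (0, 2) \<or> b = (2, 0)" "b' = (0, 2) \<or> b' = (2, 0)"
          using square2_addable sh VU True by (metis Diff_iff insertI1)+
        obtain X where X: "X \<in> Tab ?U" using Tab_nonempty shU by blast
        have c2: "2 \<le> card ?U" using cU S6 by simp
        show ?thesis
        proof (cases "a = b")
          case False
          then have "a' \<noteq> b'" using ad a b by auto
          then show ?thesis using fin[of X X] X VU generic_Cons_same[OF X c2] False by simp
        next
          case ab: True
          have "prod.swap ` ?U = ?U" unfolding True by auto
          then have X': "tr X \<in> Tab ?U" using Tab_tr[OF X] by simp
          have "tr X \<noteq> X" using Tab_tr_neq[OF X c2] .
          then have "generic (a' # X) (b' # tr X)" "generic (a # X) (b # tr X)"
            unfolding generic_def using ad ab a b by auto
          then show ?thesis using fin[of X "tr X"] X X' VU by simp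
        qed
      qed
    qed
  qed
  show ?thesis
  proof (cases "R - {b} - {b'} = prod.swap ` ?U \<and> R - {b} - {b'} \<noteq> ?U")
    case False
    then have "R - {b} - {b'} = ?U \<or> R - {b} - {b'} \<noteq> ?U \<and> R - {b} - {b'} \<noteq> prod.swap ` ?U"
      by blast
    then show ?thesis by (rule main[OF R n(1) b g])
  next
    case True
    \<comment> \<open>Transposing the second component makes the two remaining shapes equal, a case
      already covered.\<close>
    have "linked S (prod.swap ` R) a (prod.swap b) a' (prod.swap b')"
    proof (rule main)
      show "prod.swap ` R - {prod.swap b} - {prod.swap b'} = ?U \<or>
        prod.swap ` R - {prod.swap b} - {prod.swap b'} \<noteq> ?U \<and>
        prod.swap ` R - {prod.swap b} - {prod.swap b'} \<noteq> prod.swap ` ?U"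
        using True by (metis swap_Diff swap_swap_image)
    qed (use R n b g in \<open>auto simp: shape_swap card_swap corner_swap dest: arg_cong[of _ _ prod.swap]\<close>)
    then show ?thesis by (rule linked_tr)
  qed
qed

text \<open>With \<open>a\<close>, \<open>a'\<close> on top of one component and \<open>b\<close>,
  \<open>d\<close> on top of the other, the exchange acts on the first and is blocked on the second.
  The rests must then be generic themselves, which two squares cannot provide; hence the exclusion
  \<open>ne\<close>.\<close>

lemma linked_change_first:
  assumes S: "shape S" and R: "shape R" and n: "card S = card R" "6 \<le> card R"
    and a: "corner S a" "corner S a'" "a \<noteq> a'" and b: "corner R b"
    and d: "corner (R - {b}) d" "aligned b d"
    and g: "(1, 1) \<in> (S - {a}) \<union> (R - {b})"
    and ne: "\<not> (S - {a} - {a'} = square2 \<and> R - {b} - {d} = square2)"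
  shows "linked S R a b a' b"
proof -
  let ?U = "S - {a} - {a'}"
  have S6: "6 \<le> card S" using n by simp
  have main: "linked S R a b a' b"
    if R: "shape R" and n: "card S = card R" and b: "corner R b"
      and d: "corner (R - {b}) d" "aligned b d"
      and g: "(1, 1) \<in> (S - {a}) \<union> (R - {b})"
      and ne: "\<not> (S - {a} - {a'} = square2 \<and> R - {b} - {d} = square2)"
      and V: "R - {b} - {d} = ?U \<or> R - {b} - {d} \<noteq> ?U \<and> R - {b} - {d} \<noteq> prod.swap ` ?U" for R b d
  proof -
    let ?V = "R - {b} - {d}"
    have na: "\<not> aligned a a'" using corners_not_aligned[OF S a] .
    have ca: "corner (S - {a}) a'" "corner (S - {a'}) a" using corner_remove a by auto
    note sh = shape_remove_corner[OF S a(1)] shape_remove_corner[OF S a(2)]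
      shape_remove_corner[OF R b]
    have shU: "shape ?U" "shape ?V"
      using shape_remove_corner[OF sh(1) ca(1)] shape_remove_corner[OF sh(3) d(1)] .
    have cU: "card ?U = card S - 2"
      using corner_in ca a by (simp add: card_Diff_singleton)
    have fin: "linked S R a b a' b" if X: "X \<in> Tab ?U" and Y: "Y \<in> Tab ?V"
      and g: "generic X Y" for X Y
    proof -
      have t: "a' # X \<in> Tab (S - {a})" "a # X \<in> Tab (S - {a'})" "d # Y \<in> Tab (R - {b})"
        using X Y ca d Tab_Cons sh by (metis Diff_insert Diff_insert2)+
      have "conn (a # a' # X) (b # d # Y) (a' # a # X) (b # d # Y)"
        using conn_sw[of "a # a' # X" "b # d # Y" 0] na d(2) by simp
      then show ?thesis unfolding linked_def using t g generic_Cons by blast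
    qed
    show ?thesis
    proof (cases "?V = ?U")
      case False
      obtain X Y where X: "X \<in> Tab ?U" "Y \<in> Tab ?V" using Tab_nonempty shU by blast
      then have "generic X Y" using generic_Tab V False by blast
      then show ?thesis using fin[OF X] by blast
    next
      case VU: True
      have r: "(0, 1) \<in> ?U" "(1, 0) \<in> ?U"
      proof -
        have "(0, 1) \<in> ?U \<and> (1, 0) \<in> ?U"
        using g
      proof
        assume g: "(1, 1) \<in> S - {a}"
        show "(0, 1) \<in> ?U \<and> (1, 0) \<in> ?U"
          using neighbours_11_not_corner[OF sh(1) g ca(1)] by simp
      next
        assume g: "(1, 1) \<in> R - {b}"
        show "(0, 1) \<in> ?U \<and> (1, 0) \<in> ?U"
          using neighbours_11_not_corner[OF sh(3) g d(1)] VU by simp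
      qed
      then show "(0, 1) \<in> ?U" "(1, 0) \<in> ?U" by auto
      qed
      obtain X Y where "X \<in> Tab ?U" "Y \<in> Tab ?U" "generic X Y"
      proof (rule generic_pair_exists[OF shU(1) _ r])
        show "4 \<le> card ?U" using cU S6 by linarith
        show "?U \<noteq> square2" using ne VU by blast
      qed
      then show ?thesis using fin[of X Y] VU by simp
    qed
  qed
  show ?thesis
  proof (cases "R - {b} - {d} = prod.swap ` ?U \<and> R - {b} - {d} \<noteq> ?U")
    case False
    then have "R - {b} - {d} = ?U \<or> R - {b} - {d} \<noteq> ?U \<and> R - {b} - {d} \<noteq> prod.swap ` ?U"
      by blast
    then show ?thesis by (rule main[OF R n(1) b d g ne])
  next
    case True
    have eq: "prod.swap ` R - {prod.swap b} - {prod.swap d} = prod.swap ` (R - {b} - {d})"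
      "prod.swap ` R - {prod.swap b} = prod.swap ` (R - {b})"
      by (simp_all add: swap_Diff)
    have sq: "prod.swap ` square2 = square2" by auto
    have "linked S (prod.swap ` R) a (prod.swap b) a' (prod.swap b)"
    proof (rule main[where d = "prod.swap d"])
      show "prod.swap ` R - {prod.swap b} - {prod.swap d} = ?U \<or>
        prod.swap ` R - {prod.swap b} - {prod.swap d} \<noteq> ?U \<and>
        prod.swap ` R - {prod.swap b} - {prod.swap d} \<noteq> prod.swap ` ?U"
        unfolding eq(1) using True by (metis swap_swap_image)
      show "\<not> (?U = square2 \<and> prod.swap ` R - {prod.swap b} - {prod.swap d} = square2)"
        unfolding eq(1) using ne sq by (metis swap_swap_image)
      show "(1, 1) \<in> (S - {a}) \<union> (prod.swap ` R - {prod.swap b})" unfolding eq(2) using g by auto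
      show "corner (prod.swap ` R - {prod.swap b}) (prod.swap d)" unfolding eq(2) using d by (simp add: corner_swap)
    qed (use R n b d in \<open>auto simp: shape_swap card_swap corner_swap\<close>)
    then show ?thesis by (rule linked_tr)
  qed
qed


section \<open>Orbits of pairs of tableaux of non-hook shape\<close>

text \<open>Different shapes of the two components are allowed because they arise in the induction even
  when one starts from equal shapes.\<close>

definition pairs_connected :: "nat \<Rightarrow> bool" where
  "pairs_connected n \<longleftrightarrow> (\<forall>S R A B C D. card S = n \<longrightarrow> card R = n \<longrightarrow> (1, 1) \<in> S \<union> R \<longrightarrow>
     A \<in> Tab S \<longrightarrow> C \<in> Tab S \<longrightarrow> B \<in> Tab R \<longrightarrow> D \<in> Tab R \<longrightarrow>
     generic A B \<longrightarrow> generic C D \<longrightarrow> conn A B C D)"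

text \<open>With \<open>5 \<le> n\<close> the shapes have at least six boxes, so removing two
  corners leaves the four boxes that \<open>generic_pair_exists\<close> asks for. This is why the
  induction starts at five.\<close>

locale block_step =
  fixes n :: nat and S R :: "cell set"
  assumes ok: "pairs_connected n" and n5: "5 \<le> n"
    and S: "shape S" and R: "shape R" and cS: "card S = Suc n" and cR: "card R = Suc n"
begin

lemma card_ge_6: "card S = card R" "6 \<le> card R"
  using cS cR n5 by auto

definition good :: "cell \<Rightarrow> cell \<Rightarrow> bool" where
  "good a b \<longleftrightarrow> (1, 1) \<in> (S - {a}) \<union> (R - {b})"

lemma block_conn:
  assumes "corner S a" "corner R b" "good a b"
    "A \<in> Tab (S - {a})" "C \<in> Tab (S - {a})" "B \<in> Tab (R - {b})" "D \<in> Tab (R - {b})"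
    "generic A B" "generic C D"
  shows "conn (a # A) (b # B) (a # C) (b # D)"
proof (rule conn_Cons)
  have "card (S - {a}) = n" "card (R - {b}) = n" using cS cR corner_in assms by auto
  then show "conn A B C D" using ok assms unfolding pairs_connected_def good_def by blast
qed

lemma linked_trans:
  assumes "linked S R a b c d" "linked S R c d e f" "corner S c" "corner R d" "good c d"
  shows "linked S R a b e f"
proof -
  obtain A B C D where 1: "A \<in> Tab (S - {a})" "B \<in> Tab (R - {b})" "generic A B"
     "C \<in> Tab (S - {c})" "D \<in> Tab (R - {d})" "generic C D"
     "conn (a # A) (b # B) (c # C) (d # D)"
    using assms(1) unfolding linked_def by blast
  obtain C' D' E F where 2: "C' \<in> Tab (S - {c})" "D' \<in> Tab (R - {d})" "generic C' D'"
     "E \<in> Tab (S - {e})" "F \<in> Tab (R - {f})" "generic E F"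
     "conn (c # C') (d # D') (e # E) (f # F)"
    using assms(2) unfolding linked_def by blast
  have "conn (c # C) (d # D) (c # C') (d # D')"
    using block_conn[OF assms(3-5)] 1 2 by blast
  then have "conn (a # A) (b # B) (e # E) (f # F)" using 1(7) 2(7) conn_trans by blast
  then show ?thesis unfolding linked_def using 1 2 by blast
qed

section \<open>Changing one top box while keeping the other\<close>

lemma linked_both:
  assumes "corner S a" "corner S a'" "a \<noteq> a'" "corner R b" "corner R b'" "b \<noteq> b'" "(1, 1) \<in> S \<union> R"
  shows "linked S R a b a' b'"
  using linked_change_both[OF S R card_ge_6 assms] .

lemma linked_first:
  assumes "corner S a" "corner S a'" "a \<noteq> a'" "corner R b" "corner (R - {b}) d" "aligned b d" "good a b"
    "\<not> (S - {a} - {a'} = square2 \<and> R - {b} - {d} = square2)"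
  shows "linked S R a b a' b"
  using linked_change_first[OF S R card_ge_6] assms good_def by blast

text \<open>When nothing blocks at \<open>b\<close>, another corner \<open>b'\<close> does the work:
  change both boxes to reach \<open>(a', b')\<close>, change only the first to reach
  \<open>(a, b')\<close>, and change both again to reach \<open>(a', b)\<close>.\<close>

lemma linked_first_via:
  assumes "corner S a" "corner S a'" "a \<noteq> a'" "corner R b" "corner R b'" "b' \<noteq> b"
    "corner (R - {b'}) d" "aligned b' d" "good a b'" "good a' b'"
    "\<not> (S - {a} - {a'} = square2 \<and> R - {b'} - {d} = square2)"
  shows "linked S R a b a' b"
proof -
  have g: "(1, 1) \<in> S \<union> R" using assms good_def by blast
  have "linked S R a b a' b'" "linked S R a b' a' b"
    using linked_both[OF _ _ _ _ _ _ g] assms by blast+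
  moreover have "linked S R a' b' a b'" using linked_first linked_sym assms by blast
  ultimately show ?thesis using linked_trans assms by blast
qed

text \<open>This is the case excluded from \<open>linked_change_first\<close>. Here \<open>R\<close>
  is the square with \<open>(0, 2)\<close> and one more box. If that box is \<open>(1, 2)\<close>,
  then \<open>(1, 1)\<close> can block in place of \<open>(0, 2)\<close> and the rest is no longer
  the square; if it is \<open>(0, 3)\<close>, the detour through the corner \<open>(1, 1)\<close>,
  blocked by \<open>(1, 0)\<close>, works.\<close>

lemma linked_first_square:
  assumes a: "corner S a" "corner S a'" "a \<noteq> a'" and b: "corner R b"
    and sq: "S - {a} - {a'} = square2" "R - {b} - {(0, 2)} = square2"
    and d: "corner (R - {b}) (0, 2)" "aligned b (0, 2)"
  shows "linked S R a b a' b"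
proof -
  have Rb: "R - {b} = insert (0, 2) square2" using sq(2) corner_in[OF d(1)] by blast
  then have Re: "R = insert b (insert (0, 2) square2)" using corner_in[OF b] by blast
  have g: "good a c" "good a' c" for c using sq(1) unfolding good_def by auto
  obtain i j where ij: "b = (i, j)" by (cases b)
  have dn: "i' \<le> i \<Longrightarrow> j' \<le> j \<Longrightarrow> (i', j') \<in> R" for i' j'
    by (rule shape_down[OF R]) (use corner_in[OF b] ij in auto)
  have nb: "b \<notin> insert (0, 2) square2" using Rb by blast
  have "b = (0, 3) \<or> b = (1, 2)"
    using d(2) unfolding aligned_def
  proof
    assume i: "fst b = fst ((0, 2) :: cell)"
    then have "3 \<le> j" using nb ij by auto
    then have "(0, 3) \<in> R" using dn by simp
    then show ?thesis using Re by auto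
  next
    assume j: "snd b = snd ((0, 2) :: cell)"
    then have "1 \<le> i" using nb ij by auto
    then have "(1, 2) \<in> R" using dn j ij by simp
    then show ?thesis using Re by auto
  qed
  then show ?thesis
  proof
    assume e: "b = (1, 2)"
    have "corner (R - {b}) (1, 1)" unfolding Rb by (auto simp: corner_def)
    moreover have "R - {b} - {(1, 1)} \<noteq> square2" by auto
    moreover have "aligned b (1, 1)" using e by (simp add: aligned_def)
    ultimately show ?thesis using linked_first[OF a b, of "(1, 1)"] g by blast
  next
    assume e: "b = (0, 3)"
    have R': "R = insert (0, 3) (insert (0, 2) square2)" using Re e by simp
    have "corner R (1, 1)" unfolding R' by (auto simp: corner_def)
    moreover have "corner (R - {(1, 1)}) (1, 0)" unfolding R' by (auto simp: corner_def)
    moreover have "R - {(1, 1)} - {(1, 0)} \<noteq> square2" by auto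
    moreover have "aligned (1, 1) (1, 0)" "(1, 1) \<noteq> b" using e by (simp_all add: aligned_def)
    ultimately show ?thesis using linked_first_via[OF a b, of "(1, 1)" "(1, 0)"] g by blast
  qed
qed

text \<open>If \<open>S\<close> is a hook, having \<open>(1, 1)\<close> on top of \<open>R\<close>
  gives a bad block, so this corner cannot serve in a detour between good blocks. Instead three
  consecutive exchanges act on the three largest entries: they reverse three corners of
  \<open>R\<close>, whereas in \<open>S\<close> the middle one is blocked by \<open>a2\<close> and
  the outer two cancel. Genericity is automatic, because only the tails on the \<open>R\<close> side
  contain \<open>(1, 1)\<close>.\<close>

lemma linked_second_hook:
  assumes a: "corner S a" "corner S a'" "a \<noteq> a'"
    and a2: "corner (S - {a} - {a'}) a2" "aligned a a2" and nS: "(1, 1) \<notin> S"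
    and b: "corner R b" "corner R b'" "corner R (1, 1)" "b \<noteq> b'" "b \<noteq> (1, 1)" "b' \<noteq> (1, 1)"
  shows "linked S R a b a b'"
proof -
  have c: "corner (S - {a}) a'" "corner (R - {b}) (1, 1)" "corner (R - {b'}) (1, 1)"
    "corner (R - {b} - {(1, 1)}) b'" "corner (R - {b'} - {(1, 1)}) b"
    using a b by (auto intro!: corner_remove)
  have s1: "shape (S - {a})" "shape (R - {b})" "shape (R - {b'})"
    using shape_remove_corner S R a b by blast+
  have s2: "shape (S - {a} - {a'})" "shape (R - {b} - {(1, 1)})" "shape (R - {b'} - {(1, 1)})"
    using shape_remove_corner[OF s1(1) c(1)] shape_remove_corner[OF s1(2) c(2)]
      shape_remove_corner[OF s1(3) c(3)] .
  have s3: "shape (S - {a} - {a'} - {a2})" "shape (R - {b} - {(1, 1)} - {b'})"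
    using shape_remove_corner[OF s2(1) a2(1)] shape_remove_corner[OF s2(2) c(4)] .
  obtain X Y where X: "X \<in> Tab (S - {a} - {a'} - {a2})" and Y: "Y \<in> Tab (R - {b} - {(1, 1)} - {b'})"
    using Tab_nonempty[OF s3(1)] Tab_nonempty[OF s3(2)] by blast
  have eq: "R - {b} - {(1, 1)} - {b'} = R - {b'} - {(1, 1)} - {b}" by blast
  have A: "a' # a2 # X \<in> Tab (S - {a})" using X a2(1) c(1) by (simp only: Tab_Cons[OF s1(1)] Tab_Cons[OF s2(1)])
  have B: "(1, 1) # b' # Y \<in> Tab (R - {b})" using Y c(2,4) by (simp only: Tab_Cons[OF s1(2)] Tab_Cons[OF s2(2)])
  have D: "(1, 1) # b # Y \<in> Tab (R - {b'})" using Y[unfolded eq] c(3,5) by (simp only: Tab_Cons[OF s1(3)] Tab_Cons[OF s2(3)])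
  have m: "(1, 1) \<in> R - {b}" "(1, 1) \<in> R - {b'}" "(1, 1) \<notin> S - {a}" "(1, 1) \<notin> prod.swap ` (S - {a})"
    using nS b by (auto simp: corner_def)
  have g: "generic (a' # a2 # X) ((1, 1) # b' # Y)" "generic (a' # a2 # X) ((1, 1) # b # Y)"
    using generic_Tab[OF A B] generic_Tab[OF A D] m by blast+
  have na: "\<not> aligned a a'" "\<not> aligned b (1, 1)" "\<not> aligned b b'" "\<not> aligned (1, 1) b'"
    using corners_not_aligned[OF S] corners_not_aligned[OF R] a b by auto
  have 1: "conn (a # a' # a2 # X) (b # (1, 1) # b' # Y) (a' # a # a2 # X) ((1, 1) # b # b' # Y)"
    using conn_sw[of "a # a' # a2 # X" "b # (1, 1) # b' # Y" 0] na by simp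
  have 2: "conn (a' # a # a2 # X) ((1, 1) # b # b' # Y) (a' # a # a2 # X) ((1, 1) # b' # b # Y)"
    using conn_sw[of "a' # a # a2 # X" "(1, 1) # b # b' # Y" "Suc 0"] na a2 by simp
  have 3: "conn (a' # a # a2 # X) ((1, 1) # b' # b # Y) (a # a' # a2 # X) (b' # (1, 1) # b # Y)"
    using conn_sw[of "a' # a # a2 # X" "(1, 1) # b' # b # Y" 0] na aligned_sym by auto
  have "conn (a # a' # a2 # X) (b # (1, 1) # b' # Y) (a # a' # a2 # X) (b' # (1, 1) # b # Y)"
    using 1 2 3 conn_trans by blast
  then show ?thesis unfolding linked_def using A B D g by blast
qed

text \<open>The two corners are the ends of the arm and the leg. If one of these has at least two
  boxes besides the origin, the box before its end becomes a corner once both ends are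
  removed.\<close>

lemma hook_corner_pred:
  assumes a: "corner S a" "corner S a'" "a \<noteq> a'" and nS: "(1, 1) \<notin> S"
  shows "(\<exists>c. corner (S - {a} - {a'}) c \<and> aligned a c) \<or> (\<exists>c. corner (S - {a'} - {a}) c \<and> aligned a' c)"
proof -
  have hk: "i = 0 \<or> j = 0" if "(i, j) \<in> S" for i j
    using shape_down[OF S that, of 1 1] nS by linarith
  have main: "(\<exists>c. corner (S - {a} - {a'}) c \<and> aligned a c) \<or> (\<exists>c. corner (S - {a'} - {a}) c \<and> aligned a' c)"
    if e: "a = (0, k)" "a' = (l, 0)" and a: "corner S a" "corner S a'" "a \<noteq> a'" for a a' k l
  proof -
    have "k \<noteq> 0" "l \<noteq> 0"
      using corner_max[OF S a(1)[unfolded e(1)] corner_in[OF a(2)[unfolded e(2)]]]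
        corner_max[OF S a(2)[unfolded e(2)] corner_in[OF a(1)[unfolded e(1)]]] a(3) e by auto
    have mx: "x \<le> l" if "(x, 0) \<in> S" for x
      using corner_max[OF S a(2)[unfolded e(2)], of x 0] that by linarith
    have my: "y \<le> k" if "(0, y) \<in> S" for y
      using corner_max[OF S a(1)[unfolded e(1)], of 0 y] that by linarith
    have "S \<subseteq> Pair 0 ` {..k} \<union> (\<lambda>x. (x, 0)) ` {1..l}"
    proof
      fix p assume p: "p \<in> S"
      obtain x y where xy: "p = (x, y)" by (cases p)
      show "p \<in> Pair 0 ` {..k} \<union> (\<lambda>x. (x, 0)) ` {1..l}"
        using hk[of x y] mx[of x] my[of y] p xy by (cases "x = 0") auto
    qed
    \<comment> \<open>Besides the origin there are at most \<open>k\<close> boxes in the arm and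
      \<open>l\<close> in the leg; six boxes in all force one of the two numbers to be at least
      two.\<close>
    then have "card S \<le> card (Pair (0::nat) ` {..k} \<union> (\<lambda>x. (x, 0::nat)) ` {1..l})"
      by (intro card_mono) auto
    also have "\<dots> \<le> card {..k} + card {1..l}"
      by (rule order_trans[OF card_Un_le add_mono]) (rule card_image_le, simp)+
    finally have "2 \<le> k \<or> 2 \<le> l" using cS n5 by simp linarith
    then show ?thesis
    proof
      assume k: "2 \<le> k"
      have "(0, k - 1) \<in> S" using shape_down[OF S, of 0 k] corner_in[OF a(1)] e by simp
      moreover have "(1, k - 1) \<notin> S" using hk[of 1 "k - 1"] k by auto
      ultimately have "corner (S - {a} - {a'}) (0, k - 1)"
        using e k by (auto simp: corner_def)
      then show ?thesis using e by (auto simp: aligned_def)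
    next
      assume l: "2 \<le> l"
      have "(l - 1, 0) \<in> S" using shape_down[OF S, of l 0] corner_in[OF a(2)] e by simp
      moreover have "(l - 1, 1) \<notin> S" using hk[of "l - 1" 1] l by auto
      ultimately have "corner (S - {a'} - {a}) (l - 1, 0)"
        using e l by (auto simp: corner_def)
      then show ?thesis using e by (auto simp: aligned_def)
    qed
  qed
  obtain i j i' j' where e: "a = (i, j)" "a' = (i', j')" by (cases a, cases a')
  have "i = 0 \<or> j = 0" "i' = 0 \<or> j' = 0" using hk a corner_in e by blast+
  moreover have "i \<noteq> i'" "j \<noteq> j'" using corners_not_aligned[OF S a] e by (auto simp: aligned_def)
  ultimately have "i = 0 \<and> j' = 0 \<or> i' = 0 \<and> j = 0" by auto
  then show ?thesis using main[of a j a' i'] main[of a' j' a i] a e by blast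
qed

text \<open>Changing both boxes three times leads from \<open>(a, b)\<close> through
  \<open>(a', b')\<close> and \<open>(a, b'')\<close> to \<open>(a', b)\<close>. The intermediate
  blocks must be good, and exchanging the roles of \<open>b'\<close> and \<open>b''\<close> arranges
  this unless \<open>S\<close> is a hook and one of them is \<open>(1, 1)\<close>; that case rests
  on \<open>linked_second_hook\<close>.\<close>

lemma linked_first_three_corners:
  assumes a: "corner S a" "corner S a'" "a \<noteq> a'"
    and b: "corner R b" "corner R b'" "corner R b''" "b \<noteq> b'" "b \<noteq> b''" "b' \<noteq> b''"
    and g: "good a b" "good a' b"
  shows "linked S R a b a' b"
proof -
  have g1: "(1, 1) \<in> S \<union> R" using g good_def by blast
  note cells = linked_both[OF _ _ _ _ _ _ g1]
  have sch: "linked S R a b a' b"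
    if b: "corner R b" "corner R b'" "corner R b''" "b \<noteq> b'" "b \<noteq> b''" "b' \<noteq> b''"
      and "good a' b'" "good a b''" for b' b''
  proof -
    have "linked S R a b a' b'" "linked S R a' b' a b''" "linked S R a b'' a' b"
      using cells a b by blast+
    then show ?thesis using linked_trans that a by blast
  qed
  show ?thesis
  proof (cases "(1, 1) \<in> S")
    case True
    have "good a' b' \<and> good a b'' \<or> good a' b'' \<and> good a b'"
      using g True a(3) b(6) unfolding good_def by auto
    then show ?thesis using sch b by blast
  next
    case False
    have hk: "linked S R a b a' b"
      if b: "corner R b" "corner R (1, 1)" "corner R b''" "b \<noteq> (1, 1)" "b \<noteq> b''" "(1, 1) \<noteq> b''" for b''
    proof -
      have gd: "good a b" "good a b''" "good a' b''" "good a' b"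
        using g that corner_in unfolding good_def by auto
      have l: "linked S R a b'' a' b" "linked S R a b a' b''" using cells a b by blast+
      have "linked S R a b a b'' \<or> linked S R a' b a' b''"
        using hook_corner_pred[OF a False] linked_second_hook[OF a(1,2,3) _ _ False b(1,3,2)]
          linked_second_hook[OF a(2,1) _ _ _ False b(1,3,2)] a b by (metis (no_types))
      then show ?thesis
      proof
        assume "linked S R a b a b''"
        then show ?thesis using l(1) linked_trans a b gd by blast
      next
        assume "linked S R a' b a' b''"
        then have "linked S R a' b a b" using linked_sym[OF l(2)] linked_trans a b gd by blast
        then show ?thesis by (rule linked_sym)
      qed
    qed
    show ?thesis
    proof (cases "(1, 1) \<in> {b', b''}")
      case True
      then show ?thesis using hk[of b'] hk[of b''] b g False unfolding good_def by auto
    next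
      case nb: False
      then have "good a' b'" "good a b''" using g1 False unfolding good_def by auto
      then show ?thesis using sch b by blast
    qed
  qed
qed

text \<open>Since \<open>(i - 1, 0)\<close> does not become a corner, row \<open>i - 1\<close> has a
  second box, and with only one further corner \<open>(r, s)\<close> the shape \<open>R\<close> is a
  rectangle with the single box \<open>(i, 0)\<close> below it. The detour goes through
  \<open>(r, s)\<close>, blocked by the box above it or, if the rectangle is one row, by the box to
  its left.\<close>

lemma linked_first_two_corners:
  assumes a: "corner S a" "corner S a'" "a \<noteq> a'"
    and b: "corner R (i, 0)"
    and nd: "\<And>d. corner (R - {(i, 0)}) d \<Longrightarrow> \<not> aligned (i, 0) d"
    and two: "\<And>c c'. corner R c \<Longrightarrow> corner R c' \<Longrightarrow> c \<noteq> (i, 0) \<Longrightarrow> c' \<noteq> (i, 0) \<Longrightarrow> c = c'"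
    and g: "good a (i, 0)" "good a' (i, 0)"
  shows "linked S R a (i, 0) a' (i, 0)"
proof -
  have i0: "i \<noteq> 0"
  proof
    assume "i = 0"
    then have "R \<subseteq> {(0, 0)}" using corner_max[OF R b] by auto
    then show False using card_mono[of "{(0, 0)}" R] card_ge_6 by simp
  qed
  have "(i - 1, 0) \<in> R" using shape_down[OF R corner_in[OF b], of "i - 1" 0] by simp
  moreover have "\<not> corner (R - {(i, 0)}) (i - 1, 0)" using nd[of "(i - 1, 0)"] by (auto simp: aligned_def)
  ultimately have r1: "(i - 1, 1) \<in> R" using i0 by (auto simp: corner_def)
  obtain r s where b': "corner R (r, s)" and rs: "i - 1 \<le> r" "1 \<le> s" using corner_above[OF R r1] .
  have rsR: "(r, s) \<in> R" using corner_in[OF b'] .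
  have ni: "(i, 1) \<notin> R" using b by (simp add: corner_def)
  have r: "r = i - 1"
    using shape_down[OF R rsR, of i 1] ni rs by linarith
  have Rsub: "x \<le> i - 1 \<and> y \<le> s \<or> x = i \<and> y = 0" if xy: "(x, y) \<in> R" for x y
  proof -
    obtain k l where kl: "corner R (k, l)" "x \<le> k" "y \<le> l" using corner_above[OF R xy] .
    show ?thesis
    proof (cases "(k, l) = (i, 0)")
      case True then show ?thesis using kl by auto
    next
      case False
      have "(r, s) \<noteq> (i, 0)" using rs by simp
      then have "(k, l) = (r, s)" using two kl(1) b' False by blast
      then show ?thesis using kl r by auto
    qed
  qed
  \<comment> \<open>For \<open>i = 1\<close> the box \<open>(1, 1)\<close> is not in
    \<open>R\<close>, so it must come from \<open>S\<close>; for larger \<open>i\<close> it stays in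
    \<open>R\<close> unless it is \<open>(r, s)\<close> itself.\<close>
  have gd: "good a (r, s)" "good a' (r, s)"
    if "2 \<le> i \<Longrightarrow> (r, s) \<noteq> (1, 1)"
  proof -
    have "(1, 1) \<in> R - {(r, s)} \<or> (1, 1) \<notin> R"
      using that Rsub[of 1 1] shape_down[OF R rsR, of 1 1] r by fastforce
    then show "good a (r, s)" "good a' (r, s)" using g unfolding good_def by auto
  qed
  show ?thesis
  proof (cases "2 \<le> i")
    case True
    have ne: "(r, s) \<noteq> (1, 1)"
    proof
      assume "(r, s) = (1, 1)"
      then have "R \<subseteq> {0, 1} \<times> {0, 1} \<union> {(2, 0)}" using Rsub r by fastforce
      then have "card R \<le> card ({0, 1} \<times> {0, 1} \<union> {(2::nat, 0::nat)})" by (intro card_mono) auto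
      also have "\<dots> = 5" by simp
      finally show False using card_ge_6 by simp
    qed
    have "(i - 2, s) \<in> R" using shape_down[OF R rsR, of "i - 2" s] r by simp
    moreover have "(i - 2, Suc s) \<notin> R" using Rsub[of "i - 2" "Suc s"] by auto
    moreover have "Suc (i - 2) = r" using r True by simp
    ultimately have d: "corner (R - {(r, s)}) (i - 2, s)" by (auto simp: corner_def r)
    have "R - {(r, s)} - {(i - 2, s)} \<noteq> square2"
    proof -
      have "(i, 0) \<in> R - {(r, s)} - {(i - 2, s)}" using corner_in[OF b] rs by simp
      moreover have "(i, 0) \<notin> square2" using True by simp
      ultimately show ?thesis by metis
    qed
    moreover have "aligned (r, s) (i - 2, s)" "(r, s) \<noteq> (i, 0)" using rs by (simp_all add: aligned_def)
    ultimately show ?thesis using linked_first_via[OF a b b' _ d] gd ne by blast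
  next
    case False
    then have i1: "i = 1" "r = 0" using i0 r by auto
    have "R \<subseteq> Pair 0 ` {..s} \<union> {(1, 0)}" using Rsub i1 by fastforce
    then have "card R \<le> card (Pair (0::nat) ` {..s} \<union> {(1, 0)})" by (intro card_mono) auto
    also have "\<dots> \<le> card (Pair (0::nat) ` {..s}) + card {(1::nat, 0::nat)}" by (rule card_Un_le)
    also have "\<dots> \<le> s + 2" using card_image_le[of "{..s}" "Pair (0::nat)"] by simp
    finally have s: "4 \<le> s" using card_ge_6 by simp
    have "(0, s - 1) \<in> R" using shape_down[OF R rsR, of 0 "s - 1"] by simp
    moreover have "(Suc 0, s - 1) \<notin> R" using Rsub[of 1 "s - 1"] i1 s by auto
    ultimately have d: "corner (R - {(r, s)}) (0, s - 1)" using s by (auto simp: corner_def i1)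
    have "(1, 1) \<notin> R" using Rsub[of 1 1] i1 by auto
    then have "R - {(r, s)} - {(0, s - 1)} \<noteq> square2" by blast
    moreover have "aligned (r, s) (0, s - 1)" "(r, s) \<noteq> (i, 0)" using rs i1 by (simp_all add: aligned_def)
    moreover have "\<not> 2 \<le> i" using i1 by simp
    ultimately show ?thesis using linked_first_via[OF a b b' _ d] gd by blast
  qed
qed

end


section \<open>Links between all good blocks\<close>

context block_step
begin

lemma block_step_tr: "block_step n S (prod.swap ` R)"
  by unfold_locales (use ok n5 S R cS cR in \<open>simp_all add: shape_swap card_swap\<close>)

lemma block_step_flip: "block_step n R S"
  by unfold_locales (use ok n5 S R cS cR in simp_all)

lemma good_tr: "block_step.good S (prod.swap ` R) a (prod.swap b) \<longleftrightarrow> good a b"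
  using block_step.good_def[OF block_step_tr, of a "prod.swap b"] unfolding good_def
  by (simp flip: swap_Diff)

lemma good_flip: "block_step.good R S b a \<longleftrightarrow> good a b"
  using block_step.good_def[OF block_step_flip] unfolding good_def by blast

text \<open>A box \<open>d\<close> that blocks at \<open>b\<close> gives the link at once, up to the
  exceptional squares. Without such a box there are either two further corners, or \<open>b\<close>
  lies in the first row or column and the shape is a rectangle with one extra box.\<close>

lemma linked_first_any:
  assumes a: "corner S a" "corner S a'" "a \<noteq> a'" and b: "corner R b" and g: "good a b" "good a' b"
  shows "linked S R a b a' b"
proof -
  interpret T: block_step n S "prod.swap ` R" by (rule block_step_tr)
  have bT: "corner (prod.swap ` R) (prod.swap b)" using b by (simp add: corner_swap)
  have gT: "T.good a (prod.swap b)" "T.good a' (prod.swap b)" using g good_tr by auto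
  have RT: "prod.swap ` R - {prod.swap b} = prod.swap ` (R - {b})" by (simp add: swap_Diff)
  show ?thesis
  proof (cases "\<exists>d. corner (R - {b}) d \<and> aligned b d")
    case True
    then obtain d where d: "corner (R - {b}) d" "aligned b d" by blast
    show ?thesis
    proof (cases "S - {a} - {a'} = square2 \<and> R - {b} - {d} = square2")
      case False
      then show ?thesis using linked_first[OF a b d g(1)] by blast
    next
      case sq: True
      have "insert d square2 = R - {b}" using sq corner_in[OF d(1)] by blast
      then have "d = (0, 2) \<or> d = (2, 0)"
        using square2_addable[of d] shape_remove_corner[OF R b] sq by (metis Diff_iff insertI1)
      then show ?thesis
      proof
        assume "d = (0, 2)"
        then show ?thesis using linked_first_square[OF a b] sq d by simp
      next
        assume d2: "d = (2, 0)"
        then have d': "prod.swap d = (0, 2)" by simp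
        have "prod.swap ` R - {prod.swap b} - {(0, 2)} = prod.swap ` (R - {b} - {d})"
          unfolding d'[symmetric] by (simp add: swap_Diff)
        also have "\<dots> = prod.swap ` square2" using sq by simp
        also have "\<dots> = square2" by auto
        finally have sq': "prod.swap ` R - {prod.swap b} - {(0, 2)} = square2" .
        have "corner (prod.swap ` R - {prod.swap b}) (prod.swap d)" "aligned (prod.swap b) (prod.swap d)"
          using d by (simp_all only: RT corner_swap aligned_swap)
        then have "linked S (prod.swap ` R) a (prod.swap b) a' (prod.swap b)"
          using T.linked_first_square[OF a bT _ sq'] sq unfolding d' by blast
        then show ?thesis by (rule linked_tr)
      qed
    qed
  next
    case nd: False
    show ?thesis
    proof (cases "\<exists>b' b''. corner R b' \<and> corner R b'' \<and> b \<noteq> b' \<and> b \<noteq> b'' \<and> b' \<noteq> b''")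
      case True
      then show ?thesis using linked_first_three_corners[OF a b _ _ _ _ _ g] by blast
    next
      case False
      then have two: "\<And>c c'. corner R c \<Longrightarrow> corner R c' \<Longrightarrow> c \<noteq> b \<Longrightarrow> c' \<noteq> b \<Longrightarrow> c = c'" by blast
      obtain i j where ij: "b = (i, j)" by (cases b)
      have "i = 0 \<or> j = 0"
      \<comment> \<open>Off the border, the left and the upper neighbour of \<open>b\<close> both
        exist. As neither becomes a corner when \<open>b\<close> is removed, there is a box below
        the left one and a box to the right of the upper one, and these lead to two different
        corners other than \<open>b\<close>.\<close>
      proof (rule ccontr)
        assume p: "\<not> ?thesis"
        have bR: "(i, j) \<in> R" using corner_in[OF b] ij by simp
        have "(i, j - 1) \<in> R" "(i - 1, j) \<in> R" using shape_down[OF R bR] by simp_all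
        moreover have "\<not> corner (R - {b}) (i, j - 1)" "\<not> corner (R - {b}) (i - 1, j)"
          using nd ij by (auto simp: aligned_def)
        ultimately have "(Suc i, j - 1) \<in> R" "(i - 1, Suc j) \<in> R"
          using p ij by (auto simp: corner_def)
        then obtain k l k' l' where c: "corner R (k, l)" "Suc i \<le> k" "j - 1 \<le> l"
          and c': "corner R (k', l')" "i - 1 \<le> k'" "Suc j \<le> l'"
          using corner_above[OF R] by metis
        have "(k, l) \<noteq> (k', l')"
          using corner_max[OF R b[unfolded ij] corner_in[OF c(1)]] c c' by auto
        then show False using two[OF c(1) c'(1)] ij c c' by auto
      qed
      then show ?thesis
      proof
        assume "j = 0"
        then show ?thesis using linked_first_two_corners[OF a, of i] b nd two g ij by blast
      next
        assume "i = 0"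
        then have e: "prod.swap b = (j, 0)" using ij by simp
        have "linked S (prod.swap ` R) a (j, 0) a' (j, 0)"
        proof (rule T.linked_first_two_corners[OF a])
          show "corner (prod.swap ` R) (j, 0)" using bT e by simp
          show "T.good a (j, 0)" "T.good a' (j, 0)" using gT e by simp_all
          fix d assume "corner (prod.swap ` R - {(j, 0)}) d"
          then have "corner (prod.swap ` (R - {b})) (prod.swap (prod.swap d))"
            using RT e by simp
          then have "corner (R - {b}) (prod.swap d)" by (simp only: corner_swap)
          then have "\<not> aligned b (prod.swap d)" using nd by blast
          then have "\<not> aligned (prod.swap b) (prod.swap (prod.swap d))" by (simp only: aligned_swap) simp
          then show "\<not> aligned (j, 0) d" using e by simp
        next
          fix c c' assume c: "corner (prod.swap ` R) c" "corner (prod.swap ` R) c'" "c \<noteq> (j, 0)" "c' \<noteq> (j, 0)"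
          have "corner R (prod.swap c)" "corner R (prod.swap c')"
            using c corner_swap[of R "prod.swap c"] corner_swap[of R "prod.swap c'"] by simp_all
          moreover have "prod.swap c \<noteq> b" "prod.swap c' \<noteq> b" using c e by auto
          ultimately have "prod.swap c = prod.swap c'" using two by blast
          then show "c = c'" by (metis swap_swap)
        qed
        then show ?thesis using linked_tr[of S R a b a' b] e by simp
      qed
    qed
  qed
qed

lemma all_linked:
  assumes "corner S a" "corner S a'" "corner R b" "corner R b'" "good a b" "good a' b'" "(a, b) \<noteq> (a', b')"
  shows "linked S R a b a' b'"
proof (cases "a = a'")
  case True
  interpret F: block_step n R S by (rule block_step_flip)
  have "linked R S b a b' a"
    using F.linked_first_any[of b b' a] assms True good_flip by auto
  then show ?thesis using linked_flip True by blast
next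
  case False
  show ?thesis
  proof (cases "b = b'")
    case True
    then show ?thesis using linked_first_any[OF assms(1,2) False] assms by blast
  next
    case nb: False
    have "(1, 1) \<in> S \<union> R" using assms(5) good_def by blast
    then show ?thesis using linked_both assms False nb by blast
  qed
qed

end

text \<open>A gap between the two boxes would have to be filled by \<open>T\<close>, contradicting
  that \<open>(i, j)\<close> is a corner. This also translates \<open>aligned\<close> into the
  neighbourhood inspected by a jeu de taquin step.\<close>

lemma aligned_addable:
  assumes "shape T" "corner T (i, j)" "shape (insert a T)" "a \<notin> T" "aligned a (i, j)"
  shows "a = (i, Suc j) \<or> a = (Suc i, j)"
proof -
  obtain x y where a: "a = (x, y)" by (cases a)
  have ij: "(i, j) \<in> T" using corner_in[OF assms(2)] .
  have dn: "x' \<le> x \<Longrightarrow> y' \<le> y \<Longrightarrow> (x', y') \<noteq> (x, y) \<Longrightarrow> (x', y') \<in> T" for x' y'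
    using shape_down[OF assms(3), of x y x' y'] a by auto
  have lt: "\<not> (x \<le> i \<and> y \<le> j)" using shape_down[OF assms(1) ij, of x y] assms(4) a by blast
  show ?thesis
  proof (cases "x = i")
    case True
    have "\<not> Suc j < y"
    proof
      assume "Suc j < y"
      then have "(i, Suc j) \<in> T" using dn[of i "Suc j"] True by simp
      then show False using assms(2) by (simp add: corner_def)
    qed
    then show ?thesis using lt True a by auto
  next
    case False
    then have y: "y = j" using assms(5) a by (simp add: aligned_def)
    have "\<not> Suc i < x"
    proof
      assume "Suc i < x"
      then have "(Suc i, j) \<in> T" using dn[of "Suc i" j] y by simp
      then show False using assms(2) by (simp add: corner_def)
    qed
    then show ?thesis using lt y a by auto
  qed
qed

lemma wide_or_tall:
  assumes "shape T" "5 \<le> card T" shows "(0, 2) \<in> T \<or> (2, 0) \<in> T"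
proof (rule ccontr)
  assume n: "\<not> ?thesis"
  have "T \<subseteq> square2"
  proof
    fix p assume p: "p \<in> T"
    obtain i j where ij: "p = (i, j)" by (cases p)
    have "\<not> 2 \<le> i" "\<not> 2 \<le> j"
      using n p ij shape_down[OF assms(1), of i j 2 0] shape_down[OF assms(1), of i j 0 2] by auto
    then show "p \<in> square2" using ij by auto
  qed
  then have "card T \<le> card square2" by (intro card_mono) auto
  then show False using assms(2) by simp
qed

text \<open>The end of an arm or leg reaching \<open>(0, 2)\<close> or \<open>(2, 0)\<close> shares
  neither row nor column with \<open>(1, 1)\<close>. Exchanging with it brings \<open>(1, 1)\<close>
  down from the top.\<close>

lemma corner_off_11:
  assumes T: "shape T" "5 \<le> card T" "(1, 1) \<notin> T"
  obtains c where "corner T c" "\<not> aligned (1, 1) c"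
proof -
  have ex: "\<exists>c. corner T c \<and> \<not> aligned (1, 1) c" if T: "shape T" "(0, 2) \<in> T" "(1, 1) \<notin> T" for T
  proof -
    obtain k l where c: "corner T (k, l)" "2 \<le> l" using corner_above[OF T(1,2)] .
    then have "k = 0" using shape_down[OF T(1) corner_in[OF c(1)], of 1 1] T(3) by linarith
    then have "\<not> aligned (1, 1) (k, l)" using c by (simp add: aligned_def)
    then show ?thesis using c by blast
  qed
  from wide_or_tall[OF T(1,2)] show thesis
  proof
    assume "(0, 2) \<in> T" then show thesis using ex T that by blast
  next
    assume "(2, 0) \<in> T"
    then obtain c where c: "corner (prod.swap ` T) c" "\<not> aligned (1, 1) c"
      using ex[of "prod.swap ` T"] shape_swap[OF T(1)] T(3) by auto
    have "corner T (prod.swap c)" using c(1) corner_swap[of T "prod.swap c"] by simp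
    moreover have "\<not> aligned (1, 1) (prod.swap c)" using c(2) by (auto simp: aligned_def)
    ultimately show thesis using that by blast
  qed
qed

text \<open>Start with a corner weakly below and to the right of \<open>(1, 1)\<close>. If both
  boxes are aligned with it, they are its right and its lower neighbour, and a corner further up and
  to the right is not aligned with the lower one. If the corner is \<open>(1, 1)\<close> and aligned
  with neither, take the corner at the end of the first row (or column): alignment of both boxes
  with it would put one of them into the second row (or column), aligned with
  \<open>(1, 1)\<close>.\<close>

lemma separating_corner:
  assumes T: "shape T" "5 \<le> card T" "(1, 1) \<in> T"
    and a: "shape (insert a T)" "a \<notin> T" and b: "shape (insert b T)" "b \<notin> T" and ab: "a \<noteq> b"
  obtains c where "corner T c" "\<not> (aligned a c \<and> aligned b c)"
    "c \<noteq> (1, 1) \<or> aligned a c \<or> aligned b c"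
proof -
  obtain i j where c0: "corner T (i, j)" "1 \<le> i" "1 \<le> j" using corner_above[OF T(1,3)] .
  show thesis
  proof (cases "aligned a (i, j) \<and> aligned b (i, j)")
    case True
    then have e: "a = (i, Suc j) \<and> b = (Suc i, j) \<or> a = (Suc i, j) \<and> b = (i, Suc j)"
      using aligned_addable[OF T(1) c0(1) a] aligned_addable[OF T(1) c0(1) b] ab by auto
    have "(i - 1, Suc j) \<in> T"
    proof -
      have "(i - 1, Suc j) \<in> insert (i, Suc j) T"
        using e a b shape_down[of "insert (i, Suc j) T" i "Suc j" "i - 1" "Suc j"] by auto
      then show ?thesis using c0 by auto
    qed
    then obtain k l where c1: "corner T (k, l)" "i - 1 \<le> k" "Suc j \<le> l" using corner_above[OF T(1)] by blast
    have "(i, Suc j) \<notin> T" using c0(1) by (simp add: corner_def)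
    then have "k < i" using shape_down[OF T(1) corner_in[OF c1(1)], of i "Suc j"] c1 by linarith
    then have "\<not> aligned (Suc i, j) (k, l)" using c1 by (auto simp: aligned_def)
    then have "\<not> (aligned a (k, l) \<and> aligned b (k, l))" using e by auto
    then show thesis using that[OF c1(1)] c1 c0 by auto
  next
    case nb: False
    show thesis
    proof (cases "(i, j) \<noteq> (1, 1) \<or> aligned a (i, j) \<or> aligned b (i, j)")
      case True
      then show thesis using that[OF c0(1)] nb by blast
    next
      case False
      then have c11: "corner T (1, 1)" and na: "\<not> aligned a (1, 1)" "\<not> aligned b (1, 1)"
        using c0 by auto
      have ex: "\<exists>c. corner T c \<and> \<not> (aligned a c \<and> aligned b c) \<and> c \<noteq> (1, 1)"
        if T: "shape T" "(0, 2) \<in> T" "corner T (1, 1)"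
          and a: "shape (insert a T)" "a \<notin> T" "\<not> aligned a (1, 1)"
          and b: "shape (insert b T)" "b \<notin> T" "\<not> aligned b (1, 1)" and ab: "a \<noteq> b" for T a b
      proof -
        obtain k l where c: "corner T (k, l)" "2 \<le> l" using corner_above[OF T(1,2)] .
        have n12: "(1, 2) \<notin> T" using T(3) by (simp add: corner_def numeral_2_eq_2)
        then have k: "k = 0" using shape_down[OF T(1) corner_in[OF c(1)], of 1 2] c by linarith
        have "\<not> (aligned a (k, l) \<and> aligned b (k, l))"
        proof
          assume "aligned a (k, l) \<and> aligned b (k, l)"
          then have "a = (1, l) \<or> b = (1, l)"
            using aligned_addable[OF T(1) c(1) a(1,2)] aligned_addable[OF T(1) c(1) b(1,2)] ab k by auto
          then show False using a(3) b(3) by (auto simp: aligned_def)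
        qed
        moreover have "(k, l) \<noteq> (1, 1)" using c(2) by simp
        ultimately show ?thesis using c(1) by blast
      qed
      from wide_or_tall[OF T(1,2)] show thesis
      proof
        assume "(0, 2) \<in> T" then show thesis using ex[OF T(1) _ c11 a na(1) b na(2) ab] that by blast
      next
        assume t: "(2, 0) \<in> T"
        have "\<exists>c. corner (prod.swap ` T) c \<and> \<not> (aligned (prod.swap a) c \<and> aligned (prod.swap b) c) \<and> c \<noteq> (1, 1)"
        proof (rule ex)
          show "shape (insert (prod.swap a) (prod.swap ` T))" "shape (insert (prod.swap b) (prod.swap ` T))"
            using shape_swap[OF a(1)] shape_swap[OF b(1)] by simp_all
          show "corner (prod.swap ` T) (1, 1)" using c11 corner_swap[of T "(1, 1)"] by simp
          show "\<not> aligned (prod.swap a) (1, 1)" "\<not> aligned (prod.swap b) (1, 1)"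
            using na by (auto simp: aligned_def)
          show "prod.swap a \<notin> prod.swap ` T" "prod.swap b \<notin> prod.swap ` T" "prod.swap a \<noteq> prod.swap b"
            using a(2) b(2) ab by (cases a; cases b; auto)+
        qed (use t shape_swap[OF T(1)] in auto)
        then obtain c where c: "corner (prod.swap ` T) c"
          "\<not> (aligned (prod.swap a) c \<and> aligned (prod.swap b) c)" "c \<noteq> (1, 1)" by blast
        have "corner T (prod.swap c)" using c(1) corner_swap[of T "prod.swap c"] by simp
        moreover have "\<not> (aligned a (prod.swap c) \<and> aligned b (prod.swap c))"
          using c(2) aligned_swap[of a "prod.swap c"] aligned_swap[of b "prod.swap c"] by simp
        moreover have "prod.swap c \<noteq> (1, 1)" using c(3) by (cases c) auto
        ultimately show thesis using that by blast
      qed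
    qed
  qed
qed


section \<open>Moving generic pairs into good blocks with generic tails\<close>

context block_step
begin

definition reaches_good :: "cell list \<Rightarrow> cell list \<Rightarrow> bool" where
  "reaches_good A B \<longleftrightarrow> (\<exists>a b A' B'. conn A B (a # A') (b # B') \<and> corner S a \<and> corner R b \<and> good a b \<and>
     A' \<in> Tab (S - {a}) \<and> B' \<in> Tab (R - {b}) \<and> generic A' B')"

lemma reaches_goodI:
  assumes "conn A B (a # A') (b # B')" "A \<in> Tab S" "B \<in> Tab R" "good a b" "generic A' B'"
  shows "reaches_good A B"
proof -
  have "a # A' \<in> Tab S" "b # B' \<in> Tab R" using conn_Tab assms by blast+
  then show ?thesis unfolding reaches_good_def using assms Tab_Cons S R by blast
qed

text \<open>A word moves the equal tails together, so any corner \<open>c\<close> of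
  \<open>T\<close> can be brought to their front. Exchanging it with the top boxes makes the tails
  different over a common rest \<open>X\<close> unless \<open>c\<close> is blocked on both sides,
  and \<open>generic_Cons_same\<close> applies.\<close>

lemma equal_tails:
  assumes A: "a # W \<in> Tab S" and B: "b # W \<in> Tab R" and ab: "a \<noteq> b" and g: "(1, 1) \<in> S \<union> R"
  shows "reaches_good (a # W) (b # W)"
proof -
  have ca: "corner S a" "W \<in> Tab (S - {a})" and cb: "corner R b" "W \<in> Tab (R - {b})"
    using A B Tab_Cons S R by auto
  define T where "T = S - {a}"
  have T: "S = insert a T" "R = insert b T" "a \<notin> T" "b \<notin> T" "W \<in> Tab T"
    using ca cb corner_in unfolding T_def by (auto simp: Tab_def)
  have shT: "shape T" using Tab_shape T(5) .
  have cT: "card T = n" using cS T shape_finite[OF shT] by simp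
  \<comment> \<open>After the exchange the top boxes are \<open>c\<close> and \<open>c\<close> if
    nothing is blocked, \<open>a\<close> and \<open>c\<close> if only the first side is, and
    \<open>c\<close> and \<open>b\<close> if only the second is; each outcome has to be a good
    block.\<close>
  have "\<exists>c. corner T c \<and> \<not> (aligned a c \<and> aligned b c) \<and>
    (\<not> aligned a c \<and> \<not> aligned b c \<longrightarrow> good c c) \<and> (aligned a c \<longrightarrow> good a c) \<and> (aligned b c \<longrightarrow> good c b)"
  proof (cases "(1, 1) \<in> T")
    case True
    obtain c where c: "corner T c" "\<not> (aligned a c \<and> aligned b c)"
      "c \<noteq> (1, 1) \<or> aligned a c \<or> aligned b c"
      using separating_corner[OF shT _ True, of a b] cT n5 S R T ab by auto
    moreover have "good a c" "good c b" "c \<noteq> (1, 1) \<Longrightarrow> good c c"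
      using True T unfolding good_def by auto
    ultimately show ?thesis by blast
  next
    case False
    obtain c where c: "corner T c" "\<not> aligned (1, 1) c"
      using corner_off_11[OF shT _ False] cT n5 by auto
    have "c \<noteq> (1, 1)" using c(2) by auto
    moreover have "(1, 1) = a \<or> (1, 1) = b" using g T False by auto
    ultimately show ?thesis
    proof (elim disjE)
      assume n: "c \<noteq> (1, 1)" and e: "(1, 1) = a"
      have "good c x" for x using n T e unfolding good_def by auto
      then show ?thesis using c e by blast
    next
      assume n: "c \<noteq> (1, 1)" and e: "(1, 1) = b"
      have "good x c" for x using n T e unfolding good_def by auto
      then show ?thesis using c e by blast
    qed
  qed
  then obtain c where c: "corner T c" "\<not> (aligned a c \<and> aligned b c)"
    "\<not> aligned a c \<and> \<not> aligned b c \<Longrightarrow> good c c" "aligned a c \<Longrightarrow> good a c" "aligned b c \<Longrightarrow> good c b"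
    by blast
  obtain X where X: "X \<in> Tab (T - {c})" using Tab_nonempty[OF shape_remove_corner[OF shT c(1)]] by blast
  then have cX: "c # X \<in> Tab T" using Tab_Cons[OF shT] c(1) by blast
  obtain ws where ws: "fold sw ws W = c # X" using Tab_connected[OF T(5) cX] by blast
  have "conn W W (c # X) (c # X)" unfolding conn_def using ws by blast
  then have c1: "conn (a # W) (b # W) (a # c # X) (b # c # X)" by (rule conn_Cons)
  have c2: "conn (a # W) (b # W) (sw 0 (a # c # X)) (sw 0 (b # c # X))"
    using conn_trans[OF c1 conn_sw] .
  have c3: "2 \<le> card (T - {c})" using cT n5 corner_in[OF c(1)] by simp
  have acb: "a \<noteq> c" "b \<noteq> c" using corner_in[OF c(1)] T by auto
  consider "\<not> aligned a c" "\<not> aligned b c" | "aligned a c" "\<not> aligned b c" | "\<not> aligned a c" "aligned b c"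
    using c(2) by blast
  then show ?thesis
  proof cases
    case 1
    then show ?thesis
      using reaches_goodI[of "a # W" "b # W" c "a # X" c "b # X"] c2 A B c(3)
        generic_Cons_same[OF X c3 ab] by simp
  next
    case 2
    then show ?thesis
      using reaches_goodI[of "a # W" "b # W" a "c # X" c "b # X"] c2 A B c(4)
        generic_Cons_same[OF X c3] acb by simp
  next
    case 3
    then show ?thesis
      using reaches_goodI[of "a # W" "b # W" c "a # X" b "c # X"] c2 A B c(5)
        generic_Cons_same[OF X c3] acb by simp
  qed
qed

text \<open>If \<open>(1, 1)\<close> is on top, a corner not aligned with it is brought directly
  below and exchanged with it; the second component may move arbitrarily meanwhile.\<close>

lemma leave_bad:
  assumes A: "A \<in> Tab S" and B: "B \<in> Tab R" and g: "(1, 1) \<in> S"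
  obtains c C D where "conn A B (c # C) D" "c \<noteq> (1, 1)"
proof -
  obtain a A' where e: "A = a # A'" using A Tab_length cS by (metis length_Suc_conv)
  show thesis
  proof (cases "a = (1, 1)")
    case False
    then show thesis using that conn_refl e by blast
  next
    case True
    let ?T = "S - {(1, 1)}"
    have ca: "corner S (1, 1)" "A' \<in> Tab ?T" using A e True Tab_Cons[OF S] by auto
    note T = shape_remove_corner[OF S ca(1)]
    have "card ?T = n" using cS g by simp
    then obtain c where c: "corner ?T c" "\<not> aligned (1, 1) c"
      using corner_off_11[OF T] n5 by auto
    obtain X where "X \<in> Tab (?T - {c})" using Tab_nonempty[OF shape_remove_corner[OF T c(1)]] by blast
    then have "c # X \<in> Tab ?T" using Tab_Cons[OF T] c(1) by blast
    then obtain ws where ws: "fold sw ws A' = c # X" using Tab_connected ca(2) by blast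
    have "fold sw (map Suc ws @ [0]) A = c # (1, 1) # X"
      using e True ws c(2) by (simp add: fold_sw_Cons)
    then have "conn A B (c # (1, 1) # X) (fold sw (map Suc ws @ [0]) B)" unfolding conn_def by blast
    moreover have "c \<noteq> (1, 1)" using c(2) by auto
    ultimately show thesis using that by blast
  qed
qed

text \<open>Once the top boxes are good, the tails of a generic pair can fail to be generic only by
  being equal or transposed; transposing one component reduces the second case to
  \<open>equal_tails\<close>.\<close>

lemma reaches_good:
  assumes A: "A \<in> Tab S" and B: "B \<in> Tab R" and g: "(1, 1) \<in> S \<union> R" and gen: "generic A B"
  shows "reaches_good A B"
proof -
  interpret F: block_step n R S by (rule block_step_flip)
  interpret T: block_step n S "prod.swap ` R" by (rule block_step_tr)
  have "\<exists>c d C D. conn A B (c # C) (d # D) \<and> good c d"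
    using g
  proof
    assume "(1, 1) \<in> S"
    then obtain c C D where c: "conn A B (c # C) D" "c \<noteq> (1, 1)" using leave_bad[OF A B] by blast
    then obtain d D' where "D = d # D'"
      using conn_Tab[OF c(1) A B] Tab_length cR by (metis length_Suc_conv)
    moreover have "good c d" using c(2) \<open>(1, 1) \<in> S\<close> good_def by auto
    ultimately show ?thesis using c by blast
  next
    assume "(1, 1) \<in> R"
    then obtain c C D where c: "conn B A (c # C) D" "c \<noteq> (1, 1)" using F.leave_bad[OF B A] by blast
    then obtain d D' where "D = d # D'"
      using conn_Tab[OF c(1) B A] Tab_length cS by (metis length_Suc_conv)
    moreover have "good d c" using c(2) \<open>(1, 1) \<in> R\<close> good_def by auto
    ultimately show ?thesis using conn_flip c by blast
  qed
  then obtain c d C D where c: "conn A B (c # C) (d # D)" "good c d" by blast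
  have t: "c # C \<in> Tab S" "d # D \<in> Tab R" using conn_Tab c A B by blast+
  have gn: "generic (c # C) (d # D)" using generic_conn c gen by blast
  show ?thesis
  proof (cases "generic C D")
    case True
    then show ?thesis using reaches_goodI c A B by blast
  next
    case False
    then consider "C = D" | "D = tr C" unfolding generic_def by auto
    then have "reaches_good (c # C) (d # D)"
    proof cases
      case 1
      then show ?thesis using equal_tails[OF t(1)] t(2) g gn by (auto simp: generic_def)
    next
      case 2
      have D: "prod.swap d # C \<in> Tab (prod.swap ` R)" using Tab_tr[OF t(2)] 2 by simp
      have "c \<noteq> prod.swap d" using gn 2 by (auto simp: generic_def)
      then have "T.reaches_good (c # C) (prod.swap d # C)"
        using T.equal_tails[OF t(1) D] g by auto
      then obtain a b A' B' where h: "conn (c # C) (prod.swap d # C) (a # A') (b # B')" "T.good a b" "generic A' B'"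
        unfolding T.reaches_good_def by blast
      have "conn (c # C) (d # D) (a # A') (prod.swap b # tr B')"
        using conn_tr[OF h(1)] 2 by simp
      moreover have "good a (prod.swap b)" using h(2) good_tr[of a "prod.swap b"] by simp
      ultimately show ?thesis using reaches_goodI[OF _ t] generic_tr[OF h(3)] by blast
    qed
    then show ?thesis unfolding reaches_good_def using conn_trans[OF c(1)] by blast
  qed
qed

lemma pairs_conn:
  assumes A: "A \<in> Tab S" "C \<in> Tab S" and B: "B \<in> Tab R" "D \<in> Tab R" and g: "(1, 1) \<in> S \<union> R"
    and gen: "generic A B" "generic C D"
  shows "conn A B C D"
proof -
  obtain a b A' B' where 1: "conn A B (a # A') (b # B')" "corner S a" "corner R b" "good a b"
     "A' \<in> Tab (S - {a})" "B' \<in> Tab (R - {b})" "generic A' B'"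
    using reaches_good[OF A(1) B(1) g gen(1)] unfolding reaches_good_def by blast
  obtain c d C' D' where 2: "conn C D (c # C') (d # D')" "corner S c" "corner R d" "good c d"
     "C' \<in> Tab (S - {c})" "D' \<in> Tab (R - {d})" "generic C' D'"
    using reaches_good[OF A(2) B(2) g gen(2)] unfolding reaches_good_def by blast
  have "conn (a # A') (b # B') (c # C') (d # D')"
  proof (cases "(a, b) = (c, d)")
    case True
    then show ?thesis using block_conn[OF 1(2-4)] 1 2 by auto
  next
    case False
    obtain A1 B1 C1 D1 where l: "A1 \<in> Tab (S - {a})" "B1 \<in> Tab (R - {b})" "generic A1 B1"
       "C1 \<in> Tab (S - {c})" "D1 \<in> Tab (R - {d})" "generic C1 D1"
       "conn (a # A1) (b # B1) (c # C1) (d # D1)"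
      using all_linked[OF 1(2) 2(2) 1(3) 2(3) 1(4) 2(4) False] unfolding linked_def by blast
    have "conn (a # A') (b # B') (a # A1) (b # B1)" "conn (c # C1) (d # D1) (c # C') (d # D')"
      using block_conn 1 2 l by blast+
    then show ?thesis using l(7) conn_trans by blast
  qed
  then show ?thesis using 1(1) 2(1) conn_sym conn_trans by blast
qed

end

lemma pairs_connected_Suc:
  assumes "pairs_connected n" "5 \<le> n" shows "pairs_connected (Suc n)"
  unfolding pairs_connected_def
proof (intro allI impI)
  fix S R A B C D
  assume h: "card S = Suc n" "card R = Suc n" "(1, 1) \<in> S \<union> R"
    "A \<in> Tab S" "C \<in> Tab S" "B \<in> Tab R" "D \<in> Tab R" "generic A B" "generic C D"
  interpret block_step n S R
    by unfold_locales (use assms h Tab_shape in auto)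
  show "conn A B C D" using pairs_conn h by blast
qed


section \<open>Pairs of tableaux with five boxes\<close>

text \<open>An addable box is the origin or the lower or right neighbour of a present box; the
  filter checks that its upper and left neighbours are present. In this form the enumeration can be
  evaluated.\<close>

fun all_std :: "nat \<Rightarrow> cell list list" where
  "all_std 0 = [[]]"
| "all_std (Suc n) = remdups (concat (map (\<lambda>w. map (\<lambda>c. c # w)
     (filter (\<lambda>(i, j). (i, j) \<notin> set w \<and> (i = 0 \<or> (i - 1, j) \<in> set w) \<and> (j = 0 \<or> (i, j - 1) \<in> set w))
       ((0, 0) # map (\<lambda>(i, j). (Suc i, j)) w @ map (\<lambda>(i, j). (i, Suc j)) w))) (all_std n)))"

lemma std_all_std: "std w \<Longrightarrow> w \<in> set (all_std (length w))"
proof (induction w)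
  case (Cons c w)
  obtain i j where c: "c = (i, j)" by (cases c)
  have dn: "i' \<le> i \<Longrightarrow> j' \<le> j \<Longrightarrow> (i', j') \<noteq> (i, j) \<Longrightarrow> (i', j') \<in> set w" for i' j'
    using Cons.prems shape_down[of "insert c (set w)" i j i' j'] c by auto
  have nbr: "(i, j) \<notin> set w" "i = 0 \<or> (i - 1, j) \<in> set w" "j = 0 \<or> (i, j - 1) \<in> set w"
    using Cons.prems c dn[of "i - 1" j] dn[of i "j - 1"] by (cases i; cases j; simp)+
  moreover have "(i, j) = (0, 0) \<or> (i, j) \<in> (\<lambda>(i, j). (Suc i, j)) ` set w \<or> (i, j) \<in> (\<lambda>(i, j). (i, Suc j)) ` set w"
  proof (cases "i = 0")
    case True
    then show ?thesis using nbr(3) by (cases "j = 0") (auto intro!: rev_image_eqI[of "(i, j - 1)"])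
  next
    case False
    then show ?thesis using nbr(2) by (auto intro!: rev_image_eqI[of "(i - 1, j)"])
  qed
  moreover have "w \<in> set (all_std (length w))" using Cons by simp
  ultimately show ?case unfolding c by (auto intro!: bexI[of _ w])
qed simp

text \<open>Its shape, with rows of three and two boxes, is up to transposition the only non-hook
  shape with five boxes.\<close>

definition base_tab :: "cell list" where
  "base_tab = [(1, 1), (1, 0), (0, 2), (0, 1), (0, 0)]"

text \<open>One tableau for each of the seven partitions of 5.\<close>

definition base_reps :: "cell list list" where
  "base_reps = [[(0, 4), (0, 3), (0, 2), (0, 1), (0, 0)],
     [(1, 0), (0, 3), (0, 2), (0, 1), (0, 0)],
     [(1, 1), (0, 2), (1, 0), (0, 1), (0, 0)],
     [(2, 0), (1, 0), (0, 2), (0, 1), (0, 0)],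
     [(2, 0), (1, 1), (1, 0), (0, 1), (0, 0)],
     [(3, 0), (2, 0), (1, 0), (0, 1), (0, 0)],
     [(4, 0), (3, 0), (2, 0), (1, 0), (0, 0)]]"

text \<open>Words stabilising \<open>base_tab\<close>, found by a breadth-first search on pairs.\<close>

definition base_words :: "nat list list" where
  "base_words = [[], [0], [0, 1, 2, 0, 1, 2, 0, 1], [0, 1, 2, 1, 0, 1, 2, 0, 1],
     [1, 2, 0, 1, 2, 0, 1], [1, 2, 0, 1, 2, 1, 2, 0, 1, 0, 1, 2, 0, 1],
     [1, 2, 1, 0, 1, 2, 0, 1], [2], [2, 0]]"

text \<open>With the first component fixed, orbits of pairs become orbits of its stabiliser on the
  second component. Each generic second component is carried by a stabilising word to the
  representative of its shape.\<close>

lemma base_check: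
  "\<forall>B\<in>set (all_std 5). generic base_tab B \<longrightarrow>
     (\<exists>w\<in>set base_words. fold sw w base_tab = base_tab \<and> fold sw w B \<in> set base_reps)"
  by code_simp

lemma base_reps_distinct:
  "\<forall>E\<in>set base_reps. \<forall>E'\<in>set base_reps. set E = set E' \<longrightarrow> E = E'"
  by code_simp

lemma base_tab_Tab: "base_tab \<in> Tab (set base_tab)"
proof -
  have "shape {(0, 0)}" "shape {(0, 1), (0, 0)}" "shape {(0, 2), (0, 1), (0, 0)}"
    "shape {(1, 0), (0, 2), (0, 1), (0, 0)}" "shape {(1, 1), (1, 0), (0, 2), (0, 1), (0, 0)}"
    by (auto simp: shape_def le_Suc_eq numeral_2_eq_2)
  then show ?thesis unfolding Tab_def base_tab_def by (simp del: One_nat_def)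
qed

lemma pairs_base_tab:
  assumes "A \<in> Tab (set base_tab)" "C \<in> Tab (set base_tab)" "B \<in> Tab R" "D \<in> Tab R" "card R = 5"
    "generic A B" "generic C D"
  shows "conn A B C D"
proof -
  have norm: "\<exists>E\<in>set base_reps. set E = R \<and> conn A B base_tab E"
    if h: "A \<in> Tab (set base_tab)" "B \<in> Tab R" "generic A B" for A B
  proof -
    obtain ws where ws: "fold sw ws A = base_tab"
      using Tab_connected[OF h(1) base_tab_Tab] by blast
    define B' where "B' = fold sw ws B"
    have c: "conn A B base_tab B'" unfolding conn_def B'_def using ws by blast
    have B': "B' \<in> Tab R" unfolding B'_def using Tab_fold_sw h by blast
    then have "B' \<in> set (all_std 5)"
      using std_all_std[of B'] Tab_length[OF B'] assms(5) by (simp only: Tab_def mem_Collect_eq)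
    moreover have "generic base_tab B'" using generic_conn c h by blast
    ultimately obtain w where w: "fold sw w base_tab = base_tab" "fold sw w B' \<in> set base_reps"
      using base_check by blast
    have "conn base_tab B' base_tab (fold sw w B')" unfolding conn_def using w by blast
    then have "conn A B base_tab (fold sw w B')" using c conn_trans by blast
    moreover have "set (fold sw w B') = R" using Tab_fold_sw[OF B'] by (simp add: Tab_def)
    ultimately show ?thesis using w by blast
  qed
  obtain E E' where "E \<in> set base_reps" "E' \<in> set base_reps" "set E = R" "set E' = R"
    "conn A B base_tab E" "conn C D base_tab E'"
    using norm[OF assms(1,3,6)] norm[OF assms(2,4,7)] by blast
  moreover from this have "E = E'" using base_reps_distinct by blast
  ultimately show ?thesis using conn_sym conn_trans by blast
qed

lemma shape5:
  assumes "shape S" "card S = 5" "(1, 1) \<in> S"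
  shows "S = set base_tab \<or> prod.swap ` S = set base_tab"
proof -
  have ex: "S = set base_tab" if "shape S" "card S = 5" "(1, 1) \<in> S" "(0, 2) \<in> S" for S
  proof -
    have "set base_tab \<subseteq> S"
      using that shape_down[OF that(1,3), of 0 1] shape_down[OF that(1,3), of 1 0]
        shape_down[OF that(1,3), of 0 0] unfolding base_tab_def by auto
    moreover have "card (set base_tab) = 5" by (simp add: base_tab_def)
    ultimately show ?thesis using card_subset_eq[OF shape_finite[OF that(1)]] that(2) by metis
  qed
  have "(0, 2) \<in> S \<or> (2, 0) \<in> S" using wide_or_tall assms by simp
  then show ?thesis
    using ex[OF assms] ex[of "prod.swap ` S"] assms shape_swap[OF assms(1)] card_swap[of S] mem_swap
    by metis
qed

lemma pairs_connected_5: "pairs_connected 5"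
proof -
  have main: "conn A B C D" if h: "card S = 5" "card R = 5" "(1, 1) \<in> S"
    "A \<in> Tab S" "C \<in> Tab S" "B \<in> Tab R" "D \<in> Tab R" "generic A B" "generic C D" for S R A B C D
    using shape5[OF Tab_shape[OF h(4)] h(1,3)]
  proof
    assume "S = set base_tab"
    then show ?thesis using pairs_base_tab h by blast
  next
    assume e: "prod.swap ` S = set base_tab"
    have "conn (tr A) B (tr C) D"
      using pairs_base_tab[of "tr A" "tr C"] Tab_tr[OF h(4)] Tab_tr[OF h(5)] h e
      by (auto simp: generic_def)
    then have "conn B (tr A) D (tr C)" by (rule conn_flip)
    then show ?thesis using conn_tr' conn_flip by blast
  qed
  show ?thesis unfolding pairs_connected_def
  proof (intro allI impI)
    fix S R A B C D
    assume h: "card S = 5" "card R = 5" "(1, 1) \<in> S \<union> R"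
      "A \<in> Tab S" "C \<in> Tab S" "B \<in> Tab R" "D \<in> Tab R" "generic A B" "generic C D"
    show "conn A B C D"
    proof (cases "(1, 1) \<in> S")
      case True then show ?thesis using main h by blast
    next
      case False
      then have "conn B A D C" using main[of R S B D A C] h generic_flip by blast
      then show ?thesis by (rule conn_flip)
    qed
  qed
qed

lemma pairs_connected_ge_5: "5 \<le> n \<Longrightarrow> pairs_connected n"
  by (induction n rule: dec_induct) (simp_all add: pairs_connected_5 pairs_connected_Suc)

text \<open>The square with two rows has exactly two tableaux, and they are transposes of each other.\<close>

lemma generic_same_shape_card:
  assumes "A \<in> Tab S" "B \<in> Tab S" "(1, 1) \<in> S" "generic A B"
  shows "5 \<le> card S"
proof (rule ccontr)
  assume n: "\<not> 5 \<le> card S"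
  have sh: "shape S" using Tab_shape assms by blast
  have "square2 \<subseteq> S"
    using assms(3) shape_down[OF sh assms(3), of 0 1] shape_down[OF sh assms(3), of 1 0]
      shape_down[OF sh assms(3), of 0 0] by auto
  moreover have "card square2 = 4" by simp
  ultimately have S: "S = square2" using n card_seteq[OF shape_finite[OF sh], of square2] by simp
  have chk: "\<forall>A\<in>set (all_std 4). \<forall>B\<in>set (all_std 4). (1, 1) \<in> set A \<longrightarrow> (1, 1) \<in> set B \<longrightarrow> A = B \<or> tr A = B"
    by code_simp
  have "length A = 4" "length B = 4"
    using Tab_length[OF assms(1)] Tab_length[OF assms(2)] unfolding S by simp_all
  then have "A \<in> set (all_std 4)" "B \<in> set (all_std 4)"
    using std_all_std[of A] std_all_std[of B] assms(1,2) by (auto simp only: Tab_def)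
  then show False using chk assms by (auto simp: Tab_def generic_def)
qed

lemma generic_pairs_conn:
  assumes "A \<in> Tab S" "B \<in> Tab S" "C \<in> Tab S" "D \<in> Tab S" "(1, 1) \<in> S" "generic A B" "generic C D"
  shows "conn A B C D"
  using pairs_connected_ge_5[OF generic_same_shape_card[OF assms(1,2,5,6)]] assms
  unfolding pairs_connected_def by blast


section \<open>Pairs of tableaux of hook shape\<close>

fun adj_swap :: "nat \<Rightarrow> 'a list \<Rightarrow> 'a list" where
  "adj_swap 0 (a # b # w) = b # a # w"
| "adj_swap (Suc i) (a # w) = a # adj_swap i w"
| "adj_swap 0 [a] = [a]"
| "adj_swap i [] = []"

lemma mset_adj_swap [simp]: "mset (adj_swap i w) = mset w"
  by (induction i w rule: adj_swap.induct) auto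

lemma length_adj_swap [simp]: "length (adj_swap i w) = length w"
  by (induction i w rule: adj_swap.induct) auto

lemma zip_adj_swap: "length u = length v \<Longrightarrow> zip (adj_swap i u) (adj_swap i v) = adj_swap i (zip u v)"
proof (induction i u arbitrary: v rule: adj_swap.induct)
  case (1 a b w)
  then obtain c d v' where "v = c # d # v'" by (metis length_Suc_conv)
  then show ?case by simp
next
  case (2 i a w)
  then obtain c v' where "v = c # v'" by (metis length_Suc_conv)
  then show ?case using 2 by simp
next
  case (3 a)
  then obtain c where "v = [c]" by (metis length_0_conv length_Suc_conv)
  then show ?case by simp
qed simp

lemma fold_adj_swap_Cons: "fold adj_swap (map Suc ws) (a # w) = a # fold adj_swap ws w"
  by (induction ws arbitrary: w) simp_all

lemma adj_swap_to_front: "\<exists>ws. fold adj_swap ws (u @ x # v) = x # u @ v"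
proof (induction u)
  case Nil
  show ?case by (rule exI[of _ "[]"]) simp
next
  case (Cons a u)
  then obtain ws where "fold adj_swap ws (u @ x # v) = x # u @ v" by blast
  then have "fold adj_swap (map Suc ws @ [0]) ((a # u) @ x # v) = x # (a # u) @ v"
    by (simp add: fold_adj_swap_Cons)
  then show ?case by blast
qed

lemma mset_eq_adj_swap: "mset u = mset v \<Longrightarrow> \<exists>ws. fold adj_swap ws u = v"
proof (induction v arbitrary: u)
  case Nil
  then show ?case by (intro exI[of _ "[]"]) simp
next
  case (Cons x v)
  then have "x \<in> set u" by (metis list.set_intros(1) set_mset_mset)
  then obtain u1 u2 where u: "u = u1 @ x # u2" by (meson split_list)
  obtain ws where ws: "fold adj_swap ws u = x # u1 @ u2" unfolding u using adj_swap_to_front[of u1 x u2] by blast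
  have "mset (u1 @ u2) = mset v" using Cons.prems u by simp
  then obtain vs where "fold adj_swap vs (u1 @ u2) = v" using Cons.IH by blast
  then have "fold adj_swap (ws @ map Suc vs) u = x # v" using ws by (simp add: fold_adj_swap_Cons)
  then show ?case by blast
qed

text \<open>A two by two table of counts is determined by its total, its margins and one
  entry.\<close>

lemma mset_bool_pairs:
  fixes z z' :: "(bool \<times> bool) list"
  assumes "length z = length z'" "length (filter fst z) = length (filter fst z')"
    "length (filter snd z) = length (filter snd z')"
    "length (filter (\<lambda>p. fst p \<and> snd p) z) = length (filter (\<lambda>p. fst p \<and> snd p) z')"
  shows "mset z = mset z'"
proof -
  let ?c = "\<lambda>z a b. count (mset z) (a, b)"
  have 1: "length z = ?c z True True + ?c z True False + ?c z False True + ?c z False False"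
    for z :: "(bool \<times> bool) list" by (induction z) auto
  have 2: "length (filter fst z) = ?c z True True + ?c z True False" for z by (induction z) auto
  have 3: "length (filter snd z) = ?c z True True + ?c z False True" for z by (induction z) auto
  have 4: "length (filter (\<lambda>p. fst p \<and> snd p) z) = ?c z True True" for z by (induction z) auto
  have e: "?c z True True = ?c z' True True" using assms(4) by (simp only: 4)
  moreover have e2: "?c z True False = ?c z' True False" using assms(2) e by (simp only: 2)
  moreover have e3: "?c z False True = ?c z' False True" using assms(3) e by (simp only: 3)
  moreover have "?c z False False = ?c z' False False" using assms(1) e e2 e3 by (simp only: 1)
  ultimately have "count (mset z) p = count (mset z') p" for p
    by (cases p; cases "fst p"; cases "snd p") auto
  then show ?thesis by (rule multiset_eqI)
qed

text \<open>The last box is the origin, which is aligned with every box of a hook and never moves,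
  so it is left out.\<close>

definition row_word :: "cell list \<Rightarrow> bool list" where
  "row_word w = map (\<lambda>c. fst c = 0) (butlast w)"

lemma std_last: "std w \<Longrightarrow> w \<noteq> [] \<Longrightarrow> last w = (0, 0)"
proof (induction w)
  case (Cons c w)
  then show ?case using origin_in[of "{c}"] by (cases w) auto
qed simp

lemma hook_cell: "shape S \<Longrightarrow> (1, 1) \<notin> S \<Longrightarrow> (i, j) \<in> S \<Longrightarrow> i = 0 \<or> j = 0"
  using shape_down[of S i j 1 1] by linarith

text \<open>Two boxes of a hook other than the origin are aligned exactly if both lie in the arm or
  both in the leg. Then the letters agree, and exchanging equal letters does nothing, just as the
  blocked involution.\<close>

lemma row_word_sw:
  assumes "std w" "(1, 1) \<notin> set w" shows "row_word (sw i w) = adj_swap i (row_word w)"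
  using assms
proof (induction i w rule: sw.induct)
  case (1 a b w)
  show ?case
  proof (cases "w = []")
    case True
    have "b = (0, 0)" using std_last[OF 1(1)] True by simp
    moreover have "shape {a, b}" using std_shape[OF 1(1)] True by simp
    ultimately have "aligned a b" using 1(2) True hook_cell[of "{a, b}" "fst a" "snd a"]
      by (auto simp: aligned_def)
    then show ?thesis using True by (simp add: row_word_def)
  next
    case False
    have "last w = (0, 0)" using std_last[OF 1(1)] False by simp
    then have "(0, 0) \<in> set w" using False last_in_set by metis
    then have n: "a \<noteq> (0, 0)" "b \<noteq> (0, 0)" using 1 by auto
    have h: "fst a = 0 \<or> snd a = 0" "fst b = 0 \<or> snd b = 0"
      using hook_cell[OF std_shape[OF 1(1)] 1(2)] by (metis list.set_intros prod.collapse)+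
    have "aligned a b \<longleftrightarrow> (fst a = 0) = (fst b = 0)"
      unfolding aligned_def using h n by (cases a; cases b) auto
    then show ?thesis using False by (auto simp: row_word_def)
  qed
next
  case (2 i a w)
  then have IH: "row_word (sw i w) = adj_swap i (row_word w)" by simp
  show ?case
  proof (cases "w = []")
    case True then show ?thesis by (cases i) (auto simp: row_word_def)
  next
    case False
    then have "sw i w \<noteq> []" by (metis length_0_conv length_sw)
    then show ?thesis using IH False by (simp add: row_word_def)
  qed
next
  case (3 a) then show ?case by (simp add: row_word_def)
next
  case (4 i) then show ?case by (cases i) (simp_all add: row_word_def)
qed

lemma row_word_fold_sw:
  assumes "w \<in> Tab S" "(1, 1) \<notin> S" shows "row_word (fold sw ws w) = fold adj_swap ws (row_word w)"
  using assms
proof (induction ws arbitrary: w)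
  case (Cons i ws)
  then show ?case using row_word_sw[of w i] Tab_sw[of w S i] by (simp add: Tab_def)
qed simp

text \<open>A letter says whether the arm or the leg grows, and each of them can grow by one box
  only.\<close>

lemma row_word_inj:
  "std v \<Longrightarrow> std w \<Longrightarrow> (1, 1) \<notin> set v \<Longrightarrow> (1, 1) \<notin> set w \<Longrightarrow> length v = length w \<Longrightarrow>
    row_word v = row_word w \<Longrightarrow> v = w"
proof (induction v arbitrary: w)
  case (Cons c v)
  obtain d u where w: "w = d # u" using Cons.prems by (cases w) auto
  show ?case
  proof (cases "v = []")
    case True
    then show ?thesis using Cons.prems w std_last[of "c # v"] std_last[of w] by auto
  next
    case False
    then have ne: "u \<noteq> []" using Cons.prems w by auto
    have uv: "v = u" and cd: "(fst c = 0) = (fst d = 0)"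
      using Cons.IH[of u] Cons.prems w False ne by (auto simp: row_word_def)
    have "(0, 0) \<in> set u" using std_last[of u] ne Cons.prems w last_in_set[OF ne] by auto
    have sh: "shape (insert c (set u))" "shape (insert d (set u))" "c \<notin> set u" "d \<notin> set u"
      using Cons.prems w uv by auto
    have h: "fst c = 0 \<or> snd c = 0" "fst d = 0 \<or> snd d = 0"
      using hook_cell[OF sh(1), of "fst c" "snd c"] hook_cell[OF sh(2), of "fst d" "snd d"] Cons.prems w uv by auto
    then have cmp: "fst c \<le> fst d \<and> snd c \<le> snd d \<or> fst d \<le> fst c \<and> snd d \<le> snd c"
      using cd by (cases "fst c = 0") auto
    have "c = d"
    proof (rule ccontr)
      assume n: "c \<noteq> d"
      from cmp show False
      proof
        assume "fst c \<le> fst d \<and> snd c \<le> snd d"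
        then have "c \<in> insert d (set u)"
          using shape_down[OF sh(2), of "fst d" "snd d" "fst c" "snd c"] by auto
        then show False using n sh by auto
      next
        assume "fst d \<le> fst c \<and> snd d \<le> snd c"
        then have "d \<in> insert c (set u)"
          using shape_down[OF sh(1), of "fst c" "snd c" "fst d" "snd d"] by auto
        then show False using n sh by auto
      qed
    qed
    then show ?thesis using w uv by simp
  qed
qed auto

text \<open>Equal positions carry equal entries in lists of equal length, so this counts the entries
  that lie in the first row of both tableaux.\<close>

definition shared :: "cell list \<Rightarrow> cell list \<Rightarrow> nat" where
  "shared A B = length (filter (\<lambda>(a, b). fst a = 0 \<and> fst b = 0) (zip A B))"

text \<open>The additional one is the entry 1, which lies at the origin of both tableaux and is
  missing from the words.\<close>

lemma shared_row_word:
  assumes "A \<in> Tab S" "B \<in> Tab S" "S \<noteq> {}"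
  shows "shared A B = Suc (length (filter (\<lambda>p. fst p \<and> snd p) (zip (row_word A) (row_word B))))"
proof -
  have ne: "A \<noteq> []" "B \<noteq> []" using assms by (auto simp: Tab_def)
  have e: "A = butlast A @ [(0, 0)]" "B = butlast B @ [(0, 0)]"
    using append_butlast_last_id[OF ne(1)] append_butlast_last_id[OF ne(2)]
      std_last[OF _ ne(1)] std_last[OF _ ne(2)] assms by (simp_all add: Tab_def)
  have l: "length (butlast A) = length (butlast B)" using Tab_length assms by simp
  have "shared A B = Suc (length (filter (\<lambda>(a, b). fst a = 0 \<and> fst b = 0) (zip (butlast A) (butlast B))))"
    unfolding shared_def by (subst e(1), subst e(2)) (simp add: l del: length_butlast)
  also have "length (filter (\<lambda>(a, b). fst a = 0 \<and> fst b = 0) (zip (butlast A) (butlast B))) =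
    length (filter (\<lambda>p. fst p \<and> snd p) (zip (row_word A) (row_word B)))"
    unfolding row_word_def zip_map_map filter_map by (simp add: comp_def case_prod_unfold)
  finally show ?thesis .
qed

text \<open>Moves permute the positions of the zipped words, so the orbit is the multiset of letter
  pairs. Its margins are fixed by the length of the arm, which leaves the number of positions with
  both letters in the row as the only free parameter.\<close>

lemma hook_conn_iff:
  assumes A: "A \<in> Tab S" "B \<in> Tab S" and C: "C \<in> Tab S" "D \<in> Tab S" and h: "(1, 1) \<notin> S"
  shows "conn A B C D \<longleftrightarrow> shared A B = shared C D"
proof (cases "S = {}")
  case True
  then have "A = []" "B = []" "C = []" "D = []" using assms by (auto simp: Tab_def)
  then show ?thesis by simp
next
  case False
  have len: "length (row_word w) = card S - 1" if "w \<in> Tab S" for w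
    using Tab_length[OF that] by (simp add: row_word_def)
  have z: "zip (fold adj_swap ws u) (fold adj_swap ws v) = fold adj_swap ws (zip u v)" if "length u = length v"
    for ws and u v :: "bool list"
    using that by (induction ws arbitrary: u v) (simp_all add: zip_adj_swap)
  have iff: "conn A B C D \<longleftrightarrow> mset (zip (row_word A) (row_word B)) = mset (zip (row_word C) (row_word D))"
  proof
    assume "conn A B C D"
    then obtain ws where "fold sw ws A = C" "fold sw ws B = D" unfolding conn_def by blast
    then have "zip (row_word C) (row_word D) = fold adj_swap ws (zip (row_word A) (row_word B))"
      using row_word_fold_sw[OF A(1) h] row_word_fold_sw[OF A(2) h] z len A by metis
    moreover have "mset (fold adj_swap ws w) = mset w" for w :: "(bool \<times> bool) list"
      by (induction ws arbitrary: w) simp_all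
    ultimately show "mset (zip (row_word A) (row_word B)) = mset (zip (row_word C) (row_word D))" by simp
  next
    assume "mset (zip (row_word A) (row_word B)) = mset (zip (row_word C) (row_word D))"
    then obtain ws where "fold adj_swap ws (zip (row_word A) (row_word B)) = zip (row_word C) (row_word D)"
      using mset_eq_adj_swap by blast
    then have "zip (row_word (fold sw ws A)) (row_word (fold sw ws B)) = zip (row_word C) (row_word D)"
      using row_word_fold_sw[OF A(1) h] row_word_fold_sw[OF A(2) h] z len A by simp
    moreover have t: "fold sw ws A \<in> Tab S" "fold sw ws B \<in> Tab S" using Tab_fold_sw A by auto
    ultimately have "row_word (fold sw ws A) = row_word C" "row_word (fold sw ws B) = row_word D"
      using len t C by (metis map_fst_zip, metis map_snd_zip)
    then have "fold sw ws A = C" "fold sw ws B = D"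
      using row_word_inj t C h Tab_length by (auto simp: Tab_def)
    then show "conn A B C D" unfolding conn_def by blast
  qed
  have rows: "length (filter (\<lambda>x. x) (row_word w)) = card {c \<in> S. fst c = 0 \<and> c \<noteq> (0, 0)}" if w: "w \<in> Tab S" for w
  proof -
    have ne: "w \<noteq> []" using w False by (auto simp: Tab_def)
    have e: "butlast w @ [(0, 0)] = w"
      using append_butlast_last_id[OF ne] std_last[OF _ ne] w by (simp add: Tab_def)
    have d: "distinct (butlast w @ [(0, 0)])" using e std_distinct w by (simp add: Tab_def)
    have s: "set (butlast w) = S - {(0, 0)}" using d arg_cong[OF e, of set] w by (auto simp: Tab_def)
    have "length (filter (\<lambda>x. x) (row_word w)) = length (filter (\<lambda>c. fst c = 0) (butlast w))"
      unfolding row_word_def by (simp add: filter_map comp_def)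
    also have "\<dots> = card (set (filter (\<lambda>c. fst c = 0) (butlast w)))"
      using d by (intro distinct_card[symmetric]) simp
    also have "set (filter (\<lambda>c. fst c = 0) (butlast w)) = {c \<in> S. fst c = 0 \<and> c \<noteq> (0, 0)}"
      using s by auto
    finally show ?thesis .
  qed
  have fz: "length (filter fst (zip u v)) = length (filter (\<lambda>x. x) u)"
    "length (filter snd (zip u v)) = length (filter (\<lambda>x. x) v)" if "length u = length v" for u v :: "bool list"
    using that by (induction u v rule: list_induct2) auto
  have "mset (zip (row_word A) (row_word B)) = mset (zip (row_word C) (row_word D)) \<longleftrightarrow>
    length (filter (\<lambda>p. fst p \<and> snd p) (zip (row_word A) (row_word B))) =
    length (filter (\<lambda>p. fst p \<and> snd p) (zip (row_word C) (row_word D)))"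
  proof
    assume "mset (zip (row_word A) (row_word B)) = mset (zip (row_word C) (row_word D))"
    then show "length (filter (\<lambda>p. fst p \<and> snd p) (zip (row_word A) (row_word B))) =
      length (filter (\<lambda>p. fst p \<and> snd p) (zip (row_word C) (row_word D)))"
      by (metis mset_filter size_mset)
  next
    assume "length (filter (\<lambda>p. fst p \<and> snd p) (zip (row_word A) (row_word B))) =
      length (filter (\<lambda>p. fst p \<and> snd p) (zip (row_word C) (row_word D)))"
    then show "mset (zip (row_word A) (row_word B)) = mset (zip (row_word C) (row_word D))"
      by (intro mset_bool_pairs) (simp_all add: fz rows len A C)
  qed
  then show ?thesis
    using iff shared_row_word[OF A False] shared_row_word[OF C False] by simp
qed


section \<open>Fillings and evacuation\<close>

abbreviation box :: "cell \<Rightarrow> nat \<times> nat" where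
  "box \<equiv> map_prod Suc Suc"

definition cells :: "nat list \<Rightarrow> cell set" where
  "cells lam = {(i, j). i < length lam \<and> j < lam ! i}"

fun fill :: "cell list \<Rightarrow> tableau" where
  "fill [] = (\<lambda>_. 0)"
| "fill (c # w) = (fill w)(box c := Suc (length w))"

lemma box_eq [simp]: "box a = box b \<longleftrightarrow> a = b"
  by (cases a; cases b) simp

lemma box_in [simp]: "box a \<in> box ` S \<longleftrightarrow> a \<in> S"
  by (simp add: inj_image_mem_iff inj_on_def)

lemma box_Diff: "box ` (S - {c}) = box ` S - {box c}"
  by (cases c) auto

lemma diagram_cells: "diagram lam = box ` cells lam"
proof (intro equalityI subsetI)
  fix p assume "p \<in> diagram lam"
  moreover obtain i j where p: "p = (i, j)" by (cases p)
  ultimately have "(i - 1, j - 1) \<in> cells lam" "p = box (i - 1, j - 1)"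
    by (auto simp: diagram_def cells_def)
  then show "p \<in> box ` cells lam" by blast
next
  fix p assume "p \<in> box ` cells lam"
  then show "p \<in> diagram lam" by (auto simp: diagram_def cells_def)
qed

lemma shape_cells:
  assumes "partition_of lam n" shows "shape (cells lam)"
proof -
  have m: "lam ! k \<le> lam ! i" if "i \<le> k" "k < length lam" for i k
    using assms that unfolding partition_of_def sorted_wrt_iff_nth_less
    by (cases "i = k") auto
  have "cells lam \<subseteq> {..<length lam} \<times> {..<Suc (Max (set lam))}"
  proof
    fix p assume "p \<in> cells lam"
    then obtain i j where p: "p = (i, j)" "i < length lam" "j < lam ! i" by (auto simp: cells_def)
    then have "j < Suc (Max (set lam))" using Max_ge[of "set lam" "lam ! i"] by (simp del: Max_ge)
    then show "p \<in> {..<length lam} \<times> {..<Suc (Max (set lam))}" using p by auto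
  qed
  then have "finite (cells lam)" by (rule finite_subset) simp
  then show ?thesis unfolding shape_def cells_def using m
    by (auto simp: cells_def) (meson le_trans less_le_trans order.strict_trans1)+
qed

lemma card_cells:
  assumes "partition_of lam n" shows "card (cells lam) = n"
proof -
  have "cells lam = Sigma {..<length lam} (\<lambda>i. {..<lam ! i})" by (auto simp: cells_def)
  then have "card (cells lam) = (\<Sum>i<length lam. lam ! i)" by simp
  also have "\<dots> = sum_list lam" by (simp add: sum_list_sum_nth atLeast0LessThan)
  finally show ?thesis using assms by (simp add: partition_of_def)
qed

lemma fill_out: "x \<notin> box ` set w \<Longrightarrow> fill w x = 0"
  by (induction w) auto

lemma fill_le: "fill w x \<le> length w"
  by (induction w) (auto intro: le_SucI)

lemma fill_nth: "distinct w \<Longrightarrow> k < length w \<Longrightarrow> fill w (box (w ! k)) = length w - k"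
proof (induction w arbitrary: k)
  case (Cons c w)
  then show ?case by (cases k) auto
qed simp

lemma fill_inj:
  "distinct v \<Longrightarrow> distinct w \<Longrightarrow> length v = length w \<Longrightarrow> fill v = fill w \<Longrightarrow> v = w"
proof (rule nth_equalityI)
  fix k assume h: "distinct v" "distinct w" "length v = length w" "fill v = fill w" "k < length v"
  have e: "fill w (box (v ! k)) = length w - k" using fill_nth[of v k] h by simp
  then have "box (v ! k) \<in> box ` set w" using fill_out[of "box (v ! k)" w] h by auto
  then obtain l where l: "l < length w" "v ! k = w ! l" by (auto simp: in_set_conv_nth)
  then have "length w - l = length w - k" using fill_nth[of w l] h e by simp
  then have "l = k" using l h by simp
  then show "v ! k = w ! k" using l by simp
qed

lemma fill_append_out: "x \<notin> box ` set u \<Longrightarrow> fill (u @ v) x = fill v x"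
  by (induction u) auto

lemma fill_append_in:
  "x \<in> box ` set u \<Longrightarrow> length v = length v' \<Longrightarrow> fill (u @ v) x = fill (u @ v') x"
  by (induction u) auto

lemma fill_append_gt: "x \<in> box ` set u \<Longrightarrow> length v < fill (u @ v) x"
  by (induction u) auto

definition std_filling :: "cell set \<Rightarrow> tableau \<Rightarrow> bool" where
  "std_filling S T \<longleftrightarrow> bij_betw T (box ` S) {1..card S} \<and>
     (\<forall>i j j'. (i, j) \<in> S \<longrightarrow> (i, j') \<in> S \<longrightarrow> j < j' \<longrightarrow> T (box (i, j)) < T (box (i, j'))) \<and>
     (\<forall>i i' j. (i, j) \<in> S \<longrightarrow> (i', j) \<in> S \<longrightarrow> i < i' \<longrightarrow> T (box (i, j)) < T (box (i', j))) \<and>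
     (\<forall>c. c \<notin> box ` S \<longrightarrow> T c = 0)"

lemma std_filling_fill:
  assumes "w \<in> Tab S" shows "std_filling S (fill w)"
  using assms
proof (induction w arbitrary: S)
  case Nil
  then show ?case by (auto simp: std_filling_def Tab_def bij_betw_def)
next
  case (Cons c w)
  have S: "shape S" using Tab_shape Cons.prems by blast
  have c: "corner S c" and w: "w \<in> Tab (S - {c})" using Cons.prems Tab_Cons[OF S] by auto
  have lw: "card S = Suc (length w)" using Tab_length[OF Cons.prems] by simp
  have IH: "std_filling (S - {c}) (fill w)" using Cons.IH[OF w] .
  have im: "box ` S = insert (box c) (box ` (S - {c}))" using corner_in[OF c] by auto
  have b: "bij_betw (fill w) (box ` (S - {c})) {1..length w}"
    using IH lw Tab_length[OF w] unfolding std_filling_def by simp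
  have "bij_betw ((fill w)(box c := Suc (length w))) (box ` (S - {c})) {1..length w}"
    using b by (subst bij_betw_cong[where g = "fill w"]) (auto simp: box_Diff)
  then have "bij_betw (fill (c # w)) (box ` (S - {c}) \<union> {box c}) ({1..length w} \<union> {Suc (length w)})"
    using bij_betw_combine[of "fill (c # w)" _ _ "{box c}" "{Suc (length w)}"] by auto
  moreover have "{1..length w} \<union> {Suc (length w)} = {1..card S}" using lw by auto
  ultimately have bij: "bij_betw (fill (c # w)) (box ` S) {1..card S}" using im by simp
  have val: "fill (c # w) (box d) = (if d = c then Suc (length w) else fill w (box d))" for d by simp
  have lt: "fill (c # w) (box d) < fill (c # w) (box d')"
    if "d \<in> S" "d' \<in> S" "d \<noteq> c" "d' \<noteq> c \<Longrightarrow> fill w (box d) < fill w (box d')" for d d'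
    using that val le_imp_less_Suc[OF fill_le[of w "box d"]] by auto
  have nc: "(i, j) \<noteq> c" if "(i, j) \<in> S" "(i', j') \<in> S" "i \<le> i'" "j \<le> j'" "(i, j) \<noteq> (i', j')" for i j i' j'
    using corner_max[OF S, of i j i' j'] c that by auto
  show ?case unfolding std_filling_def
  proof (intro conjI allI impI)
    fix i j j' assume h: "(i, j) \<in> S" "(i, j') \<in> S" "j < j'"
    show "fill (c # w) (box (i, j)) < fill (c # w) (box (i, j'))"
      by (rule lt) (use IH h nc[of i j i j'] in \<open>auto simp: std_filling_def\<close>)
  next
    fix i i' j assume h: "(i, j) \<in> S" "(i', j) \<in> S" "i < i'"
    show "fill (c # w) (box (i, j)) < fill (c # w) (box (i', j))"
      by (rule lt) (use IH h nc[of i j i' j] in \<open>auto simp: std_filling_def\<close>)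
  next
    fix x assume "x \<notin> box ` S"
    then show "fill (c # w) x = 0"
      using Cons.prems fill_out[of x "c # w"] by (simp add: Tab_def del: fill.simps)
  qed (rule bij)
qed

text \<open>The box of the largest entry is a corner; setting it to 0 leaves a standard filling of
  the smaller shape.\<close>

lemma fill_std_filling:
  assumes "shape S" "std_filling S T" shows "\<exists>w\<in>Tab S. fill w = T"
  using assms
proof (induction "card S" arbitrary: S T)
  case 0
  then have "S = {}" using shape_finite by simp
  then show ?case using 0 by (auto simp: Tab_def std_filling_def intro!: exI[of _ "[]"])
next
  case (Suc n)
  note S = \<open>shape S\<close> and T = \<open>std_filling S T\<close>
  have bij: "bij_betw T (box ` S) {1..Suc n}" using T Suc.hyps(2) by (simp add: std_filling_def)
  have "Suc n \<in> T ` box ` S" using bij by (simp add: bij_betw_def)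
  then obtain c where c: "c \<in> S" "T (box c) = Suc n" by auto
  have mx: "T (box d) \<le> Suc n" if "d \<in> S" for d
    using bij_betwE[OF bij] that by force
  obtain i j where ij: "c = (i, j)" by (cases c)
  have cor: "corner S c"
    unfolding corner_def
  proof (intro conjI notI)
    show "c \<in> S" by (rule c)
    assume "(Suc (fst c), snd c) \<in> S"
    then have "T (box c) < T (box (Suc i, j))" using T c(1) unfolding std_filling_def ij fst_conv snd_conv by (meson lessI)
    then show False using mx[of "(Suc i, j)"] \<open>(Suc (fst c), snd c) \<in> S\<close> c ij by auto
  next
    assume "(fst c, Suc (snd c)) \<in> S"
    then have "T (box c) < T (box (i, Suc j))" using T c(1) unfolding std_filling_def ij fst_conv snd_conv by (meson lessI)
    then show False using mx[of "(i, Suc j)"] \<open>(fst c, Suc (snd c)) \<in> S\<close> c ij by auto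
  qed
  have n: "n = card (S - {c})" using Suc.hyps(2) c by simp
  have bij': "bij_betw T (box ` (S - {c})) {1..n}"
  proof -
    have "bij_betw T (box ` S - {box c}) ({1..Suc n} - {Suc n})"
      using bij_betw_DiffI[OF bij, of "{box c}" "{Suc n}"] c by auto
    moreover have "{1..Suc n} - {Suc n} = {1..n}" by auto
    ultimately show ?thesis by (simp add: box_Diff)
  qed
  have "std_filling (S - {c}) (T(box c := 0))"
    unfolding std_filling_def n[symmetric]
  proof (intro conjI)
    show "bij_betw (T(box c := 0)) (box ` (S - {c})) {1..n}"
      using bij' by (subst bij_betw_cong[where g = T]) (auto simp: box_Diff)
  qed (use T ij in \<open>auto simp: std_filling_def box_Diff\<close>)
  then obtain w where w: "w \<in> Tab (S - {c})" "fill w = T(box c := 0)"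
    using Suc.hyps(1)[OF n shape_remove_corner[OF S cor]] by blast
  have "c # w \<in> Tab S" using Tab_Cons[OF S] cor w by blast
  moreover have "fill (c # w) = T" using w c Tab_length[OF w(1)] n by (auto simp: fun_eq_iff)
  ultimately show ?case by blast
qed

lemma SYT_eq:
  assumes "partition_of lam n" shows "SYT lam = fill ` Tab (cells lam)"
proof -
  have s: "sum_list lam = card (cells lam)" using card_cells[OF assms] assms by (simp add: partition_of_def)
  have "T \<in> SYT lam \<longleftrightarrow> std_filling (cells lam) T" for T
  proof -
    have "(\<forall>i j j'. (i, j) \<in> diagram lam \<longrightarrow> (i, j') \<in> diagram lam \<longrightarrow> j < j' \<longrightarrow> T (i, j) < T (i, j')) \<longleftrightarrow>
      (\<forall>i j j'. (i, j) \<in> cells lam \<longrightarrow> (i, j') \<in> cells lam \<longrightarrow> j < j' \<longrightarrow> T (box (i, j)) < T (box (i, j')))"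
      unfolding diagram_cells by (force simp: image_iff)
    moreover have "(\<forall>i i' j. (i, j) \<in> diagram lam \<longrightarrow> (i', j) \<in> diagram lam \<longrightarrow> i < i' \<longrightarrow> T (i, j) < T (i', j)) \<longleftrightarrow>
      (\<forall>i i' j. (i, j) \<in> cells lam \<longrightarrow> (i', j) \<in> cells lam \<longrightarrow> i < i' \<longrightarrow> T (box (i, j)) < T (box (i', j)))"
      unfolding diagram_cells by (force simp: image_iff)
    ultimately show ?thesis
      unfolding SYT_def std_filling_def s mem_Collect_eq unfolding diagram_cells by blast
  qed
  then show ?thesis using std_filling_fill fill_std_filling[OF shape_cells[OF assms]] by blast
qed


section \<open>Jeu de taquin slides and evacuation on lists of boxes\<close>

lemma jdt_step_relabel:
  assumes "strict_mono f" "f 0 = (0::nat)"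
  shows "jdt_step (f \<circ> T, p) = map_prod (\<lambda>U. f \<circ> U) id (jdt_step (T, p))"
proof -
  obtain i j where p: "p = (i, j)" by (cases p)
  have z: "f x = 0 \<longleftrightarrow> x = 0" for x using strict_mono_eq[OF assms(1), of x 0] assms(2) by simp
  have l: "f x < f y \<longleftrightarrow> x < y" for x y using strict_mono_less[OF assms(1)] .
  show ?thesis unfolding p by (auto simp: Let_def z l fun_eq_iff assms(2))
qed

lemma jdt_iter_relabel:
  assumes "strict_mono f" "f 0 = (0::nat)"
  shows "(jdt_step ^^ k) (f \<circ> T, p) = map_prod (\<lambda>U. f \<circ> U) id ((jdt_step ^^ k) (T, p))"
proof (induction k)
  case (Suc k)
  obtain U q where "(jdt_step ^^ k) (T, p) = (U, q)" by (cases "(jdt_step ^^ k) (T, p)")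
  then show ?case
    unfolding funpow.simps comp_apply[of jdt_step] Suc.IH by (simp only: map_prod_simp id_def jdt_step_relabel[OF assms])
qed simp

text \<open>Slides only compare entries and test them for 0, and the values of the result come from
  the recursion depth. This absorbs the fact that \<open>evacuation\<close> does not lower the
  remaining entries between slides.\<close>

lemma evacuation_relabel:
  assumes "strict_mono f" "f 0 = (0::nat)"
  shows "evacuation k (f \<circ> T) = evacuation k T"
proof (induction k arbitrary: T)
  case (Suc k)
  have "(f \<circ> T)((1, 1) := 0) = f \<circ> T((1, 1) := 0)" using assms(2) by (auto simp: fun_eq_iff)
  then have e: "jdt_slide (Suc k) (f \<circ> T) = map_prod (\<lambda>U. f \<circ> U) id (jdt_slide (Suc k) T)"
    unfolding jdt_slide_def by (simp only: jdt_iter_relabel[OF assms])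
  obtain U q where "jdt_slide (Suc k) T = (U, q)" by (cases "jdt_slide (Suc k) T")
  then show ?case unfolding evacuation.simps e by (simp only: map_prod_simp id_apply Let_def case_prod_conv Suc.IH)
qed simp

text \<open>After the entry 1 has been deleted, the entries left start at 2: a standard filling
  raised by one, with empty boxes staying at 0.\<close>

definition incr :: "nat \<Rightarrow> nat" where
  "incr x = (if x = 0 then 0 else Suc x)"

lemma incr: "strict_mono incr" "incr 0 = 0"
  by (auto simp: incr_def strict_mono_def)

text \<open>The head of the result is the box vacated by a slide and the tail is the slid tableau,
  as \<open>jdt_slide_fill\<close> shows. The recursion applies the involutions from the smallest
  entries upwards.\<close>

fun prom :: "cell list \<Rightarrow> cell list" where
  "prom [] = []"
| "prom (a # w) = sw 0 (a # prom w)"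

fun evac :: "nat \<Rightarrow> cell list \<Rightarrow> cell list" where
  "evac 0 w = w"
| "evac (Suc k) w = hd (prom w) # evac k (tl (prom w))"

lemma length_prom [simp]: "length (prom w) = length w"
  by (induction w) (simp_all add: length_sw)

lemma set_prom [simp]: "set (prom w) = set w"
proof (induction w)
  case (Cons a w)
  then show ?case using set_sw[of 0 "a # prom w"] by simp
qed simp

lemma std_prom: "std w \<Longrightarrow> std (prom w)"
  by (induction w) (simp_all add: std_sw)

text \<open>The order of the quantifiers matters: one word serves all lists of the given length, so
  that promotion can come from a single group element.\<close>

lemma prom_fold: "\<exists>ws. \<forall>w. length w = k \<longrightarrow> prom w = fold sw ws w"
proof (induction k)
  case 0
  show ?case by (rule exI[of _ "[]"]) simp
next
  case (Suc k)
  then obtain ws where ws: "\<And>w. length w = k \<Longrightarrow> prom w = fold sw ws w" by blast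
  have "prom w = fold sw (map Suc ws @ [0]) w" if "length w = Suc k" for w
    using that ws by (cases w) (auto simp: fold_sw_Cons)
  then show ?case by blast
qed

lemma evac_fold: "\<exists>ws. \<forall>w. length w = k \<longrightarrow> evac k w = fold sw ws w"
proof (induction k)
  case 0
  show ?case by (rule exI[of _ "[]"]) simp
next
  case (Suc k)
  then obtain ws where ws: "\<And>w. length w = k \<Longrightarrow> evac k w = fold sw ws w" by blast
  obtain vs where vs: "\<And>w. length w = Suc k \<Longrightarrow> prom w = fold sw vs w" using prom_fold by blast
  have "evac (Suc k) w = fold sw (vs @ map Suc ws) w" if l: "length w = Suc k" for w
  proof -
    obtain c v where cv: "prom w = c # v" "length v = k" using l by (metis length_Suc_conv length_prom)
    then show ?thesis using vs[OF l] ws[OF cv(2)] by (simp add: fold_sw_Cons)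
  qed
  then show ?case by blast
qed

lemma length_fold_sw [simp]: "length (fold sw ws w) = length w"
  by (induction ws arbitrary: w) simp_all

lemma length_evac [simp]: "length w = k \<Longrightarrow> length (evac k w) = k"
  using evac_fold[of k] by auto

lemma fold_sw_append: "fold sw (map ((+) (length u)) ws) (u @ w) = u @ fold sw ws w"
proof (induction ws arbitrary: w)
  case (Cons i ws)
  have "sw (length u + i) (u @ w) = u @ sw i w" by (induction u) auto
  then show ?case using Cons by simp
qed simp

lemma jdt_step_if:
  "jdt_step (T, i, j) =
    (if T (i, Suc j) = 0 \<and> T (Suc i, j) = 0 then (T, i, j)
     else if T (Suc i, j) = 0 \<or> T (i, Suc j) \<noteq> 0 \<and> T (i, Suc j) < T (Suc i, j)
     then (T((i, j) := T (i, Suc j), (i, Suc j) := 0), i, Suc j)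
     else (T((i, j) := T (Suc i, j), (Suc i, j) := 0), Suc i, j))"
  by (simp add: Let_def)

declare jdt_step.simps [simp del]

text \<open>A slide through a filling with an additional largest entry \<open>M\<close> at \<open>x\<close> follows the slide
  through the smaller entries; only when that slide has come to rest next to \<open>x\<close> does it make
  one more step, into \<open>x\<close>.\<close>

lemma jdt_step_extra:
  assumes "U x = 0" "p \<noteq> x" "\<And>y. U y < M"
    and step: "jdt_step (U, p) = (U', p')"
    and p: "p = (i, j)"
  shows "U' x = 0" "p' \<noteq> x" "\<And>y. U' y < M"
    "U (i, Suc j) \<noteq> 0 \<or> U (Suc i, j) \<noteq> 0 \<Longrightarrow> jdt_step (U(x := M), p) = (U'(x := M), p')"
    "U (i, Suc j) = 0 \<Longrightarrow> U (Suc i, j) = 0 \<Longrightarrow> U' = U \<and> p' = p \<and>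
       (if x = (i, Suc j) \<or> x = (Suc i, j) then jdt_step (U(x := M), p) = (U(p := M), x)
        else jdt_step (U(x := M), p) = (U(x := M), p))"
proof -
  have M: "0 < M" using assms(3)[of x] by simp
  note step' = step[unfolded p jdt_step_if]
  note lt = assms(3)[of "(i, Suc j)"] assms(3)[of "(Suc i, j)"]
  let ?a = "U (i, Suc j)" and ?b = "U (Suc i, j)"
  consider (0) "?a = 0" "?b = 0" | (r) "?a \<noteq> 0" "?b = 0 \<or> ?a < ?b" | (d) "?b \<noteq> 0" "\<not> (?a \<noteq> 0 \<and> ?a < ?b)"
    by blast
  then have "U' x = 0 \<and> p' \<noteq> x \<and> (\<forall>y. U' y < M) \<and>
    (?a \<noteq> 0 \<or> ?b \<noteq> 0 \<longrightarrow> jdt_step (U(x := M), p) = (U'(x := M), p')) \<and>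
    (?a = 0 \<longrightarrow> ?b = 0 \<longrightarrow> U' = U \<and> p' = p \<and>
       (if x = (i, Suc j) \<or> x = (Suc i, j) then jdt_step (U(x := M), p) = (U(p := M), x)
        else jdt_step (U(x := M), p) = (U(x := M), p)))"
  proof cases
    case 0
    then have e: "U' = U" "p' = (i, j)" using step' by auto
    show ?thesis
      unfolding e p jdt_step_if using 0 assms(1-3) M p by (auto simp: fun_upd_twist)
  next
    case r
    then have e: "U' = U((i, j) := ?a, (i, Suc j) := 0)" "p' = (i, Suc j)" using step' by auto
    have nx: "x \<noteq> (i, Suc j)" using r assms(1) by metis
    have "jdt_step (U(x := M), p) = (U'(x := M), p')"
      unfolding e p jdt_step_if using r nx lt assms(1,2) p by (auto simp: fun_upd_twist)
    then show ?thesis using r e nx assms(1-3) p M by (auto simp: fun_upd_def)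
  next
    case d
    then have e: "U' = U((i, j) := ?b, (Suc i, j) := 0)" "p' = (Suc i, j)" using step' by auto
    have nx: "x \<noteq> (Suc i, j)" using d assms(1) by metis
    have "jdt_step (U(x := M), p) = (U'(x := M), p')"
      unfolding e p jdt_step_if using d nx lt assms(1,2) p by (auto simp: fun_upd_twist)
    then show ?thesis using d e nx assms(1-3) p M by (auto simp: fun_upd_def)
  qed
  then show "U' x = 0" "p' \<noteq> x" "\<And>y. U' y < M"
    "?a \<noteq> 0 \<or> ?b \<noteq> 0 \<Longrightarrow> jdt_step (U(x := M), p) = (U'(x := M), p')"
    "?a = 0 \<Longrightarrow> ?b = 0 \<Longrightarrow> U' = U \<and> p' = p \<and>
       (if x = (i, Suc j) \<or> x = (Suc i, j) then jdt_step (U(x := M), p) = (U(p := M), x)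
        else jdt_step (U(x := M), p) = (U(x := M), p))"
    by blast+
qed

text \<open>After any number of steps the two slides either agree, or the smaller one rests beside
  \<open>x\<close> and the larger one has already made its extra step. The hole then stays at
  \<open>x\<close>, because the boxes to the right of and below \<open>x\<close> are empty
  throughout.\<close>

lemma jdt_iter_extra:
  fixes U0 :: tableau
  assumes U0: "U0 x = 0" "p0 \<noteq> x" "\<And>y. U0 y < M"
    and nx: "\<And>y. y = (fst x, Suc (snd x)) \<or> y = (Suc (fst x), snd x) \<Longrightarrow>
       U0 y = 0 \<and> y \<noteq> p0"
    and st: "(jdt_step ^^ m) (U0, p0) = (U, i, j)"
  shows "U x = 0 \<and> (i, j) \<noteq> x \<and> (\<forall>y. U y < M) \<and>
    (\<forall>y. y = (fst x, Suc (snd x)) \<or> y = (Suc (fst x), snd x) \<longrightarrow> U y = 0 \<and> y \<noteq> (i, j)) \<and>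
    ((jdt_step ^^ m) (U0(x := M), p0) = (U(x := M), i, j) \<or>
     U (i, Suc j) = 0 \<and> U (Suc i, j) = 0 \<and> (x = (i, Suc j) \<or> x = (Suc i, j)) \<and>
     (jdt_step ^^ m) (U0(x := M), p0) = (U((i, j) := M), x))"
  using st
proof (induction m arbitrary: U i j)
  case 0
  then show ?case using U0 nx by auto
next
  case (Suc m)
  obtain V k l where V: "(jdt_step ^^ m) (U0, p0) = (V, k, l)" by (cases "(jdt_step ^^ m) (U0, p0)")
  note IH = Suc.IH[OF V]
  have step: "jdt_step (V, k, l) = (U, i, j)" using Suc.prems V by simp
  have inv: "V x = 0" "(k, l) \<noteq> x" "\<And>y. V y < M" using IH by auto
  note IHfar = IH[THEN conjunct2, THEN conjunct2, THEN conjunct2, THEN conjunct1, rule_format]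
  note IHst = IH[THEN conjunct2, THEN conjunct2, THEN conjunct2, THEN conjunct2]
  note ex = jdt_step_extra[OF inv step HOL.refl]
  have far: "U y = 0 \<and> y \<noteq> (i, j)" if y: "y = (fst x, Suc (snd x)) \<or> y = (Suc (fst x), snd x)" for y
  proof -
    have "V y = 0" "y \<noteq> (k, l)" using IHfar[OF y] by simp_all
    then show ?thesis using step by (auto simp: jdt_step_if split: if_splits)
  qed
  from IHst have "(jdt_step ^^ Suc m) (U0(x := M), p0) = (U(x := M), i, j) \<or>
     U (i, Suc j) = 0 \<and> U (Suc i, j) = 0 \<and> (x = (i, Suc j) \<or> x = (Suc i, j)) \<and>
     (jdt_step ^^ Suc m) (U0(x := M), p0) = (U((i, j) := M), x)"
  proof
    assume s: "(jdt_step ^^ m) (U0(x := M), p0) = (V(x := M), k, l)"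
    show ?thesis
    proof (cases "V (k, Suc l) \<noteq> 0 \<or> V (Suc k, l) \<noteq> 0")
      case True
      then show ?thesis using ex(4)[OF True] s by simp
    next
      case False
      then show ?thesis using ex(5) s by (auto split: if_splits)
    qed
  next
    assume s: "V (k, Suc l) = 0 \<and> V (Suc k, l) = 0 \<and> (x = (k, Suc l) \<or> x = (Suc k, l)) \<and>
     (jdt_step ^^ m) (U0(x := M), p0) = (V((k, l) := M), x)"
    have U: "U = V" "i = k" "j = l" using ex(5) s by auto
    obtain x1 x2 where x: "x = (x1, x2)" by (cases x)
    have "V (x1, Suc x2) = 0" "V (Suc x1, x2) = 0" "(x1, Suc x2) \<noteq> (k, l)" "(Suc x1, x2) \<noteq> (k, l)"
      using IHfar[of "(x1, Suc x2)"] IHfar[of "(Suc x1, x2)"] x by auto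
    then have "jdt_step (V((k, l) := M), x) = (V((k, l) := M), x)"
      unfolding x by (auto simp: jdt_step_if)
    then show ?thesis using s U by simp
  qed
  then show ?case using ex(1-3) far by blast
qed

text \<open>The slide through \<open>w\<close> comes to rest at the head \<open>c\<close> of
  \<open>prom w\<close>. If the box \<open>a\<close> of the largest entry is aligned with
  \<open>c\<close>, it is adjacent, its entry moves into \<open>c\<close> and \<open>a\<close> is
  vacated; otherwise that entry stays and \<open>c\<close> is vacated. This is the rule of
  \<open>sw 0\<close> on \<open>a # c # v\<close>.\<close>

lemma jdt_slide_fill:
  assumes "std w" "w \<noteq> []"
  shows "jdt_slide (length w) (fill w) = (incr \<circ> fill (tl (prom w)), box (hd (prom w)))"
  using assms
proof (induction w)
  case (Cons a w)
  show ?case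
  proof (cases "w = []")
    case True
    then have "a = (0, 0)" using std_last[OF Cons.prems(1)] by simp
    then show ?thesis using True by (auto simp: jdt_slide_def fun_eq_iff incr_def jdt_step_if)
  next
    case False
    have w: "std w" "a \<notin> set w" "shape (insert a (set w))" using Cons.prems by auto
    obtain c v where cv: "prom w = c # v" using False by (metis length_0_conv length_prom neq_Nil_conv)
    have cv_std: "std (c # v)" "insert c (set v) = set w" "length w = Suc (length v)"
      using std_prom[OF w(1)] set_prom[of w] length_prom[of w] cv by auto
    obtain ci cj where c: "c = (ci, cj)" by (cases c)
    obtain ai aj where a: "a = (ai, aj)" by (cases a)
    have cor: "corner (set w) c" using std_corner[OF cv_std(1)] cv_std(2) by simp
    let ?Z = "(fill w)((1, 1) := 0)" and ?M = "Suc (length w)" and ?x = "box a"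
    let ?U = "incr \<circ> fill v"
    have o: "(0, 0) \<in> set w" using origin_in[OF std_shape[OF w(1)]] False by simp
    have a0: "(ai, aj) \<noteq> (0, 0)" using o w(2) a by metis
    have ne: "box a \<noteq> (1, 1)" using a0 a by simp
    have sl: "(jdt_step ^^ length w) (?Z, 1, 1) = (?U, box c)"
      using Cons.IH[OF w(1) False] cv unfolding jdt_slide_def by (simp add: comp_def)
    have cora: "corner (insert a (set w)) a" using std_corner[OF Cons.prems(1)] .
    have xa: "fill w (box a) = 0" using fill_out[of "box a" w] w(2) by simp
    have out: "fill w y = 0 \<and> y \<noteq> (1, 1)" if "y = (fst ?x, Suc (snd ?x)) \<or> y = (Suc (fst ?x), snd ?x)" for y
    proof -
      have "y = box (ai, Suc aj) \<or> y = box (Suc ai, aj)" using that a by auto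
      moreover have "(ai, Suc aj) \<notin> set w" "(Suc ai, aj) \<notin> set w"
        using cora a by (auto simp: corner_def)
      moreover from this have "box (ai, Suc aj) \<notin> box ` set w" "box (Suc ai, aj) \<notin> box ` set w"
        by (simp_all only: box_in not_False_eq_True)
      moreover note a0
      ultimately show ?thesis using fill_out by auto
    qed
    have slM: "(jdt_step ^^ length w) (?Z(?x := ?M), 1, 1) = (?U(?x := ?M), box c) \<or>
       (?x = (Suc ci, Suc (Suc cj)) \<or> ?x = (Suc (Suc ci), Suc cj)) \<and>
       (jdt_step ^^ length w) (?Z(?x := ?M), 1, 1) = (?U(box c := ?M), ?x)"
      and invx: "?U ?x = 0" "box c \<noteq> ?x" "\<And>y. ?U y < ?M"
        "\<And>y. y = (fst ?x, Suc (snd ?x)) \<or> y = (Suc (fst ?x), snd ?x) \<Longrightarrow> ?U y = 0 \<and> y \<noteq> box c"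
    proof -
      have le: "?Z y < ?M" for y using fill_le[of w y] by simp
      note h = jdt_iter_extra[of ?Z ?x "(1, 1)" ?M "length w" ?U "Suc ci" "Suc cj"]
      have "?U ?x = 0 \<and> (Suc ci, Suc cj) \<noteq> ?x \<and> (\<forall>y. ?U y < ?M) \<and>
        (\<forall>y. y = (fst ?x, Suc (snd ?x)) \<or> y = (Suc (fst ?x), snd ?x) \<longrightarrow> ?U y = 0 \<and> y \<noteq> (Suc ci, Suc cj)) \<and>
        ((jdt_step ^^ length w) (?Z(?x := ?M), 1, 1) = (?U(?x := ?M), Suc ci, Suc cj) \<or>
         ?U (Suc ci, Suc (Suc cj)) = 0 \<and> ?U (Suc (Suc ci), Suc cj) = 0 \<and>
         (?x = (Suc ci, Suc (Suc cj)) \<or> ?x = (Suc (Suc ci), Suc cj)) \<and>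
         (jdt_step ^^ length w) (?Z(?x := ?M), 1, 1) = (?U((Suc ci, Suc cj) := ?M), ?x))"
      proof (rule h)
        show "?Z ?x = 0" using xa by simp
        show "(1, 1) \<noteq> ?x" using ne by simp
        show "(jdt_step ^^ length w) (?Z, 1, 1) = (?U, Suc ci, Suc cj)" using sl c by simp
        show "?Z y = 0 \<and> y \<noteq> (1, 1)"
          if "y = (fst ?x, Suc (snd ?x)) \<or> y = (Suc (fst ?x), snd ?x)" for y
          using out[OF that] by simp
      qed (rule le)
      then show "(jdt_step ^^ length w) (?Z(?x := ?M), 1, 1) = (?U(?x := ?M), box c) \<or>
       (?x = (Suc ci, Suc (Suc cj)) \<or> ?x = (Suc (Suc ci), Suc cj)) \<and>
       (jdt_step ^^ length w) (?Z(?x := ?M), 1, 1) = (?U(box c := ?M), ?x)"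
        "?U ?x = 0" "box c \<noteq> ?x" "\<And>y. ?U y < ?M"
        "\<And>y. y = (fst ?x, Suc (snd ?x)) \<or> y = (Suc (fst ?x), snd ?x) \<Longrightarrow> ?U y = 0 \<and> y \<noteq> box c"
        unfolding c by (simp_all only: map_prod_simp, blast+)
    qed
    have stuck: "?U (Suc ci, Suc (Suc cj)) = 0" "?U (Suc (Suc ci), Suc cj) = 0"
    proof -
      have "(ci, Suc cj) \<notin> set v" "(Suc ci, cj) \<notin> set v"
        using cor c cv_std(2) unfolding corner_def by auto
      then have "fill v (box (ci, Suc cj)) = 0" "fill v (box (Suc ci, cj)) = 0"
        using fill_out[of "box (ci, Suc cj)" v] fill_out[of "box (Suc ci, cj)" v] by (simp_all del: map_prod_simp)
      then show "?U (Suc ci, Suc (Suc cj)) = 0" "?U (Suc (Suc ci), Suc cj) = 0" by (simp_all add: incr_def)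
    qed
    have al: "aligned a c \<longleftrightarrow> ?x = (Suc ci, Suc (Suc cj)) \<or> ?x = (Suc (Suc ci), Suc cj)"
      using aligned_addable[OF std_shape[OF w(1)] cor[unfolded c] w(3,2)] a c
      by (auto simp: aligned_def)
    obtain V q where Vq: "jdt_step (?U, box c) = (V, q)" by (cases "jdt_step (?U, box c)")
    have e0: "(fill (a # w))((1, 1) := 0) = ?Z(?x := ?M)" using ne by (auto simp: fun_eq_iff)
    have ex: "if aligned a c then jdt_step (?U(?x := ?M), box c) = (?U(box c := ?M), ?x)
        else jdt_step (?U(?x := ?M), box c) = (?U(?x := ?M), box c)"
    proof -
      have bc: "box c = (Suc ci, Suc cj)" using c by simp
      show ?thesis
        unfolding al using jdt_step_extra(5)[OF invx(1-3) Vq bc stuck] by (elim conjE)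
    qed
    have st: "jdt_step (?U(box c := ?M), ?x) = (?U(box c := ?M), ?x)"
      using invx(4)[of "(Suc ai, Suc (Suc aj))"] invx(4)[of "(Suc (Suc ai), Suc aj)"] a
      by (simp add: jdt_step_if)
    \<comment> \<open>The first \<open>length w\<close> steps may or may not contain the extra step
      into \<open>a\<close>; the one further step granted by the longer list settles both
      possibilities in the same way.\<close>
    have res: "jdt_slide (length (a # w)) (fill (a # w)) =
      (if aligned a c then (?U(box c := ?M), ?x) else (?U(?x := ?M), box c))"
      unfolding jdt_slide_def e0
    proof (cases "aligned a c")
      case True
      then have "(jdt_step ^^ length w) (?Z(?x := ?M), 1, 1) = (?U(?x := ?M), box c) \<or>
        (jdt_step ^^ length w) (?Z(?x := ?M), 1, 1) = (?U(box c := ?M), ?x)"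
        using slM by blast
      moreover have "jdt_step (?U(?x := ?M), box c) = (?U(box c := ?M), ?x)"
        using ex True by (simp only: if_True)
      ultimately show "(jdt_step ^^ length (a # w)) (?Z(?x := ?M), 1, 1) =
        (if aligned a c then (?U(box c := ?M), ?x) else (?U(?x := ?M), box c))"
        using True st by (auto simp only: length_Cons funpow.simps comp_apply if_True)
    next
      case False
      then have "(jdt_step ^^ length w) (?Z(?x := ?M), 1, 1) = (?U(?x := ?M), box c)"
        using slM al by blast
      moreover have "jdt_step (?U(?x := ?M), box c) = (?U(?x := ?M), box c)"
        using ex False by (simp only: if_False)
      ultimately show "(jdt_step ^^ length (a # w)) (?Z(?x := ?M), 1, 1) =
        (if aligned a c then (?U(box c := ?M), ?x) else (?U(?x := ?M), box c))"
        using False by (simp only: length_Cons funpow.simps comp_apply if_False)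
    qed
    have up: "?U(box d := ?M) = incr \<circ> fill (d # v)" for d
      using cv_std(3) by (auto simp: fun_eq_iff incr_def)
    show ?thesis
      unfolding res up using cv by auto
  qed
qed simp

lemma evacuation_fill:
  "std w \<Longrightarrow> length w = k \<Longrightarrow> evacuation k (fill w) = fill (evac k w)"
proof (induction k arbitrary: w)
  case (Suc k)
  have ne: "w \<noteq> []" using Suc.prems by auto
  obtain c v where cv: "prom w = c # v" using ne by (metis length_0_conv length_prom neq_Nil_conv)
  have v: "std v" "length v = k" using std_prom[OF Suc.prems(1)] length_prom[of w] cv Suc.prems by auto
  have "jdt_slide (Suc k) (fill w) = (incr \<circ> fill v, box c)"
    using jdt_slide_fill[OF Suc.prems(1) ne] cv Suc.prems(2) by simp
  then show ?case
    using Suc.IH[OF v] evacuation_relabel[OF incr, of k "fill v"] cv v(2) by simp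
qed simp

lemma partial_evacuation_fill:
  assumes "std (u @ v)" "length v = m"
  shows "partial_evacuation m (fill (u @ v)) = fill (u @ evac m v)"
proof -
  have sv: "std v" using assms(1) by (induction u) auto
  have r: "(\<lambda>d. if fill (u @ v) d \<le> m then fill (u @ v) d else 0) = fill v"
  proof
    fix d
    have "fill v d = 0" if "d \<in> box ` set u"
      using std_distinct[OF assms(1)] that by (intro fill_out) auto
    then show "(if fill (u @ v) d \<le> m then fill (u @ v) d else 0) = fill v d"
      using fill_append_gt[of d u v] fill_append_out[of d u v] fill_le[of v d] assms(2)
      by (cases "d \<in> box ` set u") auto
  qed
  show ?thesis
  proof
    fix d
    show "partial_evacuation m (fill (u @ v)) d = fill (u @ evac m v) d"
      unfolding partial_evacuation_def r evacuation_fill[OF sv assms(2)]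
      using fill_append_gt[of d u v] fill_append_out[of d u] fill_le[of v d] assms(2)
        fill_append_in[of d u v "evac m v"]
      by (cases "d \<in> box ` set u") auto
  qed
qed


section \<open>The action of the cactus group\<close>

locale tableau_action =
  fixes n :: nat and lam :: "nat list" and \<phi> :: "(nat \<times> nat) list set \<Rightarrow> tableau \<Rightarrow> tableau"
  assumes part: "partition_of lam n" and act: "cactus_SYT_action n lam \<phi>"
begin

sublocale group_action "cactus_group n" "SYT lam" \<phi>
  using act by (simp add: cactus_SYT_action_def)

abbreviation X :: "cell list set" where
  "X \<equiv> Tab (cells lam)"

lemma X_length: "w \<in> X \<Longrightarrow> length w = n"
  using Tab_length card_cells[OF part] by simp

lemma fill_X [simp]: "w \<in> X \<Longrightarrow> fill w \<in> SYT lam"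
  using SYT_eq[OF part] by blast

lemma fill_X_eq: "v \<in> X \<Longrightarrow> w \<in> X \<Longrightarrow> fill v = fill w \<longleftrightarrow> v = w"
  using fill_inj[of v w] X_length[of v] X_length[of w] std_distinct by (auto simp: Tab_def)

section \<open>Every word of involutions is realised by a group element\<close>

definition realized :: "(cell list \<Rightarrow> cell list) \<Rightarrow> bool" where
  "realized f \<longleftrightarrow> (\<exists>g\<in>carrier (cactus_group n). \<forall>w\<in>X. \<phi> g (fill w) = fill (f w))"

lemma realized_cong: "realized f \<Longrightarrow> (\<And>w. w \<in> X \<Longrightarrow> f w = f' w) \<Longrightarrow> realized f'"
  unfolding realized_def by simp

lemma realized_id: "realized (\<lambda>w. w)"
proof -
  have "\<phi> \<one>\<^bsub>cactus_group n\<^esub> (fill w) = fill w" if "w \<in> X" for w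
    using id_eq_one that by (metis fill_X restrict_apply')
  then show ?thesis unfolding realized_def
    using group.is_monoid[OF group_cactus_group] monoid.one_closed by blast
qed

lemma realized_comp:
  assumes "realized f" "realized f'" "\<And>w. w \<in> X \<Longrightarrow> f' w \<in> X"
  shows "realized (\<lambda>w. f (f' w))"
proof -
  obtain g g' where g: "g \<in> carrier (cactus_group n)" "\<And>w. w \<in> X \<Longrightarrow> \<phi> g (fill w) = fill (f w)"
    and g': "g' \<in> carrier (cactus_group n)" "\<And>w. w \<in> X \<Longrightarrow> \<phi> g' (fill w) = fill (f' w)"
    using assms(1,2) unfolding realized_def by blast
  have "\<phi> (g \<otimes>\<^bsub>cactus_group n\<^esub> g') (fill w) = fill (f (f' w))" if "w \<in> X" for w
    using composition_rule[OF fill_X[OF that] g(1) g'(1)] g(2) g'(2) assms(3) that by simp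
  moreover have "g \<otimes>\<^bsub>cactus_group n\<^esub> g' \<in> carrier (cactus_group n)"
    using g g' group_cactus_group group.is_monoid monoid.m_closed by metis
  ultimately show ?thesis unfolding realized_def by blast
qed

text \<open>On tableaux, \<open>h\<close> is the inverse of \<open>f\<close> after \<open>k\<close>.
  In this way promotion is obtained from two evacuations; the right-hand version below then yields
  the involutions from two promotions.\<close>

lemma realized_cancel_left:
  assumes "realized f" "realized k" "\<And>w. w \<in> X \<Longrightarrow> h w \<in> X" "\<And>w. w \<in> X \<Longrightarrow> f (h w) = k w"
  shows "realized h"
proof -
  obtain g g' where g: "g \<in> carrier (cactus_group n)" "\<And>w. w \<in> X \<Longrightarrow> \<phi> g (fill w) = fill (f w)"
    and g': "g' \<in> carrier (cactus_group n)" "\<And>w. w \<in> X \<Longrightarrow> \<phi> g' (fill w) = fill (k w)"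
    using assms(1,2) unfolding realized_def by blast
  let ?i = "inv\<^bsub>cactus_group n\<^esub> g"
  have i: "?i \<in> carrier (cactus_group n)" using group.inv_closed[OF group_cactus_group g(1)] .
  have "\<phi> (?i \<otimes>\<^bsub>cactus_group n\<^esub> g') (fill w) = fill (h w)" if w: "w \<in> X" for w
  proof -
    have "\<phi> g (fill (h w)) = \<phi> g' (fill w)" using g(2)[of "h w"] g'(2) assms(3,4) w by simp
    then have "\<phi> ?i (\<phi> g' (fill w)) = fill (h w)"
      using orbit_sym_aux[OF g(1), of "fill (h w)"] assms(3) w by simp
    then show ?thesis using composition_rule[OF fill_X[OF w] i g'(1)] by simp
  qed
  moreover have "?i \<otimes>\<^bsub>cactus_group n\<^esub> g' \<in> carrier (cactus_group n)"
    using i g' group_cactus_group group.is_monoid monoid.m_closed by metis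
  ultimately show ?thesis unfolding realized_def by blast
qed

lemma realized_cancel_right:
  assumes "realized f" "realized k" "\<And>w. w \<in> X \<Longrightarrow> f w \<in> X" "\<And>w. w \<in> X \<Longrightarrow> h (f w) = k w"
  shows "realized h"
proof -
  obtain g g' where g: "g \<in> carrier (cactus_group n)" "\<And>w. w \<in> X \<Longrightarrow> \<phi> g (fill w) = fill (f w)"
    and g': "g' \<in> carrier (cactus_group n)" "\<And>w. w \<in> X \<Longrightarrow> \<phi> g' (fill w) = fill (k w)"
    using assms(1,2) unfolding realized_def by blast
  let ?i = "inv\<^bsub>cactus_group n\<^esub> g"
  have i: "?i \<in> carrier (cactus_group n)" using group.inv_closed[OF group_cactus_group g(1)] .
  have "\<phi> (g' \<otimes>\<^bsub>cactus_group n\<^esub> ?i) (fill v) = fill (h v)" if v: "v \<in> X" for v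
  proof -
    have "\<phi> ?i (fill v) \<in> SYT lam" using element_image[OF i fill_X[OF v]] by blast
    then obtain w where w: "w \<in> X" "\<phi> ?i (fill v) = fill w" using SYT_eq[OF part] by auto
    have "\<phi> (inv\<^bsub>cactus_group n\<^esub> ?i) (fill w) = fill v" using orbit_sym_aux[OF i fill_X[OF v] w(2)] .
    then have "\<phi> g (fill w) = fill v"
      using group.inv_inv[OF group_cactus_group g(1)] by simp
    then have "f w = v" using g(2)[OF w(1)] fill_X_eq assms(3) w v by simp
    then have "\<phi> g' (\<phi> ?i (fill v)) = fill (h v)" using g'(2)[OF w(1)] w assms(4) by auto
    then show ?thesis using composition_rule[OF fill_X[OF v] g'(1) i] by simp
  qed
  moreover have "g' \<otimes>\<^bsub>cactus_group n\<^esub> ?i \<in> carrier (cactus_group n)"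
    using i g' group_cactus_group group.is_monoid monoid.m_closed by metis
  ultimately show ?thesis unfolding realized_def by blast
qed

text \<open>The entries from 1 to \<open>j\<close> occupy the last \<open>j\<close> positions of a
  list of length \<open>n\<close>.\<close>

definition evac_upto :: "nat \<Rightarrow> cell list \<Rightarrow> cell list" where
  "evac_upto j w = take (n - j) w @ evac j (drop (n - j) w)"

definition prom_upto :: "nat \<Rightarrow> cell list \<Rightarrow> cell list" where
  "prom_upto j w = take (n - j) w @ prom (drop (n - j) w)"

lemma evac_upto_fold:
  assumes "j \<le> n" obtains ws where "\<And>w. w \<in> X \<Longrightarrow> evac_upto j w = fold sw ws w"
proof -
  obtain ws where ws: "\<And>w. length w = j \<Longrightarrow> evac j w = fold sw ws w" using evac_fold by blast
  have "evac_upto j w = fold sw (map ((+) (n - j)) ws) w" if "w \<in> X" for w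
    using fold_sw_append[of "take (n - j) w" ws "drop (n - j) w"] ws[of "drop (n - j) w"]
      X_length[OF that] assms unfolding evac_upto_def by simp
  then show thesis using that by blast
qed

lemma prom_upto_fold:
  assumes "j \<le> n" obtains ws where "\<And>w. w \<in> X \<Longrightarrow> prom_upto j w = fold sw ws w"
proof -
  obtain ws where ws: "\<And>w. length w = j \<Longrightarrow> prom w = fold sw ws w" using prom_fold by blast
  have "prom_upto j w = fold sw (map ((+) (n - j)) ws) w" if "w \<in> X" for w
    using fold_sw_append[of "take (n - j) w" ws "drop (n - j) w"] ws[of "drop (n - j) w"]
      X_length[OF that] assms unfolding prom_upto_def by simp
  then show thesis using that by blast
qed

lemma gen_act:
  assumes "1 < j" "j \<le> n" "w \<in> X"
  shows "\<phi> (cactus_gen n 1 j) (fill w) = fill (evac_upto j w)"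
proof -
  have "\<phi> (cactus_gen n 1 j) (fill w) = partial_evacuation j (fill w)"
    using act assms unfolding cactus_SYT_action_def by simp
  also have "fill w = fill (take (n - j) w @ drop (n - j) w)" by simp
  also have "partial_evacuation j \<dots> = fill (evac_upto j w)"
    unfolding evac_upto_def
    by (rule partial_evacuation_fill) (use assms X_length[OF assms(3)] in \<open>auto simp: Tab_def\<close>)
  finally show ?thesis by simp
qed

lemma gen_carrier: "(i, j) \<in> cactus_gens n \<Longrightarrow> cactus_gen n i j \<in> carrier (cactus_group n)"
  unfolding cactus_gen_def cactus_group_def by simp

lemma realized_evac_upto:
  assumes "j \<le> n" shows "realized (evac_upto j)"
proof (cases "1 < j")
  case True
  then have "(1, j) \<in> cactus_gens n" using assms by (simp add: cactus_gens_def)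
  then show ?thesis unfolding realized_def using gen_act[OF True assms] gen_carrier by blast
next
  case False
  have "evac_upto j w = w" if w: "w \<in> X" for w
  proof (cases j)
    case 0
    then show ?thesis by (simp add: evac_upto_def)
  next
    case (Suc k)
    then have j: "j = 1" using False by simp
    have "length (drop (n - 1) w) = Suc 0" using X_length[OF w] assms j by simp
    then obtain c where c: "drop (n - 1) w = [c]" by (metis length_0_conv length_Suc_conv)
    have "evac_upto j w = take (n - 1) w @ [c]" unfolding evac_upto_def j One_nat_def[symmetric] c by simp
    then show ?thesis using c by (metis append_take_drop_id)
  qed
  then show ?thesis using realized_cong[OF realized_id] by simp
qed

lemma evac_upto_prom_upto:
  assumes "Suc j \<le> n" "w \<in> X" shows "evac_upto j (prom_upto (Suc j) w) = evac_upto (Suc j) w"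
proof -
  let ?u = "take (n - Suc j) w" and ?v = "drop (n - Suc j) w"
  have lu: "length ?u = n - Suc j" "length ?v = Suc j" using X_length[OF assms(2)] assms(1) by auto
  obtain c v where cv: "prom ?v = c # v" using lu(2) by (metis length_Suc_conv length_prom)
  have nj: "n - j = Suc (n - Suc j)" using assms(1) by simp
  have "take (n - j) (?u @ c # v) = ?u @ [c]" "drop (n - j) (?u @ c # v) = v"
    using lu(1) unfolding nj by simp_all
  then have "evac_upto j (prom_upto (Suc j) w) = ?u @ c # evac j v"
    unfolding prom_upto_def evac_upto_def cv by simp
  then show ?thesis unfolding evac_upto_def by (simp add: cv)
qed

lemma sw_prom_upto:
  assumes "Suc j \<le> n" "w \<in> X" shows "sw (n - Suc j) (prom_upto j w) = prom_upto (Suc j) w"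
proof -
  let ?u = "take (n - Suc j) w" and ?v = "drop (n - Suc j) w"
  have lu: "length ?u = n - Suc j" "length ?v = Suc j" using X_length[OF assms(2)] assms(1) by auto
  obtain a v where av: "?v = a # v" using lu(2) by (metis length_Suc_conv)
  have nj: "n - j = Suc (n - Suc j)" using assms(1) by simp
  have w: "w = ?u @ a # v" using av by (metis append_take_drop_id)
  have "take (n - j) (?u @ a # v) = ?u @ [a]" "drop (n - j) (?u @ a # v) = v"
    using lu(1) unfolding nj by simp_all
  then have "take (n - j) w = ?u @ [a]" "drop (n - j) w = v" using w by metis+
  then have p: "prom_upto j w = ?u @ a # prom v" unfolding prom_upto_def by simp
  have "sw (length u + 0) (u @ y) = u @ sw 0 y" for u y by (induction u) auto
  then have "sw (n - Suc j) (prom_upto j w) = ?u @ sw 0 (a # prom v)" using p lu(1) by (metis add.right_neutral)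
  then show ?thesis unfolding prom_upto_def av by simp
qed

lemma prom_upto_X: "j \<le> n \<Longrightarrow> w \<in> X \<Longrightarrow> prom_upto j w \<in> X"
  using prom_upto_fold Tab_fold_sw by metis

lemma realized_prom_upto:
  assumes "j \<le> n" shows "realized (prom_upto j)"
proof (cases j)
  case 0
  then show ?thesis using realized_cong[OF realized_id, of "prom_upto j"] X_length by (simp add: prom_upto_def)
next
  case (Suc k)
  then show ?thesis
    using realized_cancel_left[OF realized_evac_upto[of k] realized_evac_upto[of j], of "prom_upto j"] assms evac_upto_prom_upto prom_upto_X
    by auto
qed

lemma realized_sw: "realized (sw i)"
proof (cases "i < n")
  case True
  then obtain j where j: "Suc j \<le> n" "i = n - Suc j" 
    by (intro that[of "n - Suc i"]) auto
  show ?thesis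
    using realized_cancel_right[OF realized_prom_upto[of j] realized_prom_upto[of "Suc j"], of "sw i"] j sw_prom_upto prom_upto_X
    by auto
next
  case False
  have "length w \<le> i \<Longrightarrow> sw i w = w" for w by (induction i w rule: sw.induct) auto
  then show ?thesis using realized_cong[OF realized_id, of "sw i"] X_length False by auto
qed

lemma realized_fold_sw: "realized (fold sw ws)"
proof (induction ws rule: rev_induct)
  case Nil
  show ?case using realized_id by (simp add: id_def)
next
  case (snoc i ws)
  have "realized (\<lambda>w. sw i (fold sw ws w))"
    using realized_comp[OF realized_sw snoc] Tab_fold_sw by blast
  then show ?case by (simp add: comp_def)
qed

section \<open>Every group element acts by a word of involutions\<close>

lemma gen_factor:
  assumes "(i, j) \<in> cactus_gens n"
  shows "cactus_class n [(i, j)] = cactus_gen n 1 j \<otimes>\<^bsub>cactus_group n\<^esub>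
    (cactus_gen n 1 (Suc (j - i)) \<otimes>\<^bsub>cactus_group n\<^esub> cactus_gen n 1 j)"
proof -
  have g: "(1, j) \<in> cactus_gens n" "(1, Suc (j - i)) \<in> cactus_gens n"
    using assms by (auto simp: cactus_gens_def)
  have "{1..Suc (j - i)} \<subseteq> {1..j}" using assms by (auto simp: cactus_gens_def)
  then have "cactus_eq n [(1, j), (1, Suc (j - i)), (1, j)] [(1 + j - Suc (j - i), 1 + j - 1)]"
    using cactus_eq.nested[OF g] by blast
  moreover have "1 + j - Suc (j - i) = i" "1 + j - 1 = j" using assms by (auto simp: cactus_gens_def)
  ultimately have "cactus_eq n [(1, j), (1, Suc (j - i)), (1, j)] [(i, j)]" by simp
  then have "cactus_class n [(i, j)] = cactus_class n [(1, j), (1, Suc (j - i)), (1, j)]"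
    using cactus_class_eq[of "[(1, j), (1, Suc (j - i)), (1, j)]" n "[(i, j)]"] g by simp
  also have "\<dots> = cactus_gen n 1 j \<otimes>\<^bsub>cactus_group n\<^esub>
    (cactus_gen n 1 (Suc (j - i)) \<otimes>\<^bsub>cactus_group n\<^esub> cactus_gen n 1 j)"
    unfolding cactus_gen_def using g by (simp add: cactus_mult)
  finally show ?thesis .
qed

definition is_fold :: "(nat \<times> nat) list set \<Rightarrow> bool" where
  "is_fold g \<longleftrightarrow> g \<in> carrier (cactus_group n) \<and> (\<exists>ws. \<forall>w\<in>X. \<phi> g (fill w) = fill (fold sw ws w))"

lemma is_fold_mult:
  assumes "is_fold g" "is_fold h" shows "is_fold (g \<otimes>\<^bsub>cactus_group n\<^esub> h)"
proof -
  obtain ws vs where g: "g \<in> carrier (cactus_group n)" "\<And>w. w \<in> X \<Longrightarrow> \<phi> g (fill w) = fill (fold sw ws w)"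
    and h: "h \<in> carrier (cactus_group n)" "\<And>w. w \<in> X \<Longrightarrow> \<phi> h (fill w) = fill (fold sw vs w)"
    using assms unfolding is_fold_def by blast
  \<comment> \<open>Here \<open>h\<close> acts before \<open>g\<close>, and \<open>fold\<close>
    consumes its list from the left, so the word of \<open>h\<close> comes first.\<close>
  have "\<phi> (g \<otimes>\<^bsub>cactus_group n\<^esub> h) (fill w) = fill (fold sw (vs @ ws) w)" if "w \<in> X" for w
    using composition_rule[OF fill_X[OF that] g(1) h(1)] g(2) h(2) that Tab_fold_sw by simp
  moreover have "g \<otimes>\<^bsub>cactus_group n\<^esub> h \<in> carrier (cactus_group n)"
    using g h group_cactus_group group.is_monoid monoid.m_closed by metis
  ultimately show ?thesis unfolding is_fold_def by blast
qed

lemma is_fold_gen1: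
  assumes "1 < j" "j \<le> n" shows "is_fold (cactus_gen n 1 j)"
proof -
  obtain ws where "\<And>w. w \<in> X \<Longrightarrow> evac_upto j w = fold sw ws w" using evac_upto_fold[OF assms(2)] by blast
  then show ?thesis
    unfolding is_fold_def using gen_act[OF assms] gen_carrier[of 1 j] assms by (auto simp: cactus_gens_def)
qed

lemma is_fold_class: "u \<in> lists (cactus_gens n) \<Longrightarrow> is_fold (cactus_class n u)"
proof (induction u)
  case Nil
  have e: "cactus_class n [] = \<one>\<^bsub>cactus_group n\<^esub>" by (simp add: cactus_group_def)
  have "\<phi> \<one>\<^bsub>cactus_group n\<^esub> (fill w) = fill (fold sw [] w)" if "w \<in> X" for w
    using id_eq_one that by (metis fill_X restrict_apply' fold_Nil id_apply)
  then show ?case unfolding is_fold_def e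
    using group.is_monoid[OF group_cactus_group] monoid.one_closed by blast
next
  case (Cons x u)
  obtain i j where x: "x = (i, j)" by (cases x)
  then have g: "(i, j) \<in> cactus_gens n" using Cons.prems by simp
  have "1 < j" "j \<le> n" "1 < Suc (j - i)" "Suc (j - i) \<le> n" using g by (auto simp: cactus_gens_def)
  then have "is_fold (cactus_class n [(i, j)])"
    unfolding gen_factor[OF g] using is_fold_gen1 is_fold_mult by blast
  moreover have "is_fold (cactus_class n u)" using Cons by simp
  moreover have "cactus_class n (x # u) = cactus_class n [(i, j)] \<otimes>\<^bsub>cactus_group n\<^esub> cactus_class n u"
    using cactus_mult[of "[(i, j)]" n u] g Cons.prems x by simp
  ultimately show ?case using is_fold_mult by simp
qed

lemma orbit_iff_conn:
  assumes "A \<in> X" "B \<in> X" "C \<in> X" "D \<in> X"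
  shows "(fill C, fill D) \<in> orbit (cactus_group n) (diagonal_action \<phi>) (fill A, fill B) \<longleftrightarrow> conn A B C D"
proof
  assume "(fill C, fill D) \<in> orbit (cactus_group n) (diagonal_action \<phi>) (fill A, fill B)"
  then obtain g where g: "g \<in> carrier (cactus_group n)" "fill C = \<phi> g (fill A)" "fill D = \<phi> g (fill B)"
    unfolding orbit_def diagonal_action_def by auto
  obtain u where "u \<in> lists (cactus_gens n)" "g = cactus_class n u"
    using g(1) by (auto simp: cactus_group_def)
  then obtain ws where ws: "\<And>w. w \<in> X \<Longrightarrow> \<phi> g (fill w) = fill (fold sw ws w)"
    using is_fold_class unfolding is_fold_def by blast
  have "fill C = fill (fold sw ws A)" "fill D = fill (fold sw ws B)" using g ws assms by auto
  then have "C = fold sw ws A" "D = fold sw ws B" using fill_X_eq Tab_fold_sw assms by auto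
  then show "conn A B C D" unfolding conn_def by blast
next
  assume "conn A B C D"
  then obtain ws where ws: "fold sw ws A = C" "fold sw ws B = D" unfolding conn_def by blast
  obtain g where "g \<in> carrier (cactus_group n)" "\<And>w. w \<in> X \<Longrightarrow> \<phi> g (fill w) = fill (fold sw ws w)"
    using realized_fold_sw[of ws] unfolding realized_def by blast
  then show "(fill C, fill D) \<in> orbit (cactus_group n) (diagonal_action \<phi>) (fill A, fill B)"
    unfolding orbit_def diagonal_action_def using ws assms by force
qed

lemma transitive: "transitive_action (cactus_group n) (SYT lam) \<phi>"
proof unfold_locales
  fix x y assume "x \<in> SYT lam" "y \<in> SYT lam"
  then obtain A C where A: "A \<in> X" "x = fill A" and C: "C \<in> X" "y = fill C"
    using SYT_eq[OF part] by blast
  obtain ws where ws: "fold sw ws A = C" using Tab_connected A C by blast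
  obtain g where "g \<in> carrier (cactus_group n)" "\<And>w. w \<in> X \<Longrightarrow> \<phi> g (fill w) = fill (fold sw ws w)"
    using realized_fold_sw[of ws] unfolding realized_def by blast
  then show "\<exists>g\<in>carrier (cactus_group n). \<phi> g x = y" using A C ws by blast
qed

end


section \<open>Transposition and first rows in terms of boxes\<close>

lemma diagram_iff_le_card_column:
  assumes "partition_of lam n"
  shows "1 \<le> i \<and> i \<le> card {i. (i, j) \<in> diagram lam} \<longleftrightarrow> (i, j) \<in> diagram lam"
proof (cases "1 \<le> j")
  case False
  then have "{i. (i, j) \<in> diagram lam} = {}" "(i, j) \<notin> diagram lam" by (auto simp: diagram_def)
  then show ?thesis by simp
next
  case True
  let ?C = "{i. (i, j) \<in> diagram lam}"
  have S: "shape (cells lam)" by (rule shape_cells[OF assms])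
  have dn: "i' \<in> ?C" if "i \<in> ?C" "1 \<le> i'" "i' \<le> i" for i i'
  proof -
    have "(i - 1, j - 1) \<in> cells lam" using that True by (auto simp: diagram_def cells_def)
    then have "(i' - 1, j - 1) \<in> cells lam" using shape_down[OF S] that by (meson diff_le_mono order_refl)
    then show ?thesis using that True by (auto simp: diagram_def cells_def)
  qed
  have fin: "finite ?C" by (rule finite_subset[of _ "{..length lam}"]) (auto simp: diagram_def)
  have pos: "1 \<le> i" if "i \<in> ?C" for i using that by (simp add: diagram_def)
  have "?C = {1..card ?C}"
  proof (cases "?C = {}")
    case False
    have "?C = {1..Max ?C}"
    proof (intro equalityI subsetI)
      fix x assume "x \<in> ?C"
      then show "x \<in> {1..Max ?C}" using pos[of x] Max_ge[OF fin, of x] by (simp only: atLeastAtMost_iff)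
    next
      fix x assume "x \<in> {1..Max ?C}"
      then show "x \<in> ?C" using dn[OF Max_in[OF fin False], of x] by (simp only: atLeastAtMost_iff)
    qed
    then show ?thesis by (metis card_atLeastAtMost diff_Suc_1)
  qed simp
  then show ?thesis by (metis atLeastAtMost_iff mem_Collect_eq)
qed

lemma cells_diagram: "(i, j) \<in> cells lam \<longleftrightarrow> (Suc i, Suc j) \<in> diagram lam"
  by (auto simp: cells_def diagram_def)

text \<open>Equality of the two lists says that the first row is as long as the first column and
  that row and column \<open>j\<close> always have the same length. Since columns are initial
  intervals, their lengths determine the diagram.\<close>

lemma self_transpose_iff:
  assumes "partition_of lam n"
  shows "self_transpose lam \<longleftrightarrow> prod.swap ` cells lam = cells lam"
proof -
  have row: "{j. (i, j) \<in> diagram lam} = {1..lam ! (i - 1)}" if "1 \<le> i" "i \<le> length lam" for i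
    using that by (auto simp: diagram_def)
  have len: "{i. (i, 1) \<in> diagram lam} = {1..length lam}"
  proof -
    have "1 \<le> lam ! (i - 1)" if "1 \<le> i" "i \<le> length lam" for i
    proof -
      have "lam ! (i - 1) \<in> set lam" using that by simp
      then show ?thesis using assms unfolding partition_of_def by force
    qed
    then show ?thesis by (auto simp: diagram_def)
  qed
  show ?thesis
  proof
    assume st: "self_transpose lam"
    have L: "length lam = card {j. (1, j) \<in> diagram lam}"
      using arg_cong[OF st[unfolded self_transpose_def], of length]
      by (simp add: transpose_partition_def del: upt_Suc)
    have col: "card {i. (i, j) \<in> diagram lam} = lam ! (j - 1)" if "1 \<le> j" "j \<le> length lam" for j
    proof -
      have "lam ! (j - 1) = transpose_partition lam ! (j - 1)" using st by (simp add: self_transpose_def)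
      also have "\<dots> = card {i. (i, j) \<in> diagram lam}"
        unfolding transpose_partition_def using that L by (subst nth_map) (auto simp del: upt_Suc)
      finally show ?thesis by simp
    qed
    have sym: "(j, i) \<in> diagram lam" if h: "(i, j) \<in> diagram lam" for i j
    proof -
      have ij: "1 \<le> i" "1 \<le> j" "i \<le> length lam" "j \<le> lam ! (i - 1)" using h by (auto simp: diagram_def)
      have "1 \<le> i \<and> (1 \<le> j \<and> j \<le> length lam)"
      proof -
        have S: "shape (cells lam)" by (rule shape_cells[OF assms])
        have "(i - 1, j - 1) \<in> cells lam" using ij by (auto simp: cells_def)
        then have "(0, j - 1) \<in> cells lam" using shape_down[OF S] by blast
        then have "(1, j) \<in> diagram lam" using ij by (simp add: cells_diagram)
        moreover have r: "{j. (1, j) \<in> diagram lam} = {1..lam ! 0}" using row[of 1] ij(1,3) by simp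
        ultimately have "j \<le> card {j. (1, j) \<in> diagram lam}"
          unfolding r by (auto simp: diagram_def)
        then show ?thesis using L ij by simp
      qed
      moreover have "i \<le> lam ! (j - 1)"
        using diagram_iff_le_card_column[OF assms, of i j] h col[of j] calculation by simp
      ultimately show ?thesis by (simp add: diagram_def)
    qed
    have "(j, i) \<in> cells lam" if "(i, j) \<in> cells lam" for i j
      using sym[of "Suc i" "Suc j"] that by (simp add: cells_diagram)
    then show "prod.swap ` cells lam = cells lam" by force
  next
    assume sw: "prod.swap ` cells lam = cells lam"
    have sym: "(j, i) \<in> diagram lam \<longleftrightarrow> (i, j) \<in> diagram lam" for i j
    proof -
      have "(b, a) \<in> cells lam \<longleftrightarrow> (a, b) \<in> cells lam" for a b using mem_swap[of a b "cells lam"] sw by simp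
      then have "(j, i) \<in> diagram lam \<longleftrightarrow> (i, j) \<in> diagram lam" if "1 \<le> i" "1 \<le> j"
        using that cells_diagram[of "i - 1" "j - 1" lam] cells_diagram[of "j - 1" "i - 1" lam] by simp
      then show ?thesis by (auto simp: diagram_def)
    qed
    have flip: "{j. (i, j) \<in> diagram lam} = {j. (j, i) \<in> diagram lam}" for i using sym by blast
    have L: "card {j. (1, j) \<in> diagram lam} = length lam"
      unfolding flip len by simp
    have col: "card {i. (i, j) \<in> diagram lam} = lam ! (j - 1)" if "1 \<le> j" "j \<le> length lam" for j
      unfolding flip[symmetric] row[OF that] by simp
    show "self_transpose lam" unfolding self_transpose_def transpose_partition_def L
      by (rule nth_equalityI) (auto simp: col simp del: upt_Suc)
  qed
qed

lemma transpose_fill: "transpose_tableau (fill w) = fill (tr w)"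
proof (induction w)
  case (Cons c w)
  obtain i j where "c = (i, j)" by (cases c)
  then show ?case using Cons by (auto simp: transpose_tableau_def fun_eq_iff)
qed (auto simp: transpose_tableau_def fun_eq_iff)

text \<open>The box at position \<open>k\<close> carries the entry \<open>n - k\<close> in both
  tableaux, so shared entries correspond bijectively to positions at which both boxes lie in row
  0.\<close>

lemma card_shared_first_row:
  assumes p: "partition_of lam n" and A: "A \<in> Tab (cells lam)" and B: "B \<in> Tab (cells lam)"
  shows "card (shared_first_row lam (fill A) (fill B)) = shared A B"
proof -
  have n: "sum_list lam = n" using p by (simp add: partition_of_def)
  have mem: "n - k \<in> first_row lam (fill w) \<longleftrightarrow> fst (w ! k) = 0" if w: "w \<in> Tab (cells lam)" and k: "k < n" for w k
  proof -
    have l: "length w = n" "distinct w" "set w = cells lam"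
      using Tab_length[OF w] card_cells[OF p] w std_distinct by (auto simp: Tab_def)
    have "n - k \<in> first_row lam (fill w) \<longleftrightarrow> (\<exists>j. (0, j) \<in> set w \<and> fill w (box (0, j)) = n - k)"
    proof -
      have "n - k \<in> first_row lam (fill w) \<longleftrightarrow> (\<exists>j. (1, j) \<in> diagram lam \<and> fill w (1, j) = n - k)"
        unfolding first_row_def mem_Collect_eq by metis
      also have "\<dots> \<longleftrightarrow> (\<exists>j. (1, Suc j) \<in> diagram lam \<and> fill w (1, Suc j) = n - k)"
      proof
        assume "\<exists>j. (1, j) \<in> diagram lam \<and> fill w (1, j) = n - k"
        then obtain j where j: "(1, j) \<in> diagram lam" "fill w (1, j) = n - k" by blast
        moreover have "j = Suc (j - 1)" using j(1) by (simp add: diagram_def)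
        ultimately show "\<exists>j. (1, Suc j) \<in> diagram lam \<and> fill w (1, Suc j) = n - k" by metis
      qed blast
      finally show ?thesis using l by (simp add: cells_diagram)
    qed
    also have "\<dots> \<longleftrightarrow> fst (w ! k) = 0"
    proof
      assume "\<exists>j. (0, j) \<in> set w \<and> fill w (box (0, j)) = n - k"
      then obtain j m where m: "m < length w" "w ! m = (0, j)" "fill w (box (w ! m)) = n - k"
        by (metis in_set_conv_nth)
      then have "n - m = n - k" using fill_nth[OF l(2) m(1)] l by simp
      then show "fst (w ! k) = 0" using m k l by (metis diff_diff_cancel fst_conv less_imp_le_nat)
    next
      assume "fst (w ! k) = 0"
      then have "w ! k = (0, snd (w ! k))" by (simp add: prod_eq_iff)
      then show "\<exists>j. (0, j) \<in> set w \<and> fill w (box (0, j)) = n - k"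
        using fill_nth[OF l(2), of k] nth_mem[of k w] l k by metis
    qed
    finally show ?thesis .
  qed
  have l: "length A = n" "length B = n" using Tab_length A B card_cells[OF p] by auto
  let ?I = "{k. k < n \<and> fst (A ! k) = 0 \<and> fst (B ! k) = 0}"
  have "shared_first_row lam (fill A) (fill B) = (\<lambda>k. n - k) ` ?I"
  proof (intro equalityI subsetI)
    fix x assume "x \<in> shared_first_row lam (fill A) (fill B)"
    then have x: "1 \<le> x" "x \<le> n" "x \<in> first_row lam (fill A)" "x \<in> first_row lam (fill B)"
      by (auto simp: shared_first_row_def n)
    have e: "n - (n - x) = x" "n - x < n" using x by auto
    then have "n - x \<in> ?I" using mem[OF A e(2)] mem[OF B e(2)] x by simp
    then show "x \<in> (\<lambda>k. n - k) ` ?I" using e(1) by (metis (no_types, lifting) image_eqI)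
  next
    fix x assume "x \<in> (\<lambda>k. n - k) ` ?I"
    then obtain k where "k < n" "fst (A ! k) = 0" "fst (B ! k) = 0" "x = n - k" by auto
    then show "x \<in> shared_first_row lam (fill A) (fill B)"
      using mem[OF A] mem[OF B] by (auto simp: shared_first_row_def n)
  qed
  moreover have "inj_on (\<lambda>k. n - k) ?I" by (rule inj_onI) auto
  ultimately have "card (shared_first_row lam (fill A) (fill B)) = card ?I" by (simp add: card_image)
  also have "\<dots> = shared A B"
    unfolding shared_def length_filter_conv_card using l by (intro arg_cong[where f = card]) auto
  finally show ?thesis .
qed

text \<open>Both relations are preserved by words. Conversely, in a pair that is not generic the
  second component is determined by the first, so transitivity on single tableaux suffices.\<close>

lemma (in tableau_action) conn_self_transpose_iff:
  assumes X: "A \<in> X" "B \<in> X" "C \<in> X" "D \<in> X" and h: "(1, 1) \<in> cells lam" and sym: "prod.swap ` cells lam = cells lam"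
  shows "conn A B C D \<longleftrightarrow> (A = B \<longleftrightarrow> C = D) \<and> (tr A = B \<longleftrightarrow> tr C = D)"
proof
  assume "conn A B C D"
  then show "(A = B \<longleftrightarrow> C = D) \<and> (tr A = B \<longleftrightarrow> tr C = D)"
    unfolding conn_def by (metis fold_sw_inj fold_sw_tr)
next
  assume e: "(A = B \<longleftrightarrow> C = D) \<and> (tr A = B \<longleftrightarrow> tr C = D)"
  obtain ws where ws: "fold sw ws A = C" using Tab_connected X by blast
  show "conn A B C D"
  proof (cases "generic A B")
    case True
    then show ?thesis using generic_pairs_conn[OF X h] e by (auto simp: generic_def)
  next
    case False
    then have "A = B \<and> C = D \<or> B = tr A \<and> D = tr C" using e by (auto simp: generic_def)
    then show ?thesis unfolding conn_def using ws fold_sw_tr by blast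
  qed
qed

theorem theoremA:
  fixes n :: nat and lam :: "nat list"
    and \<phi> :: "(nat \<times> nat) list set \<Rightarrow> tableau \<Rightarrow> tableau"
  assumes "partition_of lam n"
    and "cactus_SYT_action n lam \<phi>"
  shows "transitive_action (cactus_group n) (SYT lam) \<phi>
    \<and> (\<not> hook_shaped lam \<and> \<not> self_transpose lam \<longrightarrow>
        (\<forall>A\<in>SYT lam. \<forall>B\<in>SYT lam. \<forall>C\<in>SYT lam. \<forall>D\<in>SYT lam. A \<noteq> B \<longrightarrow> C \<noteq> D \<longrightarrow>
          (C, D) \<in> orbit (cactus_group n) (diagonal_action \<phi>) (A, B)))
    \<and> (hook_shaped lam \<longrightarrow>
        (\<forall>A\<in>SYT lam. \<forall>B\<in>SYT lam. \<forall>C\<in>SYT lam. \<forall>D\<in>SYT lam.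
          (C, D) \<in> orbit (cactus_group n) (diagonal_action \<phi>) (A, B) \<longleftrightarrow>
          card (shared_first_row lam A B) = card (shared_first_row lam C D)))
    \<and> (self_transpose lam \<and> \<not> hook_shaped lam \<longrightarrow>
        (\<forall>A\<in>SYT lam. \<forall>B\<in>SYT lam. \<forall>C\<in>SYT lam. \<forall>D\<in>SYT lam.
          (C, D) \<in> orbit (cactus_group n) (diagonal_action \<phi>) (A, B) \<longleftrightarrow>
          (A = B \<longleftrightarrow> C = D) \<and> (transpose_tableau A = B \<longleftrightarrow> transpose_tableau C = D)))"
proof -
  interpret tableau_action n lam \<phi> using assms by unfold_locales
  note syt = SYT_eq[OF part]
  have hk: "hook_shaped lam \<longleftrightarrow> (1, 1) \<notin> cells lam"
    by (simp add: hook_shaped_def cells_diagram numeral_2_eq_2)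
  have 2: "\<forall>A\<in>SYT lam. \<forall>B\<in>SYT lam. \<forall>C\<in>SYT lam. \<forall>D\<in>SYT lam. A \<noteq> B \<longrightarrow> C \<noteq> D \<longrightarrow>
      (C, D) \<in> orbit (cactus_group n) (diagonal_action \<phi>) (A, B)"
    if h: "\<not> hook_shaped lam" "\<not> self_transpose lam"
  proof -
    have ns: "prod.swap ` cells lam \<noteq> cells lam" using self_transpose_iff[OF part] h(2) by blast
    \<comment> \<open>The transpose of \<open>A\<close> has a different shape from \<open>B\<close>,
      so distinct tableaux already form a generic pair.\<close>
    have "generic A B" if "A \<in> X" "B \<in> X" "A \<noteq> B" for A B
      using that Tab_tr[of A "cells lam"] ns by (auto simp: generic_def Tab_def)
    then have "conn A B C D" if "A \<in> X" "B \<in> X" "C \<in> X" "D \<in> X" "A \<noteq> B" "C \<noteq> D" for A B C D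
      using generic_pairs_conn that h(1) hk by blast
    then show ?thesis unfolding syt by (auto simp: orbit_iff_conn)
  qed
  have 3: "\<forall>A\<in>SYT lam. \<forall>B\<in>SYT lam. \<forall>C\<in>SYT lam. \<forall>D\<in>SYT lam.
      (C, D) \<in> orbit (cactus_group n) (diagonal_action \<phi>) (A, B) \<longleftrightarrow>
      card (shared_first_row lam A B) = card (shared_first_row lam C D)" if h: "hook_shaped lam"
    unfolding syt ball_simps(9)
    using hook_conn_iff h hk by (simp add: orbit_iff_conn card_shared_first_row[OF part])
  have 4: "\<forall>A\<in>SYT lam. \<forall>B\<in>SYT lam. \<forall>C\<in>SYT lam. \<forall>D\<in>SYT lam.
      (C, D) \<in> orbit (cactus_group n) (diagonal_action \<phi>) (A, B) \<longleftrightarrow>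
      (A = B \<longleftrightarrow> C = D) \<and> (transpose_tableau A = B \<longleftrightarrow> transpose_tableau C = D)"
    if h: "self_transpose lam" "\<not> hook_shaped lam"
  proof -
    have sym: "prod.swap ` cells lam = cells lam" using self_transpose_iff[OF part] h(1) by blast
    \<comment> \<open>Symmetry of the shape keeps \<open>tr w\<close> in \<open>X\<close>, where
      \<open>fill\<close> is injective.\<close>
    have t: "transpose_tableau (fill w) = fill v \<longleftrightarrow> tr w = v" if "w \<in> X" "v \<in> X" for v w
      using fill_X_eq[of "tr w" v] Tab_tr[OF that(1)] that sym by (simp add: transpose_fill)
    have "(1, 1) \<in> cells lam" using h(2) hk by simp
    then show ?thesis
      unfolding syt using conn_self_transpose_iff[OF _ _ _ _ _ sym]
      by (simp add: orbit_iff_conn fill_X_eq t)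
  qed
  show ?thesis
    by (intro conjI impI transitive; (elim conjE)?) (erule 2 3 4, assumption?)+
qed

end
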